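(* Suppose $T$ is an $\mathsf{O}$-reduced tableau with only one row for an involution $z \in I_\infty$ that has no descents greater than $n$. Let $i_1 < i_2 < i_3 < \cdots < i_k$ be the entries of the tableau obtained from $T$ by removing all primes, and define the weak composition $\alpha^{\mathsf{O}}(T) := k\,\mathbf{e}_{i_1} + \mathbf{e}_{i_2} + \mathbf{e}_{i_3} + \cdots + \mathbf{e}_{i_k}$. Then $\mathrm{BRF}^{\mathsf{O}}_n(T) \cong \mathrm{BRF}^{\mathsf{O}}_n(\alpha^{\mathsf{O}}(T))$ as $\mathfrak{q}^+_n$-crystals.
   Context: Notation. $I_\infty$ is the set of involutions of $\mathbb{P}=\{1,2,\dots\}$ moving finitely many points; $i$ is a descent of $z$ if $z(i)>z(i+1)$. $\mathbf{e}_i$ is the $i$-th standard basis vector; weak compositions are finitely supported sequences in $\mathbb{N}$. Primed numbers are elements of $\mathbb{Z}' = \mathbb{Z}-\tfrac12$, written $x' = x - \tfrac12$, with $1'<1<2'<2<\cdots$; $\lceil\cdot\rceil$ removes primes. For $i\in\mathbb{Z}$, $s_i=s_{i'}=(i\ i{+}1)$. Primed involution words. A primed word $i_1\cdots i_\ell$ belongs to $\mathcal{R}^{\mathsf{O}}(z)$ iff, setting $z_1=1$ and $z_{j+1}=s_{i_j}z_j$ if $z_j$ preserves $\{\lceil i_j\rceil,\lceil i_j\rceil+1\}$ and $z_{j+1}=s_{i_j}z_js_{i_j}$ otherwise, one has $z_{\ell+1}=z$, $z_j(\lceil i_j\rceil)<z_j(\lceil i_j\rceil+1)$ for all $j$,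 and whenever $i_j$ is primed both $\lceil i_j\rceil$ and $\lceil i_j\rceil+1$ are fixed by $z_j$. Orthogonal Coxeter--Knuth equivalence $\overset{\mathsf{O}}{\sim}$ is generated by: $\cdots ACB\cdots\sim\cdots CAB\cdots$ and $\cdots BCA\cdots\sim\cdots BAC\cdots$ when $\lceil A\rceil<\lceil B\rceil<\lceil C\rceil$; for $a,b\in\mathbb{Z}$ with $|a-b|=1$: $aba\sim bab$, $a'b'a'\sim b'a'b'$, $a'ba\sim bab'$, $ab'a\sim ba'b$, $a'b'a\sim ba'b'$, $a'ba'\sim b'ab'$ (in any position); and, affecting only the first letters of a word, $a\cdots\sim a'\cdots$, $ab\cdots\sim ba\cdots$, $ab'\cdots\sim ba'\cdots$, $a'b\cdots\sim b'a\cdots$, $a'b'\cdots\sim b'a'\cdots$ for all $a,b\in\mathbb{Z}$. $\mathsf{O}$-reduced tableaux. An $\mathsf{O}$-reduced tableau for $z$ is a shifted tableau with no primed entries on the main diagonal, with strictly increasing rows and columns or strictly decreasing rows and columns, whose row reading word (rows read left to right, starting from the last row) lies in $\mathcal{R}^{\mathsf{O}}(z)$. Crystals. $\mathrm{RF}^{\mathsf{O}}_n(z)$ is the set of tuples $a=(a^1,\dots,a^n)$ of strictly decreasing primed words with $a^1a^2\cdots a^n\in\mathcal{R}^{\mathsf{O}}(z)$, with weight $(\ell(a^1),\dots,\ell(a^n))$; it carries the normal $\mathfrak{q}^+_n$-crystal structure of Marberg--Tong (operators $e_i,f_i$ for $i\in[n-1]$ given by the Morse--Schilling pairing rule on consecutive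 factors with swapping of primes on paired letters; $e_{\bar1},f_{\bar1}$ moving the maximal letter between the first two factors and toggling primes; $e_{1'},f_{1'}$ removing/adding a prime on $\max(a^1)$; the remaining operators obtained by conjugating with the Weyl group action $\sigma_i$). $\mathrm{RF}^{\mathsf{O}}_n(T)$ is the subset with $a^1\cdots a^n\overset{\mathsf{O}}{\sim}\mathrm{row}(T)$, and $\mathrm{BRF}^{\mathsf{O}}_n(T)$ is its subset of factorizations bounded by the standard flag, i.e. every letter $m$ in $a^i$ satisfies $i\le\lceil m\rceil$. For a symmetric weak composition $\alpha$ (i.e. $\lambda(\alpha)$, the sorted partition, equals its transpose) with $u(\alpha)\in S_n$, where $u(\alpha)$ is the shortest permutation with $\alpha=u(\alpha)\lambda(\alpha)$, define $\mathrm{BRF}^{\mathsf{O}}_n(\alpha):=\mathfrak{D}_{j_1}\cdots\mathfrak{D}_{j_m}\,\mathrm{BRF}^{\mathsf{O}}_n(w_{\lambda(\alpha)})$, where $w_\lambda$ is the dominant (132-avoiding) permutation whose Rothe diagram is the Young diagram of $\lambda$, $j_1\cdots j_m$ is a reduced word for $u(\alpha)$, and $\mathfrak{D}_j\mathcal{X}=\{b\in\mathrm{RF}^{\mathsf{O}}_n(w_{\lambda}) : e_j^kb\in\mathcal{X}\text{ for some }k\ge0\}$ is the crystal Demazure operator. *)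

theory Defs
  imports Complex_Main "HOL-Combinatorics.Permutations"
begin

section \<open>Primed letters and permutations\<close>

text \<open>The primed number \<open>x'\<close> is the real number \<open>x - 1/2\<close>, so that the order is the one of the
  reals and removing primes is the ceiling function.  Permutations of the positive integers are
  functions on \<^typ>\<open>nat\<close> fixing \<open>0\<close>.\<close>

definition is_letter :: "real \<Rightarrow> bool" where
  "is_letter x \<longleftrightarrow> x > 0 \<and> (x \<in> \<int> \<or> x + 1/2 \<in> \<int>)"

definition is_primed :: "real \<Rightarrow> bool" where
  "is_primed x \<longleftrightarrow> x \<notin> \<int>"

definition prm :: "int \<Rightarrow> real" where
  "prm a = of_int a - 1/2"

definition S_inf :: "(nat \<Rightarrow> nat) set" where
  "S_inf = {w. w permutes {1..} \<and> finite {i. w i \<noteq> i}}"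

definition I_inf :: "(nat \<Rightarrow> nat) set" where
  "I_inf = {z \<in> S_inf. z \<circ> z = id}"

definition descent :: "(nat \<Rightarrow> nat) \<Rightarrow> nat \<Rightarrow> bool" where
  "descent z i \<longleftrightarrow> 1 \<le> i \<and> z i > z (i + 1)"

definition simple_refl :: "nat \<Rightarrow> nat \<Rightarrow> nat" where
  "simple_refl i = transpose i (i + 1)"

section \<open>Primed involution words and orthogonal Coxeter--Knuth equivalence\<close>

definition invol_step :: "(nat \<Rightarrow> nat) \<Rightarrow> nat \<Rightarrow> nat \<Rightarrow> nat" where
  "invol_step z i =
     (if z ` {i, i + 1} = {i, i + 1} then simple_refl i \<circ> z
      else simple_refl i \<circ> z \<circ> simple_refl i)"

text \<open>\<open>invol_path y w z\<close>: reading the word \<open>w\<close> from the left leads from \<open>z\<^sub>j = y\<close> to \<open>z\<close>,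
  subject to the conditions imposed on each letter.\<close>

fun invol_path :: "(nat \<Rightarrow> nat) \<Rightarrow> real list \<Rightarrow> (nat \<Rightarrow> nat) \<Rightarrow> bool" where
  "invol_path y [] z \<longleftrightarrow> y = z"
| "invol_path y (x # w) z \<longleftrightarrow>
     is_letter x \<and>
     (let i = nat \<lceil>x\<rceil> in
        y i < y (i + 1) \<and>
        (is_primed x \<longrightarrow> y i = i \<and> y (i + 1) = i + 1) \<and>
        invol_path (invol_step y i) w z)"

definition R_O :: "(nat \<Rightarrow> nat) \<Rightarrow> real list set" where
  "R_O z = {w. invol_path id w z}"

inductive ock_step :: "real list \<Rightarrow> real list \<Rightarrow> bool" where
  knuth1: "\<lceil>A\<rceil> < \<lceil>B\<rceil> \<Longrightarrow> \<lceil>B\<rceil> < \<lceil>C\<rceil> \<Longrightarrow> ock_step (u @ [A, C, B] @ v) (u @ [C, A, B] @ v)"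
| knuth2: "\<lceil>A\<rceil> < \<lceil>B\<rceil> \<Longrightarrow> \<lceil>B\<rceil> < \<lceil>C\<rceil> \<Longrightarrow> ock_step (u @ [B, C, A] @ v) (u @ [B, A, C] @ v)"
| braid1: "\<bar>a - b\<bar> = 1 \<Longrightarrow>
    ock_step (u @ [of_int a, of_int b, of_int a] @ v) (u @ [of_int b, of_int a, of_int b] @ v)"
| braid2: "\<bar>a - b\<bar> = 1 \<Longrightarrow>
    ock_step (u @ [prm a, prm b, prm a] @ v) (u @ [prm b, prm a, prm b] @ v)"
| braid3: "\<bar>a - b\<bar> = 1 \<Longrightarrow>
    ock_step (u @ [prm a, of_int b, of_int a] @ v) (u @ [of_int b, of_int a, prm b] @ v)"
| braid4: "\<bar>a - b\<bar> = 1 \<Longrightarrow>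
    ock_step (u @ [of_int a, prm b, of_int a] @ v) (u @ [of_int b, prm a, of_int b] @ v)"
| braid5: "\<bar>a - b\<bar> = 1 \<Longrightarrow>
    ock_step (u @ [prm a, prm b, of_int a] @ v) (u @ [of_int b, prm a, prm b] @ v)"
| braid6: "\<bar>a - b\<bar> = 1 \<Longrightarrow>
    ock_step (u @ [prm a, of_int b, prm a] @ v) (u @ [prm b, of_int a, prm b] @ v)"
| init1: "ock_step (of_int a # v) (prm a # v)"
| init2: "ock_step ([of_int a, of_int b] @ v) ([of_int b, of_int a] @ v)"
| init3: "ock_step ([of_int a, prm b] @ v) ([of_int b, prm a] @ v)"
| init4: "ock_step ([prm a, of_int b] @ v) ([prm b, of_int a] @ v)"
| init5: "ock_step ([prm a, prm b] @ v) ([prm b, prm a] @ v)"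

abbreviation ock_equiv :: "real list \<Rightarrow> real list \<Rightarrow> bool" where
  "ock_equiv \<equiv> equivclp ock_step"

section \<open>Orthogonal reduced tableaux\<close>

text \<open>A shifted tableau is the list of its rows; row \<open>i\<close> (from \<open>0\<close>) occupies the boxes \<open>(i, j)\<close>
  with \<open>i \<le> j < i + length (T ! i)\<close>, so the diagonal entries are the first entries of the rows.\<close>

definition shifted_tableau :: "real list list \<Rightarrow> bool" where
  "shifted_tableau T \<longleftrightarrow>
     [] \<notin> set T \<and> sorted_wrt (>) (map length T) \<and> (\<forall>r\<in>set T. \<forall>x\<in>set r. is_letter x)"

definition entry :: "real list list \<Rightarrow> nat \<Rightarrow> nat \<Rightarrow> real" where
  "entry T i j = T ! i ! (j - i)"

definition rows_columns_sorted :: "(real \<Rightarrow> real \<Rightarrow> bool) \<Rightarrow> real list list \<Rightarrow> bool" where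
  "rows_columns_sorted R T \<longleftrightarrow>
     (\<forall>r\<in>set T. sorted_wrt R r) \<and>
     (\<forall>i j. i + 1 < length T \<and> i + 1 \<le> j \<and> j < i + 1 + length (T ! (i + 1)) \<longrightarrow>
        R (entry T i j) (entry T (i + 1) j))"

definition row_word :: "real list list \<Rightarrow> real list" where
  "row_word T = concat (rev T)"

definition O_reduced_tableau :: "(nat \<Rightarrow> nat) \<Rightarrow> real list list \<Rightarrow> bool" where
  "O_reduced_tableau z T \<longleftrightarrow>
     shifted_tableau T \<and>
     (\<forall>i<length T. \<not> is_primed (entry T i i)) \<and>
     (rows_columns_sorted (<) T \<or> rows_columns_sorted (>) T) \<and>
     row_word T \<in> R_O z"

section \<open>Factorizations\<close>

type_synonym factorization = "real list list"

definition RF_O :: "nat \<Rightarrow> (nat \<Rightarrow> nat) \<Rightarrow> factorization set" where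
  "RF_O n z = {a. length a = n \<and> (\<forall>w\<in>set a. sorted_wrt (>) w) \<and> concat a \<in> R_O z}"

definition weight :: "factorization \<Rightarrow> nat list" where
  "weight a = map length a"

text \<open>The factor \<open>a\<^sup>i\<close> is \<open>a ! (i - 1)\<close>.\<close>

definition flag_bounded :: "factorization \<Rightarrow> bool" where
  "flag_bounded a \<longleftrightarrow> (\<forall>i\<in>{1..length a}. \<forall>m\<in>set (a ! (i - 1)). int i \<le> \<lceil>m\<rceil>)"

definition BRF_O :: "nat \<Rightarrow> (nat \<Rightarrow> nat) \<Rightarrow> factorization set" where
  "BRF_O n z = {a \<in> RF_O n z. flag_bounded a}"

definition RF_O_tab :: "nat \<Rightarrow> (nat \<Rightarrow> nat) \<Rightarrow> real list list \<Rightarrow> factorization set" where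
  "RF_O_tab n z T = {a \<in> RF_O n z. ock_equiv (concat a) (row_word T)}"

definition BRF_O_tab :: "nat \<Rightarrow> (nat \<Rightarrow> nat) \<Rightarrow> real list list \<Rightarrow> factorization set" where
  "BRF_O_tab n z T = {a \<in> RF_O_tab n z T. flag_bounded a}"

section \<open>Crystal operators\<close>

text \<open>\<open>prime_as u v\<close> is the letter \<open>u\<close> with its prime replaced by that of \<open>v\<close>.\<close>

definition prime_as :: "real \<Rightarrow> real \<Rightarrow> real" where
  "prime_as u v = of_int \<lceil>u\<rceil> - (of_int \<lceil>v\<rceil> - v)"

definition dec_word :: "real set \<Rightarrow> real list" where
  "dec_word S = rev (sorted_list_of_set S)"

text \<open>Morse--Schilling pairing of a decreasing word (read from its largest letter) with the set of
  letters of the next factor: each letter is paired with the smallest available larger one.\<close>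

fun ms_pairs :: "real list \<Rightarrow> real set \<Rightarrow> (real \<times> real) set" where
  "ms_pairs [] V = {}"
| "ms_pairs (u # us) V =
     (let W = {v \<in> V. \<lceil>u\<rceil> < \<lceil>v\<rceil>} in
      if W = {} then ms_pairs us V
      else insert (u, Min W) (ms_pairs us (V - {Min W})))"

text \<open>The largest unpaired letter of the right factor moves to the left factor, increased by the
  least amount \<open>d\<close> that avoids the letters already there.  For \<open>d = 1\<close> and two adjacent generators,
  this is the move \<open>(a)(ba) \<mapsto> (ba)(b)\<close>, whose effect on primes by the braid relations is to swap
  those of the paired letters.  Only the paired letters met by the moved letter swap primes.\<close>

definition raise_factors :: "real list \<Rightarrow> real list \<Rightarrow> (real list \<times> real list) option" where
  "raise_factors U V =
     (let P = ms_pairs U (set V); F = set V - snd ` P in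
      if F = {} then None
      else
        let x = Max F;
            d = (LEAST d. \<lceil>x\<rceil> + int d \<notin> ceiling ` set U);
            Q = {(u, v) \<in> P. \<lceil>x\<rceil> \<le> \<lceil>u\<rceil> \<and> \<lceil>u\<rceil> < \<lceil>x\<rceil> + int d}
        in Some (dec_word ((set U - fst ` Q) \<union> (\<lambda>(u, v). prime_as u v) ` Q \<union> {x + real d}),
                 dec_word ((set V - snd ` Q - {x}) \<union> (\<lambda>(u, v). prime_as v u) ` Q)))"

definition lower_factors :: "real list \<Rightarrow> real list \<Rightarrow> (real list \<times> real list) option" where
  "lower_factors U V =
     (let P = ms_pairs U (set V); F = set U - fst ` P in
      if F = {} then None
      else
        let x = Min F;
            d = (LEAST d. \<lceil>x\<rceil> - int d \<notin> ceiling ` set V);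
            Q = {(u, v) \<in> P. \<lceil>x\<rceil> - int d < \<lceil>v\<rceil> \<and> \<lceil>v\<rceil> \<le> \<lceil>x\<rceil>}
        in Some (dec_word ((set U - fst ` Q - {x}) \<union> (\<lambda>(u, v). prime_as u v) ` Q),
                 dec_word ((set V - snd ` Q) \<union> (\<lambda>(u, v). prime_as v u) ` Q \<union> {x - real d})))"

definition on_factors ::
  "(real list \<Rightarrow> real list \<Rightarrow> (real list \<times> real list) option) \<Rightarrow> nat \<Rightarrow> factorization
     \<Rightarrow> factorization option" where
  "on_factors g i a =
     (if 1 \<le> i \<and> i < length a
      then map_option (\<lambda>(U, V). a[i - 1 := U, i := V]) (g (a ! (i - 1)) (a ! i))
      else None)"

definition e_num :: "nat \<Rightarrow> factorization \<Rightarrow> factorization option" where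
  "e_num = on_factors raise_factors"

definition f_num :: "nat \<Rightarrow> factorization \<Rightarrow> factorization option" where
  "f_num = on_factors lower_factors"

text \<open>The moved maximal letter exchanges its prime with the other leading letter of the first
  factor, as in the relations on the first two letters of a word.\<close>

fun raise_bar :: "real list \<Rightarrow> real list \<Rightarrow> (real list \<times> real list) option" where
  "raise_bar U [] = None"
| "raise_bar [] (x # V) = Some ([x], V)"
| "raise_bar (w # U) (x # V) =
     (if \<lceil>w\<rceil> < \<lceil>x\<rceil> then Some (prime_as x w # prime_as w x # U, V) else None)"

definition lower_bar :: "real list \<Rightarrow> real list \<Rightarrow> (real list \<times> real list) option" where
  "lower_bar U V =
     (case U of
        [] \<Rightarrow> None
      | x # U' \<Rightarrow>
          if V = [] \<or> \<lceil>hd V\<rceil> < \<lceil>x\<rceil> then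
            (case U' of
               [] \<Rightarrow> Some ([], x # V)
             | w # U'' \<Rightarrow> Some (prime_as w x # U'', prime_as x w # V))
          else None)"

fun raise_prime :: "factorization \<Rightarrow> factorization option" where
  "raise_prime ((x # w) # a) = (if is_primed x then Some ((of_int \<lceil>x\<rceil> # w) # a) else None)"
| "raise_prime a = None"

fun lower_prime :: "factorization \<Rightarrow> factorization option" where
  "lower_prime ((x # w) # a) = (if is_primed x then None else Some ((prm \<lceil>x\<rceil> # w) # a))"
| "lower_prime a = None"

definition opt_iter :: "('a \<Rightarrow> 'a option) \<Rightarrow> nat \<Rightarrow> 'a \<Rightarrow> 'a option" where
  "opt_iter g k a = ((\<lambda>b. Option.bind b g) ^^ k) (Some a)"

text \<open>The Weyl group action reverses \<open>i\<close>-strings.\<close>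

definition sigma :: "nat \<Rightarrow> factorization \<Rightarrow> factorization" where
  "sigma i a =
     (let p = length (a ! (i - 1)); q = length (a ! i) in
      the (if q \<le> p then opt_iter (f_num i) (p - q) a else opt_iter (e_num i) (q - p) a))"

text \<open>Conjugation of the operators with index \<open>1\<close> by the shortest permutation taking \<open>i, i + 1\<close> to
  \<open>1, 2\<close>, respectively by the one taking \<open>i\<close> to \<open>1\<close>, one index at a time.\<close>

fun bar_conj ::
  "(factorization \<Rightarrow> factorization option) \<Rightarrow> nat \<Rightarrow> factorization \<Rightarrow> factorization option" where
  "bar_conj g 0 a = None"
| "bar_conj g (Suc 0) a = g a"
| "bar_conj g (Suc (Suc i)) a =
     map_option (sigma (Suc i) \<circ> sigma (Suc (Suc i)))
       (bar_conj g (Suc i) (sigma (Suc (Suc i)) (sigma (Suc i) a)))"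

fun prime_conj ::
  "(factorization \<Rightarrow> factorization option) \<Rightarrow> nat \<Rightarrow> factorization \<Rightarrow> factorization option" where
  "prime_conj g 0 a = None"
| "prime_conj g (Suc 0) a = g a"
| "prime_conj g (Suc (Suc i)) a =
     map_option (sigma (Suc i)) (prime_conj g (Suc i) (sigma (Suc i) a))"

datatype crystal_index = Num nat | Bar nat | Prime nat

definition crystal_indices :: "nat \<Rightarrow> crystal_index set" where
  "crystal_indices n = Num ` {1..<n} \<union> Bar ` {1..<n} \<union> Prime ` {1..n}"

fun e_op :: "crystal_index \<Rightarrow> factorization \<Rightarrow> factorization option" where
  "e_op (Num i) a = e_num i a"
| "e_op (Bar i) a = bar_conj (on_factors raise_bar 1) i a"
| "e_op (Prime i) a = prime_conj raise_prime i a"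

fun f_op :: "crystal_index \<Rightarrow> factorization \<Rightarrow> factorization option" where
  "f_op (Num i) a = f_num i a"
| "f_op (Bar i) a = bar_conj (on_factors lower_bar 1) i a"
| "f_op (Prime i) a = prime_conj lower_prime i a"

text \<open>Subsets of a crystal carry the induced structure, in which an operator is zero when its value
  leaves the subset.\<close>

definition q_crystal_iso :: "nat \<Rightarrow> factorization set \<Rightarrow> factorization set \<Rightarrow> bool" where
  "q_crystal_iso n X Y \<longleftrightarrow>
     (\<exists>\<phi>. bij_betw \<phi> X Y \<and>
        (\<forall>a\<in>X. weight (\<phi> a) = weight a) \<and>
        (\<forall>\<iota>\<in>crystal_indices n. \<forall>a\<in>X. \<forall>b\<in>X.
           (e_op \<iota> a = Some b \<longleftrightarrow> e_op \<iota> (\<phi> a) = Some (\<phi> b)) \<and>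
           (f_op \<iota> a = Some b \<longleftrightarrow> f_op \<iota> (\<phi> a) = Some (\<phi> b))))"

section \<open>Weak compositions and Demazure crystals\<close>

text \<open>Weak compositions and partitions are functions on \<^typ>\<open>nat\<close> vanishing at \<open>0\<close>.\<close>

definition sort_comp :: "(nat \<Rightarrow> nat) \<Rightarrow> nat \<Rightarrow> nat" where
  "sort_comp \<alpha> p =
     (let xs = rev (sort (map \<alpha> (sorted_list_of_set {i. \<alpha> i \<noteq> 0}))) in
      if 1 \<le> p \<and> p \<le> length xs then xs ! (p - 1) else 0)"

definition perm_length :: "(nat \<Rightarrow> nat) \<Rightarrow> nat" where
  "perm_length w = card {(i, j). 1 \<le> i \<and> i < j \<and> w i > w j}"

text \<open>A permutation \<open>u\<close> moves the part in position \<open>i\<close> to position \<open>u i\<close>.\<close>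

definition u_perm :: "(nat \<Rightarrow> nat) \<Rightarrow> nat \<Rightarrow> nat" where
  "u_perm \<alpha> = (ARG_MIN perm_length u. u \<in> S_inf \<and> \<alpha> = sort_comp \<alpha> \<circ> inv u)"

definition reduced_words :: "(nat \<Rightarrow> nat) \<Rightarrow> nat list set" where
  "reduced_words u =
     {js. set js \<subseteq> {1..} \<and> foldr (\<lambda>j w. simple_refl j \<circ> w) js id = u \<and> length js = perm_length u}"

definition rothe_diagram :: "(nat \<Rightarrow> nat) \<Rightarrow> (nat \<times> nat) set" where
  "rothe_diagram w = {(i, w j) | i j. 1 \<le> i \<and> i < j \<and> w i > w j}"

definition young_diagram :: "(nat \<Rightarrow> nat) \<Rightarrow> (nat \<times> nat) set" where
  "young_diagram l = {(i, j). 1 \<le> i \<and> 1 \<le> j \<and> j \<le> l i}"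

definition dominant :: "(nat \<Rightarrow> nat) \<Rightarrow> bool" where
  "dominant w \<longleftrightarrow> \<not> (\<exists>i j k. 1 \<le> i \<and> i < j \<and> j < k \<and> w i < w k \<and> w k < w j)"

definition w_dom :: "(nat \<Rightarrow> nat) \<Rightarrow> nat \<Rightarrow> nat" where
  "w_dom l = (THE w. w \<in> S_inf \<and> dominant w \<and> rothe_diagram w = young_diagram l)"

definition demazure :: "nat \<Rightarrow> (nat \<Rightarrow> nat) \<Rightarrow> nat \<Rightarrow> factorization set \<Rightarrow> factorization set" where
  "demazure n z j X = {b \<in> RF_O n z. \<exists>k. \<exists>c\<in>X. opt_iter (e_num j) k b = Some c}"

text \<open>The word \<open>js\<close> is meant to be a reduced word of \<open>u_perm \<alpha>\<close>.\<close>

definition BRF_O_comp :: "nat \<Rightarrow> (nat \<Rightarrow> nat) \<Rightarrow> nat list \<Rightarrow> factorization set" where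
  "BRF_O_comp n \<alpha> js =
     (let w = w_dom (sort_comp \<alpha>) in foldr (demazure n w) js (BRF_O n w))"

definition unit_comp :: "nat \<Rightarrow> nat \<Rightarrow> nat" where
  "unit_comp i p = (if p = i then 1 else 0)"

definition alpha_O :: "real list list \<Rightarrow> nat \<Rightarrow> nat" where
  "alpha_O T p =
     (let is = sorted_list_of_set ((\<lambda>x. nat \<lceil>x\<rceil>) ` (\<Union>r\<in>set T. set r)); k = length is in
      k * unit_comp (is ! 0) p + (\<Sum>j = 1..<k. unit_comp (is ! j) p))"

end

(*
  Both crystals consist of factorizations of "fans", words in which every letter exceeds all
  previous letters or is smaller than all of them. The words equivalent to the row word of T are
  the fans on the set I of its entries: the relations only permute a letter going up with an
  adjacent letter going down, or the first two letters, and the prime of a non-first letter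
  belongs to the gap of I that the letter closes. For the hook shape (k, 1, ..., 1) the dominant
  permutation is the transposition of 1 and k + 1, whose words are the fans on {1, ..., k} with at
  most the first letter primed. Since the letters of a fan are distinct, crystal operators move
  letters without changing them, so that replacing the letters by their ranks in I and erasing the
  primes of all but the first letter commutes with all operators. The flag condition on the fans
  on I becomes the bound "the letter t of {1, ..., k} lies in a factor whose index is at most the
  t-th element of I", and applying a Demazure operator to the set defined by such bounds replaces
  I by s_j(I) whenever j is in I and j + 1 is not. A reduced word of u(alpha) takes
  {1, ..., k} to I by such steps only, because its length is the difference of the sums of the
  two sets.
*)

theory Submission
  imports Defs
begin

section \<open>Fans and their factorizations\<close>

text \<open>A prefix of a fan on I fills an interval of I, so each gap of I is closed exactly once:
  by its upper end going up or by its lower end going down. Naming the gap by its upper end in both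
  cases makes H independent of the order of reading. A prime then stays with its gap although it may
  sit on either of two letters, and H restores every erased prime except the first. The operators
  involve partial iterations (\<open>the\<close> in \<open>sigma\<close>) and conjugations, and they
  may leave the flag-bounded sets. Hence everything about them is proved on the larger sets
  \<open>fans\<close>, and flags enter only at the end, as bounds on images under standardization.
  On the Demazure side u(alpha) is never computed: the image of {1..k} and an upper bound for the
  length suffice, because a simple reflection raises the sum of a finite set by at most one.\<close>

definition cl :: "real \<Rightarrow> nat" where
  "cl x = nat \<lceil>x\<rceil>"

text \<open>In \<open>fan H S w\<close> the set \<open>S\<close> contains the letters read before \<open>w\<close>. A new maximum \<open>c\<close> closes
  the gap below \<open>c\<close>, a new minimum the one below \<open>Min S\<close>; the gap is named by its upper end, and
  \<open>H\<close> tells whether it carries a prime. The prime of the first letter is free.\<close>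

fun fan :: "(nat \<Rightarrow> bool) \<Rightarrow> nat set \<Rightarrow> real list \<Rightarrow> bool" where
  "fan H S [] \<longleftrightarrow> True"
| "fan H S (x # w) \<longleftrightarrow> is_letter x \<and>
     ((\<forall>y\<in>S. y < cl x) \<and> (S \<noteq> {} \<longrightarrow> is_primed x = H (cl x)) \<or>
      (\<forall>y\<in>S. cl x < y) \<and> (S \<noteq> {} \<longrightarrow> is_primed x = H (Min S))) \<and>
     fan H (insert (cl x) S) w"

lemma ceiling_letter: "is_letter x \<Longrightarrow> \<lceil>x\<rceil> = int (cl x)"
  unfolding is_letter_def cl_def by (simp add: le_ceiling_iff order_less_imp_le)

lemma cl_letter_pos: "is_letter x \<Longrightarrow> 1 \<le> cl x"
  unfolding is_letter_def cl_def by (simp add: le_ceiling_iff Suc_le_eq)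

lemma letter_gap: 
  assumes "is_letter x" 
  shows "x = of_int \<lceil>x\<rceil> - (if is_primed x then 1/2 else 0)"
proof (cases "x \<in> \<int>")
  case True
  then show ?thesis by (auto simp: is_primed_def Ints_def)
next
  case False
  with assms have "x + 1/2 \<in> \<int>" by (auto simp: is_letter_def)
  then obtain m where m: "x + 1/2 = of_int m" by (auto simp: Ints_def)
  then have "\<lceil>x\<rceil> = m" by (intro ceiling_unique) auto
  with m False show ?thesis by (auto simp: is_primed_def)
qed

lemma letter_eqI:
  assumes "is_letter x" "is_letter y" "cl x = cl y" "is_primed x = is_primed y"
  shows "x = y"
  using assms letter_gap[of x] letter_gap[of y] by (simp add: ceiling_letter)

lemma cl_mono: "x \<le> y \<Longrightarrow> cl x \<le> cl y"
  unfolding cl_def by (intro nat_mono ceiling_mono)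

lemma cl_less_imp: "cl x < cl y \<Longrightarrow> x < y"
  using cl_mono[of y x] by linarith

lemma fan_append: "fan H S (u @ v) \<longleftrightarrow> fan H S u \<and> fan H (S \<union> cl ` set u) v"
  by (induction u arbitrary: S) auto

lemma fan_letter: "fan H S w \<Longrightarrow> x \<in> set w \<Longrightarrow> is_letter x"
  by (induction w arbitrary: S) auto

text \<open>The set of letters already read only grows along the word, so a letter that is extreme
  when it is read is extreme with respect to every earlier set.\<close>

lemma fan_mem:
  "fan H S w \<Longrightarrow> y \<in> set w \<Longrightarrow> (\<forall>s\<in>S. s < cl y) \<or> (\<forall>s\<in>S. cl y < s)"
proof (induction w arbitrary: S)
  case (Cons x w)
  show ?case
  proof (cases "y = x")
    case True
    then show ?thesis using Cons.prems(1) by auto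
  next
    case False
    then show ?thesis using Cons.IH[of "insert (cl x) S"] Cons.prems by auto
  qed
qed simp

lemma fan_disjoint: "fan H S w \<Longrightarrow> y \<in> set w \<Longrightarrow> cl y \<notin> S"
  using fan_mem by blast

lemma fan_distinct: "fan H S w \<Longrightarrow> distinct (map cl w)"
proof (induction w arbitrary: S)
  case (Cons x w)
  then show ?case using fan_disjoint[of H "insert (cl x) S" w] by force
qed simp

lemma dec_word_eq: "sorted_wrt (>) w \<Longrightarrow> A = set w \<Longrightarrow> dec_word A = w"
proof -
  assume w: "sorted_wrt (>) w" and A: "A = set w"
  have "sorted_wrt (<) (rev w)" using w by (simp add: sorted_wrt_rev)
  then have "sorted (rev w)" "distinct (rev w)" by (simp_all only: strict_sorted_iff)
  then have "sorted_list_of_set (set (rev w)) = rev w"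
    by (rule sorted_list_of_set.idem_if_sorted_distinct)
  with A show ?thesis by (simp add: dec_word_def)
qed

section \<open>Crystal operators on fans\<close>

text \<open>In a fan, every letter of a decreasing factor except possibly its first one is a new minimum.
  Hence two consecutive factors have at most one pair, and operators move letters unchanged.\<close>

definition has_up :: "real list \<Rightarrow> real list \<Rightarrow> bool" where
  "has_up U V \<longleftrightarrow> U \<noteq> [] \<and> V \<noteq> [] \<and> cl (hd U) < cl (hd V)"

text \<open>A head of \<open>V\<close> above one letter of \<open>U\<close> is a new maximum. The
  rest of \<open>V\<close> lies below that head, so its letters can only be new minima, below all of
  \<open>U\<close>.\<close>

lemma has_up_bounds:
  assumes "fan H S (U @ V)" "sorted_wrt (>) V" "has_up U V" "u \<in> set U"
  shows "cl u < cl (hd V)" "x \<in> set (tl V) \<Longrightarrow> cl x < cl u"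
proof -
  from assms(3) obtain v V' where V: "V = v # V'" and U: "U \<noteq> []" "cl (hd U) < cl v"
    by (cases V) (auto simp: has_up_def)
  have f: "fan H (S \<union> cl ` set U) (v # V')" using assms(1) V fan_append by blast
  have "hd U \<in> set U" using U by simp
  then show "cl u < cl (hd V)" using f U assms(4) V
    by (metis UnI2 fan.simps(2) image_eqI list.sel(1) not_less_iff_gr_or_eq)
  assume x: "x \<in> set (tl V)"
  have f': "fan H (insert (cl v) (S \<union> cl ` set U)) V'" using f by simp
  have "x < v" using assms(2) x V by auto
  then have "cl x \<le> cl v" by (intro cl_mono) simp
  then show "cl x < cl u" using fan_mem[OF f', of x] x V assms(4) by auto
qed

text \<open>A letter of \<open>V\<close> is at most \<open>hd V\<close>, hence at most
  \<open>hd U\<close>; being on one side of everything read before, it is on the lower side of all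
  of \<open>U\<close>.\<close>

lemma not_has_up_bounds:
  assumes "fan H S (U @ V)" "sorted_wrt (>) V" "\<not> has_up U V" "u \<in> set U" "x \<in> set V"
  shows "cl x < cl u"
proof -
  from assms(5) obtain v V' where V: "V = v # V'" by (cases V) auto
  from assms(4) have U: "U \<noteq> []" "hd U \<in> set U" by (cases U; simp)+
  have f: "fan H (S \<union> cl ` set U) V" using assms(1) fan_append by blast
  have hv: "cl v \<le> cl (hd U)" using assms(3) V U by (auto simp: has_up_def)
  have "x \<le> v" using assms(2,5) V by auto
  then have "cl x \<le> cl v" by (rule cl_mono)
  moreover have "cl (hd U) \<in> S \<union> cl ` set U" "cl u \<in> S \<union> cl ` set U" using U assms(4) by auto
  ultimately show ?thesis using fan_mem[OF f assms(5)] hv by (meson le_trans not_less)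
qed

lemma ms_pairs_empty: "\<forall>u\<in>set U. \<forall>v\<in>V. \<not> \<lceil>u\<rceil> < \<lceil>v\<rceil> \<Longrightarrow> ms_pairs U V = {}"
  by (induction U) (auto simp: Let_def)

text \<open>Only \<open>hd V\<close> can exceed letters of \<open>U\<close>. The pairing reads
  \<open>U\<close> from its front, so \<open>hd U\<close> takes it and nothing is left for the later
  letters.\<close>

lemma ms_pairs_fan:
  assumes f: "fan H S (U @ V)" and V: "sorted_wrt (>) V"
  shows "ms_pairs U (set V) = (if has_up U V then {(hd U, hd V)} else {})"
proof -
  have L: "\<And>x. x \<in> set (U @ V) \<Longrightarrow> \<lceil>x\<rceil> = int (cl x)" 
    using fan_letter[OF f] ceiling_letter by blast
  show ?thesis
  proof (cases "has_up U V")
    case True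
    then obtain u U' v V' where UV: "U = u # U'" "V = v # V'"
      by (cases U; cases V) (auto simp: has_up_def)
    have W: "{w \<in> set V. \<lceil>u\<rceil> < \<lceil>w\<rceil>} = {v}"
      using has_up_bounds[OF f V True, of u] L UV by (force)
    have "ms_pairs U' (set V - {v}) = {}"
      using has_up_bounds(2)[OF f V True] L UV by (intro ms_pairs_empty) force
    then show ?thesis using True W by (simp add: UV)
  next
    case False
    then show ?thesis using not_has_up_bounds[OF f V False] L 
      by (simp, intro ms_pairs_empty) force
  qed
qed

text \<open>Closed form of the raising rule: the largest unpaired letter is the first or, when
  \<open>hd V\<close> is paired, the second letter of \<open>V\<close>. It lies below all of
  \<open>U\<close> and is appended there.\<close>

definition raise_fan :: "real list \<Rightarrow> real list \<Rightarrow> (real list \<times> real list) option" where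
  "raise_fan U V =
     (if has_up U V then (case tl V of [] \<Rightarrow> None | x # W \<Rightarrow> Some (U @ [x], hd V # W))
      else (case V of [] \<Rightarrow> None | x # W \<Rightarrow> Some (U @ [x], W)))"

definition lower_fan :: "real list \<Rightarrow> real list \<Rightarrow> (real list \<times> real list) option" where
  "lower_fan U V =
     (if has_up U V then (if tl U = [] then None else Some (butlast U, hd V # last U # tl V))
      else (if U = [] then None else Some (butlast U, last U # V)))"

lemma Least_zero: "P 0 \<Longrightarrow> (LEAST d. P d) = (0::nat)"
  by (intro Least_equality) auto

text \<open>The moved letter is below every letter of \<open>U\<close>, so the shift
  \<open>d\<close> is 0 and the set \<open>Q\<close> of pairs that swap primes is empty.\<close>

lemma raise_factors_fan:
  assumes f: "fan H S (U @ V)" and U: "sorted_wrt (>) U" and V: "sorted_wrt (>) V"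
  shows "raise_factors U V = raise_fan U V"
proof -
  let ?P = "ms_pairs U (set V)"
  let ?F = "set V - snd ` ?P"
  \<comment> \<open>The unpaired letters of \<open>V\<close>, as a list whose head is the letter to
    be moved.\<close>
  define W where "W = (if has_up U V then tl V else V)"
  note P = ms_pairs_fan[OF f V]
  have F: "?F = set W"
    unfolding P W_def using V by (cases V) (auto simp: has_up_def)
  have W: "sorted_wrt (>) W" using V by (cases V) (auto simp: W_def)
  show ?thesis
  proof (cases W)
    case Nil
    then show ?thesis unfolding raise_factors_def raise_fan_def Let_def F
      by (auto simp: W_def split: if_splits)
  next
    case (Cons x W')
    have "Max ?F = x" unfolding F using W Cons by (intro Max_eqI) auto
    have xU: "cl x < cl u" if "u \<in> set U" for u
      using has_up_bounds(2)[OF f V _ that, of x] not_has_up_bounds[OF f V _ that, of x] Cons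
      by (auto simp: W_def split: if_splits)
    have xV: "x \<in> set V" using Cons by (cases V) (auto simp: W_def split: if_splits)
    have "\<lceil>x\<rceil> \<notin> ceiling ` set U"
      using xU by (force simp: cl_def)
    then have d: "(LEAST d. \<lceil>x\<rceil> + int d \<notin> ceiling ` set U) = 0"
      by (intro Least_zero) simp
    have Q: "{(u, v) \<in> ?P. \<lceil>x\<rceil> \<le> \<lceil>u\<rceil> \<and> \<lceil>u\<rceil> < \<lceil>x\<rceil> + int 0} = {}" by auto
    have "?F \<noteq> {}" unfolding F Cons by simp
    then have main: "raise_factors U V = Some (dec_word (insert x (set U)), dec_word (set V - {x}))"
      unfolding raise_factors_def Let_def \<open>Max ?F = x\<close> d Q by simp
    have s: "sorted_wrt (>) (U @ [x])"
      using U xU by (auto simp: sorted_wrt_append intro: cl_less_imp)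
    show ?thesis
    proof (cases "has_up U V")
      case True
      then obtain v where v: "V = v # x # W'" using Cons
        by (cases V) (auto simp: W_def has_up_def)
      have dw: "dec_word (insert x (set U)) = U @ [x]" using s by (intro dec_word_eq) auto
      have dw': "dec_word (set V - {x}) = v # W'" using V v by (intro dec_word_eq) auto
      show ?thesis using main True v dw dw' by (simp add: raise_fan_def)
    next
      case False
      then have v: "V = x # W'" using Cons by (auto simp: W_def)
      have dw: "dec_word (insert x (set U)) = U @ [x]" using s by (intro dec_word_eq) auto
      have dw': "dec_word (set V - {x}) = W'" using V v by (intro dec_word_eq) auto
      show ?thesis using main False v dw dw' by (simp add: raise_fan_def)
    qed
  qed
qed

text \<open>Here \<open>d\<close> is 0 because the letters of a fan have distinct ceilings, so the
  moved letter meets nothing in \<open>V\<close>. It is the last letter of \<open>U\<close> and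
  lands at the front of \<open>V\<close>, or behind \<open>hd V\<close> when that one is a new
  maximum.\<close>

lemma lower_factors_fan:
  assumes f: "fan H S (U @ V)" and U: "sorted_wrt (>) U" and V: "sorted_wrt (>) V"
  shows "lower_factors U V = lower_fan U V"
proof -
  let ?P = "ms_pairs U (set V)"
  let ?F = "set U - fst ` ?P"
  define W where "W = (if has_up U V then tl U else U)"
  note P = ms_pairs_fan[OF f V]
  have F: "?F = set W"
    unfolding P W_def using U by (cases U) (auto simp: has_up_def)
  have W: "sorted_wrt (>) W" using U by (cases U) (auto simp: W_def)
  show ?thesis
  proof (cases W rule: rev_cases)
    case Nil
    then show ?thesis unfolding lower_factors_def lower_fan_def Let_def F
      by (auto simp: W_def split: if_splits)
  next
    case (snoc W' x)
    have "Min ?F = x" unfolding F using W snoc by (intro Min_eqI) (auto simp: sorted_wrt_append)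
    have "x \<in> set W" using snoc by simp
    then have xU: "x \<in> set U" by (cases U) (auto simp: W_def split: if_splits)
    have xV: "cl x \<noteq> cl v" if "v \<in> set V" for v
      using fan_distinct[OF f] xU that by force
    have L: "\<And>x. x \<in> set (U @ V) \<Longrightarrow> \<lceil>x\<rceil> = int (cl x)" 
      using fan_letter[OF f] ceiling_letter by blast
    have "\<lceil>x\<rceil> \<notin> ceiling ` set V"
      using xV by (force simp: cl_def)
    then have d: "(LEAST d. \<lceil>x\<rceil> - int d \<notin> ceiling ` set V) = 0"
      by (intro Least_zero) simp
    have Q: "{(u, v) \<in> ?P. \<lceil>x\<rceil> - int 0 < \<lceil>v\<rceil> \<and> \<lceil>v\<rceil> \<le> \<lceil>x\<rceil>} = {}" by auto
    have "?F \<noteq> {}" unfolding F snoc by simp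
    then have main: "lower_factors U V = Some (dec_word (set U - {x}), dec_word (insert x (set V)))"
      unfolding lower_factors_def Let_def \<open>Min ?F = x\<close> d Q by simp
    show ?thesis
    proof (cases "has_up U V")
      case True
      then obtain u v V' where v: "U = u # W' @ [x]" "V = v # V'" using snoc
        by (cases U; cases V) (auto simp: W_def has_up_def)
      have dw: "dec_word (set U - {x}) = u # W'" 
        using U v by (intro dec_word_eq) (auto simp: sorted_wrt_append)
      have "cl x < cl v" "\<And>y. y \<in> set V' \<Longrightarrow> cl y < cl x" 
        using has_up_bounds[OF f V True xU] v by auto
      then have dw': "dec_word (insert x (set V)) = v # x # V'" 
        using V v by (intro dec_word_eq) (auto intro: cl_less_imp)
      show ?thesis using main True v dw dw' by (simp add: lower_fan_def)
    next
      case False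
      then have v: "U = W' @ [x]" using snoc by (auto simp: W_def)
      have dw: "dec_word (set U - {x}) = W'" 
        using U v by (intro dec_word_eq) (auto simp: sorted_wrt_append)
      have dw': "dec_word (insert x (set V)) = x # V" 
        using V v not_has_up_bounds[OF f V False xU]
        by (intro dec_word_eq) (auto intro: cl_less_imp)
      show ?thesis using main False v dw dw' by (simp add: lower_fan_def)
    qed
  qed
qed


text \<open>With the element \<open>u\<close> between them, \<open>v\<close> goes up and
  \<open>x\<close> goes down in either order. The gap closed by \<open>x\<close> is named by
  \<open>Min S\<close>, which inserting \<open>cl v\<close> does not change, so both primes stay
  valid.\<close>

lemma fan_swap:
  assumes "finite S" "u \<in> S" "cl x < u" "u < cl v"
  shows "fan H S (v # x # w) \<longleftrightarrow> fan H S (x # v # w)"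
proof -
  have "Min S \<le> cl v" using assms by (meson Min_le less_imp_le order_trans)
  moreover have "Min (insert (cl v) S) = min (cl v) (Min S)" using assms by (intro Min_insert) auto
  ultimately have "Min (insert (cl v) S) = Min S" by linarith
  then show ?thesis using assms by (auto simp: insert_commute dest: bspec[of S _ u])
qed

text \<open>The form of the exchange used for \<open>raise_bar\<close> and \<open>lower_bar\<close>,
  where a leading letter jumps over the descending letters of the first factor.\<close>

lemma fan_move:
  assumes "finite S" "u \<in> S" "u < cl v" "\<forall>x\<in>set X. cl x < u"
  shows "fan H S (X @ v # w) \<longleftrightarrow> fan H S (v # X @ w)"
  using assms
proof (induction X arbitrary: S)
  case (Cons x X)
  have "fan H S ((x # X) @ v # w) \<longleftrightarrow> fan H S [x] \<and> fan H (insert (cl x) S) (X @ v # w)"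
    by simp
  also have "\<dots> \<longleftrightarrow> fan H S [x] \<and> fan H (insert (cl x) S) (v # X @ w)"
    using Cons.prems by (subst Cons.IH) auto
  also have "\<dots> \<longleftrightarrow> fan H S (x # v # X @ w)" by simp
  also have "\<dots> \<longleftrightarrow> fan H S (v # x # X @ w)"
    using Cons.prems by (intro fan_swap[symmetric]) auto
  finally show ?case by simp
qed simp

text \<open>The first two letters close one gap, named by the larger of them in either order. Its
  prime therefore belongs to the second position, while the prime of the first position is
  free.\<close>

lemma fan_init_swap:
  assumes "is_letter x1" "is_letter y1" "cl x1 = cl x" "cl y1 = cl y"
    "is_primed x1 = is_primed y" "is_primed y1 = is_primed x" "fan H {} (y # x # w)"
  shows "fan H {} (x1 # y1 # w)"
  using assms by (auto simp: insert_commute)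

text \<open>The ambient set of both crystals: for the \<open>H\<close> of the tableau it is
  \<open>RF_O_tab\<close>, and for \<open>H\<close> constantly false and an interval from 1 it
  consists of all factorizations of a transposition.\<close>

definition fans :: "nat \<Rightarrow> (nat \<Rightarrow> bool) \<Rightarrow> nat set \<Rightarrow> factorization set" where
  "fans n H I = {a. length a = n \<and> (\<forall>w\<in>set a. sorted_wrt (>) w) \<and>
     fan H {} (concat a) \<and> cl ` set (concat a) = I}"

lemma factors_split:
  assumes "1 \<le> i" "i < length a"
  obtains L U V R where "a = L @ U # V # R" "i = Suc (length L)"
proof
  show "a = take (i - 1) a @ a ! (i - 1) # a ! i # drop (Suc i) a"
    using assms by (metis Cons_nth_drop_Suc Suc_diff_1 append_take_drop_id less_imp_diff_less
        less_eq_Suc_le One_nat_def)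
  show "i = Suc (length (take (i - 1) a))" using assms by simp
qed

lemma on_factors_split:
  "on_factors g (Suc (length L)) (L @ U # V # R) = map_option (\<lambda>(U, V). L @ U # V # R) (g U V)"
  by (cases "g U V") (auto simp: on_factors_def nth_append list_update_append)

lemma on_factors_cong: "g U V = g' U V \<Longrightarrow>
  on_factors g (Suc (length L)) (L @ U # V # R) = on_factors g' (Suc (length L)) (L @ U # V # R)"
  by (simp add: on_factors_split)

lemma fans_split:
  "L @ U # V # R \<in> fans n H I \<longleftrightarrow>
     length L + length R + 2 = n \<and> (\<forall>w\<in>set L \<union> set R. sorted_wrt (>) w) \<and>
     sorted_wrt (>) U \<and> sorted_wrt (>) V \<and> fan H {} (concat L) \<and>
     fan H (cl ` set (concat L)) (U @ V) \<and>
     fan H (cl ` set (concat L) \<union> cl ` set (U @ V)) (concat R) \<and>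
     cl ` set (concat L) \<union> cl ` set (U @ V) \<union> cl ` set (concat R) = I"
  by (auto simp: fans_def fan_append image_Un Un_assoc)

lemma sorted_cl:
  assumes "distinct (map cl w)" "sorted_wrt (>) w"
  shows "sorted_wrt (\<lambda>x y. cl x > cl y) w"
  using assms
proof (induction w)
  case (Cons x w)
  have "cl y < cl x" if "y \<in> set w" for y
  proof -
    have "cl y \<le> cl x" using Cons.prems(2) that by (intro cl_mono) auto
    moreover have "cl y \<noteq> cl x" using Cons.prems(1) that by simp (metis image_eqI)
    ultimately show ?thesis by simp
  qed
  with Cons show ?case by auto
qed simp

text \<open>The ceilings of the letters of a fan are distinct, so its primes never decide a
  comparison.\<close>

lemma fan_sorted_iff:
  assumes "fan H S w"
  shows "sorted_wrt (>) w \<longleftrightarrow> sorted_wrt (\<lambda>x y. cl x > cl y) w"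
proof
  assume "sorted_wrt (>) w"
  then show "sorted_wrt (\<lambda>x y. cl x > cl y) w" using fan_distinct[OF assms] sorted_cl by blast
next
  assume "sorted_wrt (\<lambda>x y. cl x > cl y) w"
  then show "sorted_wrt (>) w" by (rule sorted_wrt_mono_rel[rotated]) (auto intro: cl_less_imp)
qed

text \<open>A letter leaving \<open>V\<close> passes at most \<open>hd V\<close>, by
  \<open>fan_swap\<close>. The conclusion on \<open>hd\<close> keeps the letter with the free prime
  in place, as \<open>std\<close> requires, and the one on \<open>has_up\<close> allows the steps of
  an iteration to be counted.\<close>

lemma raise_fan_closed:
  assumes f: "fan H S (U @ V)" and s: "sorted_wrt (>) U" "sorted_wrt (>) V" and S: "finite S"
    and r: "raise_fan U V = Some (U', V')"
  shows "fan H S (U' @ V')" "sorted_wrt (>) U'" "sorted_wrt (>) V'" "set (U' @ V') = set (U @ V)"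
    "hd (U' @ V') = hd (U @ V)" "length V = Suc (length V')" "length U' = Suc (length U)"
    "has_up U' V' = has_up U V"
proof -
  have "fan H S (U' @ V') \<and> sorted_wrt (>) U' \<and> sorted_wrt (>) V' \<and> set (U' @ V') = set (U @ V) \<and>
    hd (U' @ V') = hd (U @ V) \<and> length V = Suc (length V') \<and> length U' = Suc (length U) \<and>
    has_up U' V' = has_up U V"
  proof (cases "has_up U V")
    case True
    then obtain u U0 v x W where v: "V = v # x # W" "U = u # U0" "U' = U @ [x]" "V' = v # W"
      using r by (cases U; cases V; cases "tl V") (auto simp: raise_fan_def has_up_def)
    have b: "\<And>y. y \<in> set U \<Longrightarrow> cl x < cl y" "cl u < cl v"
      using has_up_bounds[OF f s(2) True] v by auto
    have "fan H S U \<and> fan H (S \<union> cl ` set U) (v # x # W)" using f v by (simp only: fan_append)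
    moreover have "fan H (S \<union> cl ` set U) (v # x # W) = fan H (S \<union> cl ` set U) (x # v # W)"
      using S b v by (intro fan_swap[of _ "cl u"]) auto
    ultimately have "fan H S (U @ x # v # W)" by (simp only: fan_append)
    moreover have "sorted_wrt (>) U'" using b s v by (auto simp: sorted_wrt_append intro: cl_less_imp)
    ultimately show ?thesis using v s b True by (auto simp: has_up_def)
  next
    case False
    then obtain x W where v: "V = x # W" "U' = U @ [x]" "V' = W"
      using r by (cases V) (auto simp: raise_fan_def)
    have b: "\<And>y. y \<in> set U \<Longrightarrow> z \<in> set V \<Longrightarrow> cl z < cl y" for z
      using not_has_up_bounds[OF f s(2) False] v by auto
    have "sorted_wrt (>) U'" using b s v by (auto simp: sorted_wrt_append intro: cl_less_imp)
    moreover have "\<not> has_up U' V'"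
    proof
      assume h: "has_up U' V'"
      then have "W \<noteq> []" using v by (auto simp: has_up_def)
      then have "hd W \<in> set W" "hd W < x" using s v by auto
      then show False using h b[of "hd U" "hd W"] v cl_mono[of "hd W" x] by (cases U) (auto simp: has_up_def)
    qed
    ultimately show ?thesis using v s False f by auto
  qed
  then show "fan H S (U' @ V')" "sorted_wrt (>) U'" "sorted_wrt (>) V'" "set (U' @ V') = set (U @ V)"
    "hd (U' @ V') = hd (U @ V)" "length V = Suc (length V')" "length U' = Suc (length U)"
    "has_up U' V' = has_up U V" by blast+
qed

lemma lower_fan_closed:
  assumes f: "fan H S (U @ V)" and s: "sorted_wrt (>) U" "sorted_wrt (>) V" and S: "finite S"
    and r: "lower_fan U V = Some (U', V')"
  shows "fan H S (U' @ V')" "sorted_wrt (>) U'" "sorted_wrt (>) V'" "set (U' @ V') = set (U @ V)"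
    "hd (U' @ V') = hd (U @ V)" "length U = Suc (length U')" "length V' = Suc (length V)"
    "has_up U' V' = has_up U V"
proof -
  have "fan H S (U' @ V') \<and> sorted_wrt (>) U' \<and> sorted_wrt (>) V' \<and> set (U' @ V') = set (U @ V) \<and>
    hd (U' @ V') = hd (U @ V) \<and> length U = Suc (length U') \<and> length V' = Suc (length V) \<and>
    has_up U' V' = has_up U V"
  proof (cases "has_up U V")
    case True
    then obtain u U0 v x W where v: "V = v # W" "U = u # U0 @ [x]" "U' = u # U0" "V' = v # x # W"
      using r by (cases U; cases V; cases "tl U" rule: rev_cases) (auto simp: lower_fan_def has_up_def)
    have b: "\<And>y. y \<in> set W \<Longrightarrow> cl y < cl x" "cl u < cl v" "cl x < cl v"
      using has_up_bounds[OF f s(2) True] v by auto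
    have "fan H S U" using f fan_append by blast
    then have "cl x < cl u" using s v by (simp only: fan_sorted_iff) auto
    have "fan H S (u # U0) \<and> fan H (S \<union> cl ` set (u # U0)) (x # v # W)"
      using f v fan_append[of H S "u # U0" "x # v # W"] by simp
    moreover have "fan H (S \<union> cl ` set (u # U0)) (v # x # W) = fan H (S \<union> cl ` set (u # U0)) (x # v # W)"
      using S b v \<open>cl x < cl u\<close> by (intro fan_swap[of _ "cl u"]) auto
    ultimately have "fan H S ((u # U0) @ v # x # W)" by (simp only: fan_append)
    moreover have "sorted_wrt (>) V'" using b s v by (auto intro: cl_less_imp)
    ultimately show ?thesis using v s b True by (auto simp: has_up_def sorted_wrt_append)
  next
    case False
    then obtain x where v: "U = U' @ [x]" "V' = x # V"
      using r by (cases U rule: rev_cases) (auto simp: lower_fan_def)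
    have b: "\<And>y. y \<in> set U \<Longrightarrow> z \<in> set V \<Longrightarrow> cl z < cl y" for z
      using not_has_up_bounds[OF f s(2) False] v by auto
    have "sorted_wrt (>) V'" using b s v by (auto intro: cl_less_imp)
    moreover have "\<not> has_up U' V'"
    proof
      assume h: "has_up U' V'"
      then have "U' \<noteq> []" using v by (auto simp: has_up_def)
      then have "x < hd U'" using s v by (cases U') auto
      then show False using h v cl_mono[of x "hd U'"] by (auto simp: has_up_def)
    qed
    ultimately show ?thesis using v s False f by (auto simp: sorted_wrt_append hd_append)
  qed
  then show "fan H S (U' @ V')" "sorted_wrt (>) U'" "sorted_wrt (>) V'" "set (U' @ V') = set (U @ V)"
    "hd (U' @ V') = hd (U @ V)" "length U = Suc (length U')" "length V' = Suc (length V)"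
    "has_up U' V' = has_up U V" by blast+
qed

lemma letter_mk:
  assumes "1 \<le> r"
  shows "cl (real r - (if p then 1/2 else 0)) = r" "is_primed (real r - (if p then 1/2 else 0)) = p"
    "is_letter (real r - (if p then 1/2 else 0))"
proof -
  have c: "\<lceil>real r - 1/2\<rceil> = int r" by (intro ceiling_unique) auto
  then have "real r - 1/2 \<notin> \<int>"
    by (metis Ints_cases ceiling_of_int of_int_of_nat_eq diff_eq_eq less_irrefl half_gt_zero_iff
        zero_less_one add_cancel_left_right)
  then show "cl (real r - (if p then 1/2 else 0)) = r" "is_primed (real r - (if p then 1/2 else 0)) = p"
    "is_letter (real r - (if p then 1/2 else 0))"
    using c assms by (auto simp: cl_def is_primed_def is_letter_def)
qed

lemma prime_as_letter:
  assumes "is_letter x" "is_letter y"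
  shows "cl (prime_as x y) = cl x" "is_primed (prime_as x y) = is_primed y" "is_letter (prime_as x y)"
proof -
  have p: "prime_as x y = real (cl x) - (if is_primed y then 1/2 else 0)"
    using letter_gap[OF assms(2)] ceiling_letter[OF assms(1)] by (simp add: prime_as_def)
  then show "cl (prime_as x y) = cl x" "is_primed (prime_as x y) = is_primed y" "is_letter (prime_as x y)"
    using letter_mk[OF cl_letter_pos[OF assms(1)]] by auto
qed

lemma finite_fans: "a \<in> fans n H I \<Longrightarrow> finite I"
  by (auto simp: fans_def)

lemma e_num_fans:
  assumes "a \<in> fans n H I" 
  shows "e_num i a = on_factors raise_fan i a"
proof (cases "1 \<le> i \<and> i < length a")
  case True
  then obtain L U V R where a: "a = L @ U # V # R" "i = Suc (length L)"
    using factors_split by blast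
  show ?thesis unfolding a e_num_def using assms unfolding a fans_split
    by (intro on_factors_cong raise_factors_fan) auto
qed (auto simp: e_num_def on_factors_def)

lemma f_num_fans:
  assumes "a \<in> fans n H I" 
  shows "f_num i a = on_factors lower_fan i a"
proof (cases "1 \<le> i \<and> i < length a")
  case True
  then obtain L U V R where a: "a = L @ U # V # R" "i = Suc (length L)"
    using factors_split by blast
  show ?thesis unfolding a f_num_def using assms unfolding a fans_split
    by (intro on_factors_cong lower_factors_fan) auto
qed (auto simp: f_num_def on_factors_def)

lemma on_factors_SomeE:
  assumes "on_factors g i a = Some b"
  obtains L U V R U' V' where "a = L @ U # V # R" "i = Suc (length L)" "b = L @ U' # V' # R"
    "g U V = Some (U', V')"
proof -
  have "1 \<le> i \<and> i < length a" using assms by (auto simp: on_factors_def split: if_splits)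
  then obtain L U V R where a: "a = L @ U # V # R" "i = Suc (length L)"
    using factors_split by blast
  with assms that show ?thesis by (auto simp: on_factors_split)
qed

lemma fans_exchange:
  assumes "L @ U # V # R \<in> fans n H I" "fan H (cl ` set (concat L)) (U' @ V')"
    "sorted_wrt (>) U'" "sorted_wrt (>) V'" "set (U' @ V') = set (U @ V)" "hd (U' @ V') = hd (U @ V)"
  shows "L @ U' # V' # R \<in> fans n H I" "hd (concat (L @ U' # V' # R)) = hd (concat (L @ U # V # R))"
proof -
  show "L @ U' # V' # R \<in> fans n H I" using assms(1-4) unfolding fans_split assms(5) by blast
  have "U' @ V' = [] \<longleftrightarrow> U @ V = []" using assms(5) by (metis set_empty)
  moreover have "concat (L @ U' # V' # R) = concat L @ (U' @ V') @ concat R" 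
    "concat (L @ U # V # R) = concat L @ (U @ V) @ concat R" by simp_all
  ultimately show "hd (concat (L @ U' # V' # R)) = hd (concat (L @ U # V # R))" 
    using assms(6) by (simp only: hd_append split: if_splits)
qed

lemma e_num_closed:
  assumes a: "a \<in> fans n H I" and b: "e_num i a = Some b"
  shows "b \<in> fans n H I" "hd (concat b) = hd (concat a)"
proof -
  obtain L U V R U' V' where ab: "a = L @ U # V # R" "i = Suc (length L)" "b = L @ U' # V' # R"
    "raise_fan U V = Some (U', V')" 
    using b unfolding e_num_fans[OF a] by (rule on_factors_SomeE)
  have f: "fan H (cl ` set (concat L)) (U @ V)" "sorted_wrt (>) U" "sorted_wrt (>) V"
    using a unfolding ab fans_split by auto
  note c = raise_fan_closed[OF f _ ab(4)]
  show "b \<in> fans n H I" "hd (concat b) = hd (concat a)"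
    using fans_exchange[OF a[unfolded ab(1)], of U' V'] c unfolding ab(1,3) by auto
qed

lemma f_num_closed:
  assumes a: "a \<in> fans n H I" and b: "f_num i a = Some b"
  shows "b \<in> fans n H I" "hd (concat b) = hd (concat a)"
proof -
  obtain L U V R U' V' where ab: "a = L @ U # V # R" "i = Suc (length L)" "b = L @ U' # V' # R"
    "lower_fan U V = Some (U', V')" 
    using b unfolding f_num_fans[OF a] by (rule on_factors_SomeE)
  have f: "fan H (cl ` set (concat L)) (U @ V)" "sorted_wrt (>) U" "sorted_wrt (>) V"
    using a unfolding ab fans_split by auto
  note c = lower_fan_closed[OF f _ ab(4)]
  show "b \<in> fans n H I" "hd (concat b) = hd (concat a)"
    using fans_exchange[OF a[unfolded ab(1)], of U' V'] c unfolding ab(1,3) by auto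
qed

lemma opt_iter_0 [simp]: "opt_iter g 0 a = Some a"
  by (simp add: opt_iter_def)

lemma opt_iter_Suc: "opt_iter g (Suc k) a = Option.bind (g a) (opt_iter g k)"
proof -
  have "((\<lambda>b. Option.bind b g) ^^ k) None = None" for k by (induction k) auto
  then show ?thesis
    unfolding opt_iter_def funpow_Suc_right by (cases "g a") auto
qed

lemma opt_iter_closed:
  assumes "\<And>a b. a \<in> X \<Longrightarrow> g a = Some b \<Longrightarrow> b \<in> X" "a \<in> X" "opt_iter g k a = Some b"
  shows "b \<in> X"
  using assms(2,3)
proof (induction k arbitrary: a)
  case (Suc k)
  then show ?case using assms(1) by (auto simp: opt_iter_Suc bind_eq_Some_conv)
qed simp

lemma opt_iter_equivariant:
  assumes "\<And>a b. a \<in> X \<Longrightarrow> g a = Some b \<Longrightarrow> b \<in> X"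
    "\<And>a. a \<in> X \<Longrightarrow> g (\<phi> a) = map_option \<phi> (g a)" "a \<in> X"
  shows "opt_iter g k (\<phi> a) = map_option \<phi> (opt_iter g k a)"
  using assms(3)
proof (induction k arbitrary: a)
  case (Suc k)
  then show ?case using assms(1,2) by (cases "g a") (auto simp: opt_iter_Suc)
qed simp

text \<open>Each step moves one letter and only the paired one is stuck, so the length of
  \<open>U\<close>, less one if there is a pair, counts the available steps. Definedness matters
  because \<open>sigma\<close> applies \<open>the\<close> to such an iteration.\<close>

lemma opt_iter_f_num:
  assumes "L @ U # V # R \<in> fans n H I" "k + (if has_up U V then 1 else 0) \<le> length U"
  shows "opt_iter (f_num (Suc (length L))) k (L @ U # V # R) \<noteq> None"
  using assms
proof (induction k arbitrary: U V)
  case (Suc k)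
  have "tl U \<noteq> []" if "has_up U V" using Suc.prems(2) that by (cases U) auto
  then obtain U' V' where UV: "lower_fan U V = Some (U', V')" 
    using Suc.prems(2) by (cases "has_up U V"; cases U) (auto simp: lower_fan_def)
  then have f: "f_num (Suc (length L)) (L @ U # V # R) = Some (L @ U' # V' # R)"
    by (simp add: f_num_fans[OF Suc.prems(1)] on_factors_split)
  have "fan H (cl ` set (concat L)) (U @ V)" "sorted_wrt (>) U" "sorted_wrt (>) V"
    using Suc.prems(1) unfolding fans_split by auto
  note c = lower_fan_closed[OF this _ UV]
  have "opt_iter (f_num (Suc (length L))) k (L @ U' # V' # R) \<noteq> None"
    using c Suc.prems(2) by (intro Suc.IH f_num_closed[OF Suc.prems(1) f]) auto
  then show ?case by (simp add: opt_iter_Suc f)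
qed simp

lemma opt_iter_e_num:
  assumes "L @ U # V # R \<in> fans n H I" "k + (if has_up U V then 1 else 0) \<le> length V"
  shows "opt_iter (e_num (Suc (length L))) k (L @ U # V # R) \<noteq> None"
  using assms
proof (induction k arbitrary: U V)
  case (Suc k)
  have "tl V \<noteq> []" if "has_up U V" using Suc.prems(2) that by (cases V) auto
  then obtain U' V' where UV: "raise_fan U V = Some (U', V')" 
    using Suc.prems(2) by (cases V; cases "tl V") (auto simp: raise_fan_def split: if_splits)
  then have f: "e_num (Suc (length L)) (L @ U # V # R) = Some (L @ U' # V' # R)"
    by (simp add: e_num_fans[OF Suc.prems(1)] on_factors_split)
  have "fan H (cl ` set (concat L)) (U @ V)" "sorted_wrt (>) U" "sorted_wrt (>) V"
    using Suc.prems(1) unfolding fans_split by auto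
  note c = raise_fan_closed[OF this _ UV]
  have "opt_iter (e_num (Suc (length L))) k (L @ U' # V' # R) \<noteq> None"
    using c Suc.prems(2) by (intro Suc.IH e_num_closed[OF Suc.prems(1) f]) auto
  then show ?case by (simp add: opt_iter_Suc f)
qed simp

text \<open>The iteration in \<open>sigma\<close> always has a value: a pair makes both factors
  nonempty, and the difference of their lengths then leaves room for the letter that cannot
  move.\<close>

lemma sigma_cases:
  assumes a: "a \<in> fans n H I" and i: "1 \<le> i" "i < n"
  obtains k where "length (a ! i) \<le> length (a ! (i - 1))" "k = length (a ! (i - 1)) - length (a ! i)"
      "opt_iter (f_num i) k a = Some (sigma i a)"
  | k where "\<not> length (a ! i) \<le> length (a ! (i - 1))" "k = length (a ! i) - length (a ! (i - 1))"
      "opt_iter (e_num i) k a = Some (sigma i a)"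
proof -
  have "length a = n" using a by (simp add: fans_def)
  then obtain L U V R where ab: "a = L @ U # V # R" "i = Suc (length L)" 
    using factors_split[of i a] i by metis
  have n: "a ! (i - 1) = U" "a ! i = V" by (simp_all add: ab nth_append)
  show thesis
  proof (cases "length V \<le> length U")
    case True
    have "has_up U V \<Longrightarrow> length V \<ge> 1" by (cases V) (auto simp: has_up_def)
    then have "length U - length V + (if has_up U V then 1 else 0) \<le> length U" using True by auto
    then have "opt_iter (f_num i) (length U - length V) a \<noteq> None"
      using a unfolding ab by (intro opt_iter_f_num)
    then show thesis using True that(1) n by (simp add: sigma_def Let_def)
  next
    case False
    have "has_up U V \<Longrightarrow> length U \<ge> 1" by (cases U) (auto simp: has_up_def)
    then have "length V - length U + (if has_up U V then 1 else 0) \<le> length V" using False by auto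
    then have "opt_iter (e_num i) (length V - length U) a \<noteq> None"
      using a unfolding ab by (intro opt_iter_e_num)
    then show thesis using False that(2) n by (simp add: sigma_def Let_def)
  qed
qed

lemma sigma_closed:
  assumes a: "a \<in> fans n H I" and i: "1 \<le> i" "i < n"
  shows "sigma i a \<in> fans n H I"
proof (rule sigma_cases[OF assms])
  fix k assume "opt_iter (f_num i) k a = Some (sigma i a)"
  then show ?thesis by (rule opt_iter_closed[rotated 2]) (use a f_num_closed in blast)+
next
  fix k assume "opt_iter (e_num i) k a = Some (sigma i a)"
  then show ?thesis by (rule opt_iter_closed[rotated 2]) (use a e_num_closed in blast)+
qed

lemma fans_Cons2:
  "U # V # R \<in> fans n H I \<longleftrightarrow> length R + 2 = n \<and> sorted_wrt (>) U \<and> sorted_wrt (>) V \<and>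
     (\<forall>w\<in>set R. sorted_wrt (>) w) \<and> fan H {} (U @ V @ concat R) \<and> cl ` set (U @ V @ concat R) = I"
  by (auto simp: fans_def)

text \<open>\<open>x\<close> first jumps over \<open>X\<close> by \<open>fan_move\<close> and then,
  as the second letter of the word, changes places with \<open>w\<close>. The exchange of primes in
  \<open>raise_bar\<close> is exactly the one of \<open>fan_init_swap\<close>.\<close>

lemma raise_bar_closed:
  assumes a: "U # V # R \<in> fans n H I" and b: "raise_bar U V = Some (U', V')"
  shows "U' # V' # R \<in> fans n H I"
proof (cases U)
  case Nil
  with b obtain x W where "V = x # W" "U' = [x]" "V' = W" by (cases V) auto
  with a Nil show ?thesis by (auto simp: fans_def)
next
  case (Cons w X)
  with b obtain x W where V: "V = x # W" and wx: "\<lceil>w\<rceil> < \<lceil>x\<rceil>" 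
    and UV': "U' = prime_as x w # prime_as w x # X" "V' = W" by (cases V) (auto split: if_splits)
  have f0: "fan H {} (U @ V @ concat R)" and s: "sorted_wrt (>) U" "sorted_wrt (>) V"
    using a by (auto simp: fans_def)
  have f: "fan H {} (U @ V)" using f0 by (simp add: fan_append)
  have L: "is_letter w" "is_letter x" using fan_letter[OF f] Cons V by auto
  note p = prime_as_letter[OF L] prime_as_letter[OF L(2,1)]
  have h: "has_up U V" using wx ceiling_letter[OF L(1)] ceiling_letter[OF L(2)] 
    by (auto simp: Cons V has_up_def)
  note hb = has_up_bounds[OF f s(2) h]
  have "sorted_wrt (\<lambda>x y. cl x > cl y) U" using s f fan_append fan_sorted_iff by blast
  then have Xw: "\<And>y. y \<in> set X \<Longrightarrow> cl y < cl w" by (simp add: Cons)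
  have "fan H {cl w} (X @ x # W @ concat R)" using f0 by (simp add: Cons V)
  then have "fan H {cl w} (x # X @ W @ concat R)"
    using hb[of w] Xw Cons V by (subst (asm) fan_move[of _ "cl w"]) auto
  then have "fan H {} (w # x # X @ W @ concat R)" using L by simp
  then have "fan H {} (U' @ V' @ concat R)"
    unfolding UV' append_Cons using p by - (rule fan_init_swap[where x = x and y = w], assumption+)
  moreover have "sorted_wrt (>) U'" "sorted_wrt (>) V'"
    using s Xw p hb Cons V unfolding UV' by (auto intro!: cl_less_imp)
  moreover have "cl ` set (U' @ V' @ concat R) = cl ` set (U @ V @ concat R)"
    using p by (auto simp: UV' Cons V)
  ultimately show ?thesis using a unfolding fans_Cons2 by blast
qed

text \<open>The reverse of raising: \<open>x\<close> and \<open>w\<close> change places first, and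
  \<open>x\<close> then moves behind the rest of the first factor. With only \<open>x\<close> in the
  first factor the word itself stays the same.\<close>

lemma lower_bar_closed:
  assumes a: "U # V # R \<in> fans n H I" and b: "lower_bar U V = Some (U', V')"
  shows "U' # V' # R \<in> fans n H I"
proof -
  obtain x X where U: "U = x # X" and Vx: "V = [] \<or> \<lceil>hd V\<rceil> < \<lceil>x\<rceil>"
    using b by (auto simp: lower_bar_def split: list.splits if_splits)
  have f0: "fan H {} (U @ V @ concat R)" and s: "sorted_wrt (>) U" "sorted_wrt (>) V"
    using a by (auto simp: fans_def)
  have f: "fan H {} (U @ V)" using f0 by (simp add: fan_append)
  have L: "\<And>y. y \<in> set (U @ V) \<Longrightarrow> is_letter y" using fan_letter[OF f] by blast
  have h: "\<not> has_up U V"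
  proof (cases V)
    case (Cons v W)
    then have "is_letter x" "is_letter v" using L U by auto
    then show ?thesis using Vx ceiling_letter Cons U by (auto simp: has_up_def)
  qed (simp add: has_up_def)
  note hb = not_has_up_bounds[OF f s(2) h]
  show ?thesis
  proof (cases X)
    case Nil
    then have UV': "U' = []" "V' = x # V" using b Vx by (auto simp: lower_bar_def U)
    have "sorted_wrt (>) V'" using s hb[of x] U unfolding UV' by (auto intro: cl_less_imp)
    then show ?thesis using a by (simp add: fans_def UV' U Nil)
  next
    case (Cons w W)
    then have UV': "U' = prime_as w x # W" "V' = prime_as x w # V" 
      using b Vx by (auto simp: lower_bar_def U)
    have Lx: "is_letter w" "is_letter x" using L Cons U by auto
    note p = prime_as_letter[OF Lx] prime_as_letter[OF Lx(2,1)]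
    have "sorted_wrt (\<lambda>x y. cl x > cl y) U" using s f fan_append fan_sorted_iff by blast
    then have Xw: "\<And>y. y \<in> set W \<Longrightarrow> cl y < cl w" "cl w < cl x" by (auto simp add: Cons U)
    have "fan H {} (prime_as w x # prime_as x w # W @ V @ concat R)"
      using p f0 U Cons by - (rule fan_init_swap[where x = w and y = x], simp_all)
    then have "fan H {cl w} (prime_as x w # W @ V @ concat R)" by (simp only: fan.simps p insert_commute)
    then have "fan H {cl w} (W @ prime_as x w # V @ concat R)"
      using Xw p by (subst fan_move[of _ "cl w"]) auto
    moreover have "fan H {} [prime_as w x]" using p by simp
    ultimately have "fan H {} ([prime_as w x] @ W @ prime_as x w # V @ concat R)"
      unfolding fan_append[of H "{}" "[_]"] using p by simp
    then have "fan H {} (U' @ V' @ concat R)" by (simp add: UV')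
    moreover have "sorted_wrt (>) U'" "sorted_wrt (>) V'"
      using s Xw p hb[of x] U Cons unfolding UV' by (auto intro!: cl_less_imp)
    moreover have "cl ` set (U' @ V' @ concat R) = cl ` set (U @ V @ concat R)"
      using p by (auto simp: UV' Cons U)
    ultimately show ?thesis using a unfolding fans_Cons2 by blast
  qed
qed

text \<open>The letter concerned is the first of the whole word, whose prime the fan condition
  leaves free.\<close>

lemma raise_prime_closed:
  assumes a: "a \<in> fans n H I" and b: "raise_prime a = Some b"
  shows "b \<in> fans n H I"
proof -
  obtain x w R where ab: "a = (x # w) # R" "is_primed x" "b = (of_int \<lceil>x\<rceil> # w) # R"
    using b by (cases a rule: raise_prime.cases) (auto split: if_splits)
  let ?x = "of_int \<lceil>x\<rceil> :: real"
  have f: "fan H {} (x # w @ concat R)" "sorted_wrt (>) (x # w)" using a by (auto simp: fans_def ab)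
  have fw: "fan H {} (x # w)" using f(1) fan_append[of H "{}" "x # w" "concat R"] by simp
  have "is_letter x" using f by simp
  then have x: "cl ?x = cl x" "is_letter ?x" by (auto simp: cl_def is_letter_def less_le_trans[OF _ le_of_int_ceiling])
  then have "fan H {} (?x # w @ concat R)" using f by simp
  moreover have c: "\<forall>y\<in>set w. cl y < cl x" using f(2) fan_sorted_iff[OF fw] by simp
  moreover have "sorted_wrt (>) (?x # w)"
    using f(2) c x by (auto intro: cl_less_imp)
  ultimately show ?thesis using a x(1) by (simp add: fans_def ab)
qed

lemma lower_prime_closed:
  assumes a: "a \<in> fans n H I" and b: "lower_prime a = Some b"
  shows "b \<in> fans n H I"
proof -
  obtain x w R where ab: "a = (x # w) # R" "\<not> is_primed x" "b = (prm \<lceil>x\<rceil> # w) # R"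
    using b by (cases a rule: lower_prime.cases) (auto split: if_splits)
  let ?x = "prm \<lceil>x\<rceil>"
  have f: "fan H {} (x # w @ concat R)" "sorted_wrt (>) (x # w)" using a by (auto simp: fans_def ab)
  have fw: "fan H {} (x # w)" using f(1) fan_append[of H "{}" "x # w" "concat R"] by simp
  have Lx: "is_letter x" using f by simp
  have "\<lceil>?x\<rceil> = \<lceil>x\<rceil>" unfolding prm_def by (intro ceiling_unique) auto
  then have "cl ?x = cl x" by (simp add: cl_def)
  moreover have "is_letter ?x"
    using cl_letter_pos[OF Lx] by (simp add: is_letter_def prm_def ceiling_letter[OF Lx])
  ultimately have x: "cl ?x = cl x" "is_letter ?x" by blast+
  then have "fan H {} (?x # w @ concat R)" using f by simp
  moreover have c: "\<forall>y\<in>set w. cl y < cl x" using f(2) fan_sorted_iff[OF fw] by simp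
  moreover have "sorted_wrt (>) (?x # w)"
    using f(2) c x by (auto intro: cl_less_imp)
  ultimately show ?thesis using a x(1) by (simp add: fans_def ab)
qed


section \<open>Standardization\<close>

definition rank :: "nat set \<Rightarrow> nat \<Rightarrow> nat" where
  "rank I m = card (I \<inter> {..m})"

lemma rank_less_iff:
  assumes "finite I" "x \<in> I" "y \<in> I"
  shows "rank I x < rank I y \<longleftrightarrow> x < y"
proof -
  have "rank I a < rank I b" if "b \<in> I" "a < b" for a b
  proof -
    have "I \<inter> {..a} \<subseteq> I \<inter> {..b}" "b \<in> I \<inter> {..b}" "b \<notin> I \<inter> {..a}" using that by auto
    then show ?thesis unfolding rank_def using assms(1) by (intro psubset_card_mono) blast+
  qed
  then show ?thesis using assms by (metis not_less_iff_gr_or_eq)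
qed

lemma rank_eq_iff:
  assumes "finite I" "x \<in> I" "y \<in> I"
  shows "rank I x = rank I y \<longleftrightarrow> x = y"
  using rank_less_iff[of I] assms by (metis less_irrefl not_less_iff_gr_or_eq)

lemma rank_image:
  assumes "finite I"
  shows "rank I ` I = {1..card I}"
proof (rule card_subset_eq)
  have "1 \<le> rank I x" if "x \<in> I" for x
    unfolding rank_def using assms that by (auto simp: Suc_le_eq card_gt_0_iff)
  moreover have "rank I x \<le> card I" for x
    unfolding rank_def using assms by (intro card_mono) auto
  ultimately show "rank I ` I \<subseteq> {1..card I}" by auto
  have "inj_on (rank I) I" using rank_eq_iff[OF assms] by (auto simp: inj_on_def)
  then show "card (rank I ` I) = card {1..card I}" by (simp add: card_image)
qed simp

text \<open>Standardization replaces the letters by their ranks and removes all primes except that of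
  the first letter of the word, the only one that is not determined by the rest.\<close>

definition std_letter :: "nat set \<Rightarrow> nat \<Rightarrow> real \<Rightarrow> real" where
  "std_letter I c x = real (rank I (cl x)) - (if cl x = c \<and> is_primed x then 1/2 else 0)"

definition std :: "nat set \<Rightarrow> factorization \<Rightarrow> factorization" where
  "std I a = map (map (std_letter I (cl (hd (concat a))))) a"

lemma std_letter:
  assumes "finite I" "cl x \<in> I"
  shows "cl (std_letter I c x) = rank I (cl x)"
    "is_primed (std_letter I c x) \<longleftrightarrow> cl x = c \<and> is_primed x" "is_letter (std_letter I c x)"
proof -
  have "rank I (cl x) \<in> {1..card I}" using rank_image[OF assms(1)] assms(2) by blast
  then have "1 \<le> rank I (cl x)" by simp
  then show "cl (std_letter I c x) = rank I (cl x)"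
    "is_primed (std_letter I c x) \<longleftrightarrow> cl x = c \<and> is_primed x" "is_letter (std_letter I c x)"
    using letter_mk by (simp_all only: std_letter_def)
qed

lemma std_letter_cong: "cl x \<noteq> c \<Longrightarrow> cl x \<noteq> d \<Longrightarrow> std_letter I c x = std_letter I d x"
  by (simp add: std_letter_def)

lemma concat_std: "concat (std I a) = map (std_letter I (cl (hd (concat a)))) (concat a)"
  by (simp add: std_def map_concat)

lemma weight_std [simp]: "weight (std I a) = weight a"
  by (simp add: std_def weight_def)

text \<open>Since the ceiling \<open>c\<close> of the first letter is already in \<open>S\<close>,
  every prime of \<open>w\<close> is erased; hence the new prime pattern is constantly
  false.\<close>

lemma fan_std:
  assumes "fan H S w" "c \<in> S" "S \<union> cl ` set w \<subseteq> I" "finite I"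
  shows "fan (\<lambda>_. False) (rank I ` S) (map (std_letter I c) w)"
  using assms(1-3)
proof (induction w arbitrary: S)
  case (Cons x w)
  have "cl x \<noteq> c" using fan_disjoint[OF Cons.prems(1)] Cons.prems(2) by auto
  moreover have "(\<forall>y\<in>S. rank I y < rank I (cl x)) \<or> (\<forall>y\<in>S. rank I (cl x) < rank I y)"
    using fan_mem[OF Cons.prems(1), of x] Cons.prems(3) rank_less_iff[OF assms(4)]
    by (auto simp: subset_iff)
  moreover have "fan (\<lambda>_. False) (rank I ` insert (cl x) S) (map (std_letter I c) w)"
    using Cons.prems by (intro Cons.IH) auto
  ultimately show ?case using std_letter[OF assms(4), of x c] Cons.prems(3) by auto
qed simp

lemma fans_factor_distinct:
  assumes "a \<in> fans n H I" "w \<in> set a"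
  shows "distinct (map cl w)"
proof -
  have "distinct (map cl (concat a))" using assms(1) fan_distinct by (auto simp: fans_def)
  moreover obtain u v where "a = u @ w # v" using assms(2) split_list by metis
  ultimately show ?thesis by simp
qed

lemma std_sorted_iff:
  assumes "finite I" "cl ` set w \<subseteq> I" "distinct (map cl w)"
  shows "sorted_wrt (>) (map (std_letter I c) w) \<longleftrightarrow> sorted_wrt (>) w"
proof -
  have d: "distinct (map cl (map (std_letter I c) w))"
  proof -
    have "map cl (map (std_letter I c) w) = map (rank I) (map cl w)"
      using assms(2) std_letter(1)[OF assms(1)] by auto
    moreover have "inj_on (rank I) (set (map cl w))"
      using assms(2) by (intro inj_onI) (auto simp: rank_eq_iff[OF assms(1)] image_subset_iff)
    ultimately show ?thesis using assms(3) by (simp only: distinct_map[of "rank I"] simp_thms)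
  qed
  have eq: "sorted_wrt (\<lambda>x y. cl x > cl y) (map (std_letter I c) w) \<longleftrightarrow> sorted_wrt (\<lambda>x y. cl x > cl y) w"
    unfolding sorted_wrt_map
    using assms(2) std_letter(1)[OF assms(1)] rank_less_iff[OF assms(1)]
    by (intro iffI; elim sorted_wrt_mono_rel[rotated]) (auto simp: subset_iff)
  have "sorted_wrt (\<lambda>x y. cl x > cl y) w \<Longrightarrow> sorted_wrt (>) w" for w
    by (erule sorted_wrt_mono_rel[rotated]) (rule cl_less_imp)
  then show ?thesis using sorted_cl[OF d] sorted_cl[OF assms(3)] eq by blast
qed

lemma fans_factor_subset:
  assumes "a \<in> fans n H I" "w \<in> set a" shows "cl ` set w \<subseteq> I"
  using assms by (auto simp: fans_def)

lemma std_closed: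
  assumes a: "a \<in> fans n H I"
  shows "std I a \<in> fans n (\<lambda>_. False) {1..card I}"
proof -
  let ?c = "cl (hd (concat a))"
  have fin: "finite I" using a by (rule finite_fans)
  have f: "fan H {} (concat a)" "cl ` set (concat a) = I" using a by (auto simp: fans_def)
  have "fan (\<lambda>_. False) {} (concat (std I a))"
  proof (cases "concat a")
    case (Cons x w)
    have "fan (\<lambda>_. False) (rank I ` {cl x}) (map (std_letter I ?c) w)"
      using f Cons fin by (intro fan_std[of H]) auto
    then show ?thesis using std_letter[OF fin, of x ?c] f(2) Cons by (auto simp: concat_std)
  qed (simp only: concat_std list.map fan.simps)
  moreover have "cl ` set (concat (std I a)) = rank I ` I"
  proof -
    have "cl ` set (concat (std I a)) = (\<lambda>x. rank I (cl x)) ` set (concat a)"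
      unfolding concat_std set_map image_image
      using f(2) by (intro image_cong refl std_letter(1)[OF fin]) blast
    then show ?thesis using f(2) by (metis image_image)
  qed
  moreover have "\<forall>w\<in>set (std I a). sorted_wrt (>) w"
    using a std_sorted_iff[OF fin] fans_factor_subset[OF a] fans_factor_distinct[OF a]
    by (auto simp: std_def fans_def)
  ultimately show ?thesis using a rank_image[OF fin] by (simp add: fans_def std_def)
qed

text \<open>Once something has been read, the ceiling of a letter decides between going up and going
  down, and \<open>H\<close> then dictates its prime.\<close>

lemma fan_unique:
  assumes "fan H S w" "fan H S v" "S \<noteq> {}" "map cl w = map cl v"
  shows "w = v"
  using assms
proof (induction w arbitrary: v S)
  case (Cons x w)
  then obtain y v' where v: "v = y # v'" by (cases v) auto
  obtain s where s: "s \<in> S" using Cons.prems(3) by blast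
  \<comment> \<open>Comparison with a single element \<open>s\<close> of \<open>S\<close> decides
    the direction.\<close>
  have P: "is_primed z = (if s < cl z then H (cl z) else H (Min S))" if "fan H S (z # u)" for z u
    using that s by (auto dest: bspec[of S _ s])
  have "is_primed x = is_primed y" 
    using P[OF Cons.prems(1)] P[OF Cons.prems(2)[unfolded v]] Cons.prems(4) v by simp
  then have "x = y" using Cons.prems by (intro letter_eqI) (auto simp: v)
  moreover have "w = v'" using Cons.prems by (intro Cons.IH[of "insert (cl x) S"]) (auto simp: v)
  ultimately show ?case by (simp add: v)
qed simp

lemma concat_eq_imp_eq:
  "map length a = map length b \<Longrightarrow> concat a = concat b \<Longrightarrow> a = b"
  by (induction a arbitrary: b) (auto simp: Cons_eq_map_conv)

text \<open>The first standardized letter returns the ceiling and the prime of the first letter; the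
  ranks return the other ceilings and \<open>fan_unique\<close> their primes. The division into
  factors is read off the weight.\<close>

lemma inj_on_std: "inj_on (std I) (fans n H I)"
proof (rule inj_onI)
  fix a b assume a: "a \<in> fans n H I" and b: "b \<in> fans n H I" and eq: "std I a = std I b"
  have fin: "finite I" using a by (rule finite_fans)
  have l: "map length a = map length b" using weight_std[of I a] weight_std[of I b] eq by (simp add: weight_def)
  have fa: "fan H {} (concat a)" "cl ` set (concat a) = I" using a by (auto simp: fans_def)
  have fb: "fan H {} (concat b)" "cl ` set (concat b) = I" using b by (auto simp: fans_def)
  have ceq: "concat (std I a) = concat (std I b)" using eq by simp
  show "a = b"
  proof (cases "concat a")
    case Nil
    then have "concat b = []" using ceq unfolding concat_std by (metis map_is_Nil_conv)
    then show ?thesis using Nil by (intro concat_eq_imp_eq[OF l]) (simp only:)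
  next
    case (Cons x w)
    then obtain y v where v: "concat b = y # v" using ceq by (cases "concat b") (auto simp: concat_std)
    have I: "cl ` set (x # w) \<subseteq> I" "cl ` set (y # v) \<subseteq> I" using fa fb Cons v by auto
    have e: "std_letter I (cl x) x = std_letter I (cl y) y" 
      "map (std_letter I (cl x)) w = map (std_letter I (cl y)) v"
      using ceq Cons v by (auto simp: concat_std)
    have R: "rank I (cl z) = rank I (cl z') \<Longrightarrow> cl z = cl z'" if "cl z \<in> I" "cl z' \<in> I" for z z'
      using rank_eq_iff[OF fin] that by blast
    have xy: "cl x = cl y" "is_primed x = is_primed y"
      using std_letter(1,2)[OF fin, of x "cl x"] std_letter(1,2)[OF fin, of y "cl y"] e(1) I R by auto
    then have "x = y" using fa(1) fb(1) Cons v by (intro letter_eqI) auto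
    moreover have "w = v"
    proof (rule fan_unique)
      show "fan H {cl x} w" "fan H {cl x} v" using fa fb Cons v xy by auto
      have "map (rank I) (map cl w) = map (rank I) (map cl v)"
      proof -
        have E: "map cl (map (std_letter I (cl x)) w) = map cl (map (std_letter I (cl y)) v)" using e by simp
        have M: "map cl (map (std_letter I c) u) = map (rank I) (map cl u)" 
          if "cl ` set u \<subseteq> I" for u c using that std_letter(1)[OF fin] by auto
        have "cl ` set w \<subseteq> I" "cl ` set v \<subseteq> I" using I by auto
        then show ?thesis using E by (simp only: M)
      qed
      moreover have "inj_on (rank I) (set (map cl w) \<union> set (map cl v))"
        using I by (intro inj_onI) (auto simp: rank_eq_iff[OF fin] image_subset_iff)
      ultimately show "map cl w = map cl v" by (rule map_inj_on)
    qed simp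
    ultimately show ?thesis using l Cons v by (intro concat_eq_imp_eq) auto
  qed
qed

lemma obtain_letter:
  assumes "1 \<le> r"
  obtains x where "is_letter x" "cl x = r" "is_primed x = p"
  using letter_mk[OF assms] that by blast

text \<open>The ranks are pulled back letter by letter, and the primes erased by standardization are
  put back as \<open>H\<close> prescribes.\<close>

lemma fan_lift:
  assumes "finite I" "0 \<notin> I" "fan K (rank I ` S) v" "S \<subseteq> I" "cl ` set v \<subseteq> {1..card I}"
  shows "\<exists>w. fan H S w \<and> map cl v = map (rank I \<circ> cl) w \<and> cl ` set w \<subseteq> I"
  using assms(3-)
proof (induction v arbitrary: S)
  case (Cons y v)
  have "cl y \<in> rank I ` I" unfolding rank_image[OF assms(1)] using Cons.prems(3) by auto
  then obtain i where i: "i \<in> I" "cl y = rank I i" by blast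
  have "\<exists>w. fan H (insert i S) w \<and> map cl v = map (rank I \<circ> cl) w \<and> cl ` set w \<subseteq> I"
    using Cons.prems i by (intro Cons.IH) auto
  then obtain w where w: "fan H (insert i S) w" "map cl v = map (rank I \<circ> cl) w" "cl ` set w \<subseteq> I"
    by blast
  have "(\<forall>s\<in>S. s < i) \<or> (\<forall>s\<in>S. i < s)"
    using fan_mem[OF Cons.prems(1), of y] i Cons.prems(2) rank_less_iff[OF assms(1)] 
    by (auto simp: subset_iff)
  moreover have "1 \<le> i" using i assms(2) by (cases i) auto
  then obtain x where x: "is_letter x" "cl x = i" "is_primed x = (if \<forall>s\<in>S. s < i then H i else H (Min S))"
    by (rule obtain_letter)
  ultimately have "fan H S (x # w)" using w(1) by auto
  then show ?case using w x i by (intro exI[of _ "x # w"]) auto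
qed simp

lemma split_shape:
  assumes "length w = length (concat b)"
  obtains a where "concat a = w" "map length a = map length b"
  using assms
proof (induction b arbitrary: w thesis)
  case (Cons x b)
  obtain a where "concat a = drop (length x) w" "map length a = map length b"
    using Cons.IH[of "drop (length x) w"] Cons.prems(2) by auto
  then show ?case using Cons.prems(2) by (intro Cons.prems(1)[of "take (length x) w # a"]) auto
qed simp

text \<open>The first letter takes the prime of the first letter of \<open>b\<close>,
  \<open>fan_lift\<close> supplies the others, and \<open>fan_unique\<close> shows that
  standardizing gives back the word of \<open>b\<close>. The factors are then cut as those of
  \<open>b\<close>.\<close>

lemma std_surj:
  assumes I: "finite I" "0 \<notin> I" and b: "b \<in> fans n (\<lambda>_. False) {1..card I}"
  shows "b \<in> std I ` fans n H I"
proof -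
  have fb: "fan (\<lambda>_. False) {} (concat b)" "cl ` set (concat b) = {1..card I}"
    using b by (auto simp: fans_def)
  have "\<exists>w. fan H {} w \<and> cl ` set w \<subseteq> I \<and> map (std_letter I (cl (hd w))) w = concat b"
  proof (cases "concat b")
    case (Cons y v)
    obtain i where i: "i \<in> I" "cl y = rank I i" using fb(2) Cons rank_image[OF I(1)]
      by (metis imageE image_eqI list.set_intros(1))
    then have "1 \<le> i" using I(2) by (cases i) auto
    then obtain x where x: "is_letter x" "cl x = i" "is_primed x = is_primed y"
      by (rule obtain_letter)
    have "\<exists>w. fan H {i} w \<and> map cl v = map (rank I \<circ> cl) w \<and> cl ` set w \<subseteq> I"
      using fb i Cons by (intro fan_lift[OF I, of "\<lambda>_. False"]) auto
    then obtain w where w: "fan H {i} w" "map cl v = map (rank I \<circ> cl) w" "cl ` set w \<subseteq> I" by blast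
    have "map (std_letter I i) w = v"
    proof (rule fan_unique)
      show "fan (\<lambda>_. False) {rank I i} (map (std_letter I i) w)"
        using fan_std[OF w(1), of i I] w(3) I i by simp
      show "fan (\<lambda>_. False) {rank I i} v" using fb(1) Cons i by simp
      show "map cl (map (std_letter I i) w) = map cl v"
        unfolding w(2) using w(3) std_letter(1)[OF I(1)] by auto
    qed simp
    moreover have "std_letter I i x = y"
      using std_letter[OF I(1), of x i] x i fb(1) Cons by (intro letter_eqI) auto
    ultimately show ?thesis using w x i Cons by (intro exI[of _ "x # w"]) auto
  qed (auto intro: exI[of _ "[]"])
  then obtain w where w: "fan H {} w" "cl ` set w \<subseteq> I" "map (std_letter I (cl (hd w))) w = concat b" 
    by blast
  have "length w = length (concat b)" using w(3) by (metis length_map)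
  then obtain a where a: "concat a = w" "map length a = map length b" by (rule split_shape)
  have std: "std I a = b"
    using weight_std[of I a] a w by (intro concat_eq_imp_eq) (auto simp: weight_def concat_std)
  have "cl ` set w = I"
  proof -
    have "rank I ` cl ` set w = cl ` set (concat b)" 
      unfolding w(3)[symmetric] set_map image_image
      using w(2) by (intro image_cong refl std_letter(1)[OF I(1), symmetric]) auto
    also have "\<dots> = rank I ` I" using fb rank_image[OF I(1)] by simp
    finally show ?thesis
      using w(2) inj_on_image_eq_iff[of "rank I" I "cl ` set w" I] rank_eq_iff[OF I(1)]
      by (auto simp: inj_on_def)
  qed
  moreover have "length a = n" using map_eq_imp_length_eq[OF a(2)] b by (simp add: fans_def)
  moreover have "\<forall>u\<in>set a. sorted_wrt (>) u"
  proof
    fix u assume u: "u \<in> set a"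
    then have "map (std_letter I (cl (hd (concat a)))) u \<in> set b" unfolding std[symmetric] std_def by simp
    then have "sorted_wrt (>) (map (std_letter I (cl (hd (concat a)))) u)" using b by (simp add: fans_def)
    moreover have "cl ` set u \<subseteq> I"
    proof -
      have "set u \<subseteq> set w" using u a(1) by auto
      then show ?thesis using w(2) by blast
    qed
    moreover have "distinct (map cl u)"
    proof -
      have "distinct (map cl (concat a))" using fan_distinct w(1) a by blast
      moreover obtain p q where "a = p @ u # q" using u split_list by metis
      ultimately show ?thesis by simp
    qed
    ultimately show "sorted_wrt (>) u" using std_sorted_iff[OF I(1)] by blast
  qed
  ultimately have "a \<in> fans n H I" using a w by (simp add: fans_def del: set_concat)
  then show ?thesis using std by blast
qed


section \<open>Compatibility of standardization with the operators\<close>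

lemma has_up_std:
  assumes "finite I" "cl ` set (U @ V) \<subseteq> I"
  shows "has_up (map (std_letter I c) U) (map (std_letter I c) V) = has_up U V"
proof (cases "U = [] \<or> V = []")
  case False
  then have "cl (hd U) \<in> I" "cl (hd V) \<in> I" using assms(2) by (cases U; cases V; auto)+
  then show ?thesis using False std_letter(1)[OF assms(1)] rank_less_iff[OF assms(1)]
    by (simp add: has_up_def hd_map)
qed (auto simp: has_up_def)

lemma raise_fan_std:
  assumes "finite I" "cl ` set (U @ V) \<subseteq> I"
  shows "raise_fan (map (std_letter I c) U) (map (std_letter I c) V) =
    map_option (map_prod (map (std_letter I c)) (map (std_letter I c))) (raise_fan U V)"
  unfolding raise_fan_def has_up_std[OF assms]
  by (cases V; cases "tl V") (auto simp: has_up_def)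

lemma lower_fan_std:
  assumes "finite I" "cl ` set (U @ V) \<subseteq> I"
  shows "lower_fan (map (std_letter I c) U) (map (std_letter I c) V) =
    map_option (map_prod (map (std_letter I c)) (map (std_letter I c))) (lower_fan U V)"
  unfolding lower_fan_def has_up_std[OF assms]
  by (cases V; cases U) (auto simp: has_up_def map_butlast last_map map_tl)

text \<open>\<open>std\<close> depends on the first letter of the word to which it is applied, so
  hypothesis \<open>h\<close> is what allows the same letterwise map before and after the
  move.\<close>

lemma on_factors_std:
  assumes a: "a \<in> fans n H I"
    and g: "\<And>U V c. cl ` set (U @ V) \<subseteq> I \<Longrightarrow> g (map (std_letter I c) U) (map (std_letter I c) V) =
      map_option (map_prod (map (std_letter I c)) (map (std_letter I c))) (g U V)"
    and h: "\<And>b. on_factors g i a = Some b \<Longrightarrow> hd (concat b) = hd (concat a)"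
  shows "on_factors g i (std I a) = map_option (std I) (on_factors g i a)"
proof (cases "1 \<le> i \<and> i < length a")
  case True
  then obtain L U V R where ab: "a = L @ U # V # R" "i = Suc (length L)" 
    using factors_split by blast
  define c where "c = cl (hd (concat a))"
  define m where "m = map (std_letter I c)"
  have "cl ` set (U @ V) \<subseteq> I" using a unfolding ab fans_split by blast
  note g = g[OF this, of c, folded m_def]
  have "std I a = map m L @ m U # m V # map m R" unfolding std_def c_def[symmetric] m_def by (simp add: ab)
  then have "on_factors g i (std I a) = map_option (\<lambda>(U, V). map m L @ U # V # map m R) (g (m U) (m V))"
    using on_factors_split[of g "map m L" "m U" "m V" "map m R"] by (simp add: ab)
  also have "\<dots> = map_option (std I) (on_factors g i a)"
  proof (cases "g U V")
    case (Some p)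
    then obtain U' V' where "g U V = Some (U', V')" by (cases p) auto
    note UV = this
    then have b: "on_factors g i a = Some (L @ U' # V' # R)" by (simp add: ab on_factors_split)
    have "std I (L @ U' # V' # R) = map m (L @ U' # V' # R)"
      by (simp only: std_def h[OF b] m_def c_def)
    then show ?thesis by (simp add: g b UV)
  next
    case None
    then have "on_factors g i a = None" by (simp add: ab on_factors_split)
    with None show ?thesis by (simp add: g)
  qed
  finally show ?thesis .
qed (auto simp: on_factors_def std_def)

lemma e_num_std:
  assumes a: "a \<in> fans n H I"
  shows "e_num i (std I a) = map_option (std I) (e_num i a)"
  unfolding e_num_fans[OF a] e_num_fans[OF std_closed[OF a]]
  using e_num_closed(2)[OF a] raise_fan_std[OF finite_fans[OF a]]
  by (intro on_factors_std[OF a]) (simp_all add: e_num_fans[OF a])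

lemma f_num_std:
  assumes a: "a \<in> fans n H I"
  shows "f_num i (std I a) = map_option (std I) (f_num i a)"
  unfolding f_num_fans[OF a] f_num_fans[OF std_closed[OF a]]
  using f_num_closed(2)[OF a] lower_fan_std[OF finite_fans[OF a]]
  by (intro on_factors_std[OF a]) (simp_all add: f_num_fans[OF a])

lemma sigma_std:
  assumes a: "a \<in> fans n H I" and i: "1 \<le> i" "i < n"
  shows "sigma i (std I a) = std I (sigma i a)"
proof -
  have "length a = n" using a by (simp add: fans_def)
  then have l: "length (std I a ! (i - 1)) = length (a ! (i - 1))" "length (std I a ! i) = length (a ! i)"
    using i by (simp_all add: std_def)
  have ef: "opt_iter (f_num i) k (std I a) = map_option (std I) (opt_iter (f_num i) k a)"
    "opt_iter (e_num i) k (std I a) = map_option (std I) (opt_iter (e_num i) k a)" for k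
    by (rule opt_iter_equivariant[where X = "fans n H I"];
        (rule e_num_closed(1) f_num_closed(1) e_num_std f_num_std a; assumption?))+
  from a i show ?thesis
  proof (rule sigma_cases)
    fix k assume "length (a ! i) \<le> length (a ! (i - 1))" "k = length (a ! (i - 1)) - length (a ! i)"
      "opt_iter (f_num i) k a = Some (sigma i a)"
    then show ?thesis unfolding sigma_def[of i "std I a"] l ef by simp
  next
    fix k assume "\<not> length (a ! i) \<le> length (a ! (i - 1))" "k = length (a ! i) - length (a ! (i - 1))"
      "opt_iter (e_num i) k a = Some (sigma i a)"
    then show ?thesis unfolding sigma_def[of i "std I a"] l ef by simp
  qed
qed

text \<open>Here \<open>y\<close> is the first letter before the exchange and \<open>x\<close> after
  it. The prime of \<open>y\<close> passes to \<open>x\<close> and survives on both sides; the prime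
  of \<open>x\<close> is erased on both sides.\<close>

lemma std_letter_prime_as:
  assumes "finite I" "is_letter x" "is_letter y" "cl x \<in> I" "cl y \<in> I" "cl x \<noteq> cl y"
  shows "std_letter I (cl x) (prime_as x y) = prime_as (std_letter I (cl y) x) (std_letter I (cl y) y)"
    "std_letter I (cl x) (prime_as y x) = prime_as (std_letter I (cl y) y) (std_letter I (cl y) x)"
proof -
  note s = std_letter[OF assms(1)]
  note p = prime_as_letter[OF assms(2,3)] prime_as_letter[OF assms(3,2)]
    prime_as_letter[OF s(3) s(3), OF assms(4,5), of "cl y" "cl y"]
    prime_as_letter[OF s(3) s(3), OF assms(5,4), of "cl y" "cl y"]
  show "std_letter I (cl x) (prime_as x y) = prime_as (std_letter I (cl y) x) (std_letter I (cl y) y)"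
    "std_letter I (cl x) (prime_as y x) = prime_as (std_letter I (cl y) y) (std_letter I (cl y) x)"
    by (rule letter_eqI; use assms s p in simp)+
qed

text \<open>The first letter changes from \<open>w\<close> to \<open>x\<close>, so the two
  standardizations use different maps. These agree on all other letters by
  \<open>std_letter_cong\<close>, and on \<open>w\<close> and \<open>x\<close> the difference is the
  exchange of primes.\<close>

lemma raise_bar_std:
  assumes a: "a \<in> fans n H I"
  shows "on_factors raise_bar 1 (std I a) = map_option (std I) (on_factors raise_bar 1 a)"
proof (cases "1 < length a")
  case True
  then obtain U V R where ab: "a = U # V # R" by (cases a; cases "tl a") auto
  have fin: "finite I" using a by (rule finite_fans)
  have f: "fan H {} (U @ V @ concat R)" "cl ` set (U @ V @ concat R) = I"
    using a unfolding ab fans_Cons2 by blast+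
  have oc: "on_factors g 1 (U # V # R) = map_option (\<lambda>(U, V). U # V # R) (g U V)" for g U V R
    using on_factors_split[of g "[]"] by simp
  show ?thesis
  proof (cases "U = [] \<or> V = []")
    case True
    then show ?thesis by (cases U; cases V) (auto simp: ab oc std_def simp del: One_nat_def)
  next
    case False
    then obtain w X x W where UV: "U = w # X" "V = x # W" by (cases U; cases V) auto
    have L: "is_letter w" "is_letter x" and I: "cl w \<in> I" "cl x \<in> I"
      using fan_letter[OF f(1)] f(2) UV by auto
    have d: "distinct (map cl (w # X @ x # W @ concat R))" using fan_distinct[OF f(1)] UV by simp
    have lt: "\<lceil>std_letter I (cl w) w\<rceil> < \<lceil>std_letter I (cl w) x\<rceil> \<longleftrightarrow> \<lceil>w\<rceil> < \<lceil>x\<rceil>"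
      using I L by (simp add: ceiling_letter std_letter[OF fin] rank_less_iff[OF fin])
    have same: "std_letter I (cl w) y = std_letter I (cl x) y" if "y \<in> set (X @ W @ concat R)" for y
      using d that by (intro std_letter_cong) (auto simp: image_iff simp del: set_concat)
    have wx: "cl w \<noteq> cl x" using d by auto
    have sa: "std I a = map (std_letter I (cl w)) U # map (std_letter I (cl w)) V #
      map (map (std_letter I (cl w))) R" by (simp add: std_def ab UV)
    show ?thesis
    proof (cases "\<lceil>w\<rceil> < \<lceil>x\<rceil>")
      case True
      define b where "b = (prime_as x w # prime_as w x # X) # W # R"
      have hb: "cl (hd (concat b)) = cl x" using prime_as_letter L by (simp add: b_def)
      have "on_factors raise_bar 1 a = Some b" unfolding ab oc using True by (simp add: UV b_def)
      moreover have "on_factors raise_bar 1 (std I a) = Some (std I b)"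
      proof -
        have sb: "std I b = map (map (std_letter I (cl x))) b" by (simp only: std_def hb)
        have "map (std_letter I (cl w)) Y = map (std_letter I (cl x)) Y" if "set Y \<subseteq> set (X @ W @ concat R)" for Y
          using same that by (auto simp: subset_iff)
        then have "map (std_letter I (cl w)) X = map (std_letter I (cl x)) X" 
          "map (std_letter I (cl w)) W = map (std_letter I (cl x)) W"
          "map (map (std_letter I (cl w))) R = map (map (std_letter I (cl x))) R" by auto
        then show ?thesis unfolding sb sa oc unfolding b_def using True lt
          by (simp add: UV std_letter_prime_as[OF fin L(2,1) I(2,1) wx[symmetric]])
      qed
      ultimately show ?thesis by simp
    next
      case False
      then have "on_factors raise_bar 1 a = None" unfolding ab oc by (simp add: UV)
      moreover have "on_factors raise_bar 1 (std I a) = None"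
        unfolding sa oc using False lt by (simp add: UV)
      ultimately show ?thesis by simp
    qed
  qed
qed (simp add: on_factors_def std_def)

lemma lower_bar_std:
  assumes a: "a \<in> fans n H I"
  shows "on_factors lower_bar 1 (std I a) = map_option (std I) (on_factors lower_bar 1 a)"
proof (cases "1 < length a")
  case True
  then obtain U V R where ab: "a = U # V # R" by (cases a; cases "tl a") auto
  have fin: "finite I" using a by (rule finite_fans)
  have f: "fan H {} (U @ V @ concat R)" "cl ` set (U @ V @ concat R) = I"
    using a unfolding ab fans_Cons2 by blast+
  have oc: "on_factors g 1 (U # V # R) = map_option (\<lambda>(U, V). U # V # R) (g U V)" for g U V R
    using on_factors_split[of g "[]"] by simp
  show ?thesis
  proof (cases U)
    case Nil
    then show ?thesis by (simp add: ab oc std_def lower_bar_def del: One_nat_def)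
  next
    case (Cons x X)
    have L: "is_letter y" and I: "cl y \<in> I" if "y \<in> set (U @ V)" for y
      using fan_letter[OF f(1)] f(2) that by auto
    let ?g = "std_letter I (cl x)"
    have sa: "std I a = map ?g U # map ?g V # map (map ?g) R" by (simp add: std_def ab Cons)
    have cond: "(map ?g V = [] \<or> \<lceil>hd (map ?g V)\<rceil> < \<lceil>?g x\<rceil>) \<longleftrightarrow> (V = [] \<or> \<lceil>hd V\<rceil> < \<lceil>x\<rceil>)"
    proof (cases V)
      case (Cons v V')
      then have "is_letter v" "cl v \<in> I" "is_letter x" "cl x \<in> I" using L I \<open>U = x # X\<close> by auto
      then show ?thesis by (simp add: Cons ceiling_letter std_letter[OF fin] rank_less_iff[OF fin])
    qed simp
    show ?thesis
    proof (cases "V = [] \<or> \<lceil>hd V\<rceil> < \<lceil>x\<rceil>")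
      case True
      show ?thesis
      proof (cases X)
        case Nil
        have "on_factors lower_bar 1 a = Some ([] # (x # V) # R)"
          unfolding ab oc using True by (simp add: Cons Nil lower_bar_def)
        moreover have "on_factors lower_bar 1 (std I a) = Some (map (map ?g) ([] # (x # V) # R))"
          unfolding sa oc using True cond
          by (simp add: Cons Nil lower_bar_def del: map_is_Nil_conv Nil_is_map_conv)
        ultimately show ?thesis by (simp add: std_def)
      next
        case X: (Cons w W)
        define b where "b = (prime_as w x # W) # (prime_as x w # V) # R"
        have Lx: "is_letter x" "is_letter w" "cl x \<in> I" "cl w \<in> I" using L I Cons X by auto
        have hb: "cl (hd (concat b)) = cl w" using prime_as_letter Lx by (simp add: b_def)
        have d: "distinct (map cl (x # w # W @ V @ concat R))" using fan_distinct[OF f(1)] Cons X by simp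
        then have wx: "cl w \<noteq> cl x" by auto
        have same: "?g y = std_letter I (cl w) y" if "y \<in> set (W @ V @ concat R)" for y
          using d that by (intro std_letter_cong) (auto simp: image_iff simp del: set_concat)
        have sb: "std I b = map (map (std_letter I (cl w))) b" by (simp only: std_def hb)
        have "map ?g Y = map (std_letter I (cl w)) Y" if "set Y \<subseteq> set (W @ V @ concat R)" for Y
          using same that by (auto simp: subset_iff)
        then have eqs: "map ?g W = map (std_letter I (cl w)) W" 
          "map ?g V = map (std_letter I (cl w)) V"
          "map (map ?g) R = map (map (std_letter I (cl w))) R" by auto
        have "on_factors lower_bar 1 a = Some b"
          unfolding ab oc using True by (simp add: Cons X lower_bar_def b_def)
        moreover have "on_factors lower_bar 1 (std I a) = Some (std I b)"
        proof -
          have "lower_bar (map ?g U) (map ?g V) = 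
            Some (prime_as (?g w) (?g x) # map ?g W, prime_as (?g x) (?g w) # map ?g V)"
            using True cond by (simp add: Cons X lower_bar_def del: map_is_Nil_conv Nil_is_map_conv)
          then have "on_factors lower_bar 1 (std I a) = 
            Some ((prime_as (?g w) (?g x) # map ?g W) # (prime_as (?g x) (?g w) # map ?g V) # map (map ?g) R)"
            unfolding sa oc by simp
          then show ?thesis unfolding sb unfolding b_def list.map eqs
            by (simp add: std_letter_prime_as[OF fin Lx(2,1,4,3) wx])
        qed
        ultimately show ?thesis by simp
      qed
    next
      case False
      then have "on_factors lower_bar 1 a = None" unfolding ab oc by (simp add: Cons lower_bar_def)
      moreover have "on_factors lower_bar 1 (std I a) = None"
        unfolding sa oc using False cond
        by (simp add: Cons lower_bar_def del: map_is_Nil_conv Nil_is_map_conv)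
      ultimately show ?thesis by simp
    qed
  qed
qed (simp add: on_factors_def std_def)

lemma prime_std:
  assumes a: "a \<in> fans n H I"
  shows "raise_prime (std I a) = map_option (std I) (raise_prime a)"
    "lower_prime (std I a) = map_option (std I) (lower_prime a)"
proof -
  have fin: "finite I" using a by (rule finite_fans)
  have "raise_prime (std I a) = map_option (std I) (raise_prime a) \<and>
    lower_prime (std I a) = map_option (std I) (lower_prime a)"
  proof (cases "a = [] \<or> hd a = []")
    case True
    then show ?thesis by (cases a) (auto simp: std_def)
  next
    case False
    then obtain x w R where ab: "a = (x # w) # R" by (cases a; cases "hd a") auto
    have f: "fan H {} (x # w @ concat R)" "cl x \<in> I" using a by (auto simp: fans_def ab)
    have L: "is_letter x" using f by simp
    have d: "distinct (map cl (x # w @ concat R))" using fan_distinct[OF f(1)] .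
    let ?g = "std_letter I (cl x)"
    have gx: "is_primed (?g x) = is_primed x" using std_letter[OF fin f(2)] by simp
    let ?r = "of_int \<lceil>x\<rceil> :: real" and ?l = "prm \<lceil>x\<rceil>"
    have eq: "?r = real (cl x) - (if False then 1/2 else 0)" "?l = real (cl x) - (if True then 1/2 else 0)"
      using ceiling_letter[OF L] by (simp_all add: prm_def)
    note mk = letter_mk[OF cl_letter_pos[OF L]]
    have rl: "cl ?r = cl x" "\<not> is_primed ?r" "cl ?l = cl x" "is_primed ?l"
      unfolding eq by (simp_all only: mk simp_thms)
    have c: "\<lceil>?g x\<rceil> = int (rank I (cl x))" using ceiling_letter std_letter[OF fin f(2)] by metis
    have "?g ?r = of_int \<lceil>?g x\<rceil>" unfolding c std_letter_def[of I "cl x" ?r] using rl by simp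
    moreover have "prm \<lceil>?g x\<rceil> = real (rank I (cl x)) - 1 / 2" unfolding c prm_def by simp
    then have "?g ?l = prm \<lceil>?g x\<rceil>" using rl unfolding std_letter_def[of I "cl x" ?l] by simp
    ultimately have "?g ?r = of_int \<lceil>?g x\<rceil>" "?g ?l = prm \<lceil>?g x\<rceil>" by blast+
    then show ?thesis using gx rl by (simp add: std_def ab)
  qed
  then show "raise_prime (std I a) = map_option (std I) (raise_prime a)"
    "lower_prime (std I a) = map_option (std I) (lower_prime a)" by blast+
qed

section \<open>Operators conjugated by the Weyl group action\<close>

lemma bar_conj_closed:
  assumes g: "\<And>a b. a \<in> fans n H I \<Longrightarrow> g a = Some b \<Longrightarrow> b \<in> fans n H I"
    and "i < n" "a \<in> fans n H I" "bar_conj g i a = Some b"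
  shows "b \<in> fans n H I"
  using assms(2-)
proof (induction i arbitrary: a b rule: less_induct)
  case (less i)
  consider "i = 0" | "i = 1" | j where "i = Suc (Suc j)" by (metis One_nat_def not0_implies_Suc)
  then show ?case
  proof cases
    case 3
    let ?a = "sigma (Suc (Suc j)) (sigma (Suc j) a)"
    obtain b' where b': "bar_conj g (Suc j) ?a = Some b'" "b = sigma (Suc j) (sigma (Suc (Suc j)) b')"
      using less.prems(3) unfolding 3 by auto
    have "?a \<in> fans n H I" using less.prems(1,2) 3 by (intro sigma_closed) auto
    then have "b' \<in> fans n H I" using less.IH[of "Suc j"] less.prems(1) b'(1) 3 by auto
    then show ?thesis unfolding b' using less.prems(1) 3 by (intro sigma_closed) auto
  qed (use less.prems g in auto)
qed

lemma bar_conj_std: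
  assumes g: "\<And>a b. a \<in> fans n H I \<Longrightarrow> g a = Some b \<Longrightarrow> b \<in> fans n H I"
    and gs: "\<And>a. a \<in> fans n H I \<Longrightarrow> g (std I a) = map_option (std I) (g a)"
    and "i < n" "a \<in> fans n H I"
  shows "bar_conj g i (std I a) = map_option (std I) (bar_conj g i a)"
  using assms(3-)
proof (induction i arbitrary: a rule: less_induct)
  case (less i)
  consider "i = 0" | "i = 1" | j where "i = Suc (Suc j)" by (metis One_nat_def not0_implies_Suc)
  then show ?case
  proof cases
    case 3
    let ?a = "sigma (Suc (Suc j)) (sigma (Suc j) a)"
    have a1: "sigma (Suc j) a \<in> fans n H I" "?a \<in> fans n H I"
      using less.prems(1,2) 3 by (auto intro!: sigma_closed)
    have "sigma (Suc (Suc j)) (sigma (Suc j) (std I a)) = std I ?a"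
      using less.prems a1 3 by (simp add: sigma_std)
    moreover have "bar_conj g (Suc j) (std I ?a) = map_option (std I) (bar_conj g (Suc j) ?a)"
      using less.IH[of "Suc j"] less.prems(1) a1 3 by auto
    moreover have "sigma (Suc j) (sigma (Suc (Suc j)) (std I b)) = std I (sigma (Suc j) (sigma (Suc (Suc j)) b))"
      if "bar_conj g (Suc j) ?a = Some b" for b
    proof -
      have "b \<in> fans n H I" using bar_conj_closed[OF g _ a1(2) that] less.prems(1) 3 by auto
      then show ?thesis using less.prems(1) 3 by (simp add: sigma_std[of _ n H] sigma_closed)
    qed
    ultimately show ?thesis unfolding 3 bar_conj.simps by (cases "bar_conj g (Suc j) ?a") auto
  qed (use less.prems gs in auto)
qed

lemma prime_conj_closed:
  assumes g: "\<And>a b. a \<in> fans n H I \<Longrightarrow> g a = Some b \<Longrightarrow> b \<in> fans n H I"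
    and "i \<le> n" "a \<in> fans n H I" "prime_conj g i a = Some b"
  shows "b \<in> fans n H I"
  using assms(2-)
proof (induction i arbitrary: a b rule: less_induct)
  case (less i)
  consider "i = 0" | "i = 1" | j where "i = Suc (Suc j)" by (metis One_nat_def not0_implies_Suc)
  then show ?case
  proof cases
    case 3
    let ?a = "sigma (Suc j) a"
    obtain b' where b': "prime_conj g (Suc j) ?a = Some b'" "b = sigma (Suc j) b'"
      using less.prems(3) unfolding 3 by auto
    have "?a \<in> fans n H I" using less.prems(1,2) 3 by (intro sigma_closed) auto
    then have "b' \<in> fans n H I" using less.IH[of "Suc j"] less.prems(1) b'(1) 3 by auto
    then show ?thesis unfolding b' using less.prems(1) 3 by (intro sigma_closed) auto
  qed (use less.prems g in auto)
qed

lemma prime_conj_std: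
  assumes g: "\<And>a b. a \<in> fans n H I \<Longrightarrow> g a = Some b \<Longrightarrow> b \<in> fans n H I"
    and gs: "\<And>a. a \<in> fans n H I \<Longrightarrow> g (std I a) = map_option (std I) (g a)"
    and "i \<le> n" "a \<in> fans n H I"
  shows "prime_conj g i (std I a) = map_option (std I) (prime_conj g i a)"
  using assms(3-)
proof (induction i arbitrary: a rule: less_induct)
  case (less i)
  consider "i = 0" | "i = 1" | j where "i = Suc (Suc j)" by (metis One_nat_def not0_implies_Suc)
  then show ?case
  proof cases
    case 3
    let ?a = "sigma (Suc j) a"
    have a1: "?a \<in> fans n H I"
      using less.prems(1,2) 3 by (auto intro!: sigma_closed)
    have "sigma (Suc j) (std I a) = std I ?a"
      using less.prems 3 by (simp add: sigma_std)
    moreover have "prime_conj g (Suc j) (std I ?a) = map_option (std I) (prime_conj g (Suc j) ?a)"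
      using less.IH[of "Suc j"] less.prems(1) a1 3 by auto
    moreover have "sigma (Suc j) (std I b) = std I (sigma (Suc j) b)"
      if "prime_conj g (Suc j) ?a = Some b" for b
    proof -
      have "b \<in> fans n H I" using prime_conj_closed[OF g _ a1 that] less.prems(1) 3 by auto
      then show ?thesis using less.prems(1) 3 by (simp add: sigma_std)
    qed
    ultimately show ?thesis unfolding 3 prime_conj.simps by (cases "prime_conj g (Suc j) ?a") auto
  qed (use less.prems gs in auto)
qed

lemma on_factors_bar_closed:
  assumes a: "a \<in> fans n H I"
  shows "on_factors raise_bar 1 a = Some b \<Longrightarrow> b \<in> fans n H I"
    "on_factors lower_bar 1 a = Some b \<Longrightarrow> b \<in> fans n H I"
proof -
  show "b \<in> fans n H I" if "on_factors raise_bar 1 a = Some b"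
    using that by (rule on_factors_SomeE) (use a raise_bar_closed in force)
  show "b \<in> fans n H I" if "on_factors lower_bar 1 a = Some b"
    using that by (rule on_factors_SomeE) (use a lower_bar_closed in force)
qed

lemma op_closed:
  assumes a: "a \<in> fans n H I" and i: "\<iota> \<in> crystal_indices n"
  shows "e_op \<iota> a = Some b \<Longrightarrow> b \<in> fans n H I" "f_op \<iota> a = Some b \<Longrightarrow> b \<in> fans n H I"
proof -
  have "bar_conj (on_factors raise_bar 1) j a = Some b \<Longrightarrow> b \<in> fans n H I"
    "bar_conj (on_factors lower_bar 1) j a = Some b \<Longrightarrow> b \<in> fans n H I" if "j < n" for j
    using that a by (auto elim!: bar_conj_closed[rotated -1] intro: on_factors_bar_closed simp del: One_nat_def)
  moreover have "prime_conj raise_prime j a = Some b \<Longrightarrow> b \<in> fans n H I"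
    "prime_conj lower_prime j a = Some b \<Longrightarrow> b \<in> fans n H I" if "j \<le> n" for j
    using that a by (auto elim!: prime_conj_closed[rotated -1] intro: raise_prime_closed lower_prime_closed)
  ultimately show "e_op \<iota> a = Some b \<Longrightarrow> b \<in> fans n H I" "f_op \<iota> a = Some b \<Longrightarrow> b \<in> fans n H I"
    using i e_num_closed(1)[OF a] f_num_closed(1)[OF a]
    by (auto simp: crystal_indices_def simp del: One_nat_def)
qed

lemma op_std:
  assumes a: "a \<in> fans n H I" and i: "\<iota> \<in> crystal_indices n"
  shows "e_op \<iota> (std I a) = map_option (std I) (e_op \<iota> a)"
    "f_op \<iota> (std I a) = map_option (std I) (f_op \<iota> a)"
proof -
  have "bar_conj (on_factors raise_bar 1) j (std I a) = map_option (std I) (bar_conj (on_factors raise_bar 1) j a)"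
    if "j < n" for j
    by (rule bar_conj_std[OF _ _ that a])
      (rule on_factors_bar_closed(1), assumption+, rule raise_bar_std, assumption)
  moreover have "bar_conj (on_factors lower_bar 1) j (std I a) = map_option (std I) (bar_conj (on_factors lower_bar 1) j a)"
    if "j < n" for j
    by (rule bar_conj_std[OF _ _ that a])
      (rule on_factors_bar_closed(2), assumption+, rule lower_bar_std, assumption)
  moreover have "prime_conj raise_prime j (std I a) = map_option (std I) (prime_conj raise_prime j a)"
    if "j \<le> n" for j
    by (rule prime_conj_std[OF _ _ that a])
      (rule raise_prime_closed, assumption+, rule prime_std(1), assumption)
  moreover have "prime_conj lower_prime j (std I a) = map_option (std I) (prime_conj lower_prime j a)" 
    if "j \<le> n" for j
    by (rule prime_conj_std[OF _ _ that a])
      (rule lower_prime_closed, assumption+, rule prime_std(2), assumption)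
  ultimately show "e_op \<iota> (std I a) = map_option (std I) (e_op \<iota> a)"
    "f_op \<iota> (std I a) = map_option (std I) (f_op \<iota> a)"
    using i e_num_std[OF a] f_num_std[OF a]
    by (auto simp: crystal_indices_def simp del: One_nat_def)
qed

text \<open>Injectivity of \<open>std\<close> is used on all of \<open>fans\<close>: the value of an
  operator may leave \<open>X\<close>, and its image must then differ from the images of the
  elements of \<open>X\<close>.\<close>

lemma std_crystal_iso:
  assumes "X \<subseteq> fans n H I" "finite I" 
  shows "q_crystal_iso n X (std I ` X)"
  unfolding q_crystal_iso_def
proof (intro exI[of _ "std I"] conjI ballI)
  have inj: "inj_on (std I) X" using inj_on_std assms(1) inj_on_subset by blast
  then show "bij_betw (std I) X (std I ` X)" by (rule inj_on_imp_bij_betw)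
  fix \<iota> a b assume i: "\<iota> \<in> crystal_indices n" and ab: "a \<in> X" "b \<in> X"
  have a: "a \<in> fans n H I" and b: "b \<in> fans n H I" using ab assms(1) by auto
  have "map_option (std I) u = Some (std I b) \<longleftrightarrow> u = Some b" if "\<And>c. u = Some c \<Longrightarrow> c \<in> fans n H I" for u
    using that b inj_on_std[of I n H] by (cases u) (auto simp: inj_on_def)
  then show "e_op \<iota> a = Some b \<longleftrightarrow> e_op \<iota> (std I a) = Some (std I b)"
    "f_op \<iota> a = Some b \<longleftrightarrow> f_op \<iota> (std I a) = Some (std I b)"
    using op_closed[OF a i] by (auto simp: op_std[OF a i])
qed auto


section \<open>Demazure operators\<close>

text \<open>Strict lower bounds for factors counted from 0, so that the standard flag is the case
  \<open>c i = i\<close>. Recursion with a shifted \<open>c\<close> lets two adjacent factors be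
  singled out by \<open>bounded_append\<close>.\<close>

fun bounded :: "(nat \<Rightarrow> nat) \<Rightarrow> factorization \<Rightarrow> bool" where
  "bounded c [] \<longleftrightarrow> True"
| "bounded c (w # a) \<longleftrightarrow> (\<forall>m\<in>set w. c 0 < cl m) \<and> bounded (\<lambda>i. c (Suc i)) a"

lemma bounded_nth: "bounded c a \<longleftrightarrow> (\<forall>i<length a. \<forall>m\<in>set (a ! i). c i < cl m)"
proof (induction a arbitrary: c)
  case (Cons w a)
  then show ?case by (auto simp: less_Suc_eq_0_disj)
qed simp

lemma bounded_append: "bounded c (a @ b) \<longleftrightarrow> bounded c a \<and> bounded (\<lambda>i. c (i + length a)) b"
proof (induction a arbitrary: c)
  case (Cons w a)
  show ?case by (simp add: Cons.IH)
qed simp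

text \<open>Raising only moves a letter between the factors with indices \<open>j - 1\<close> and
  \<open>j\<close>, counted from 0, and these have the same bound.\<close>

lemma bounded_exchange:
  assumes a: "a \<in> fans n H I" and b: "e_num j a = Some b" and c: "c j = c (j - 1)"
  shows "bounded c b \<longleftrightarrow> bounded c a"
proof -
  obtain L U V R U' V' where ab: "a = L @ U # V # R" "j = Suc (length L)" "b = L @ U' # V' # R"
    "raise_fan U V = Some (U', V')" 
    using b unfolding e_num_fans[OF a] by (rule on_factors_SomeE)
  have f: "fan H (cl ` set (concat L)) (U @ V)" "sorted_wrt (>) U" "sorted_wrt (>) V"
    using a unfolding ab fans_split by auto
  have "set (U' @ V') = set (U @ V)" using raise_fan_closed(4)[OF f _ ab(4)] by simp
  then have "(\<forall>m\<in>set (U' @ V'). c (length L) < cl m) \<longleftrightarrow> (\<forall>m\<in>set (U @ V). c (length L) < cl m)"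
    by simp
  moreover have "c (Suc (length L)) = c (length L)" using c by (simp add: ab(2))
  ultimately show ?thesis unfolding ab(1,3) bounded_append by (simp add: ball_Un) argo
qed

text \<open>Lowering the bound of factor \<open>j\<close> to that of its left neighbour makes the
  condition constant on strings of \<open>e_num j\<close>, which gives one inclusion. Conversely,
  while a letter of factor \<open>j\<close> violates \<open>c\<close>, raising is possible and
  shortens that factor.\<close>

lemma demazure_bounded:
  assumes M: "RF_O n z = fans n H I" and j: "1 \<le> j" and c: "c j = Suc (c (j - 1))"
  shows "demazure n z j {a \<in> fans n H I. bounded c a} =
    {a \<in> fans n H I. bounded (c(j := c (j - 1))) a}"
proof -
  define c' where "c' = c(j := c (j - 1))"
  have c': "c' j = c' (j - 1)" "\<And>i. c' i \<le> c i" "\<And>i. i \<noteq> j \<Longrightarrow> c' i = c i" 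
    using c j by (auto simp: c'_def)
  have "bounded c' a" if "a \<in> fans n H I" "opt_iter (e_num j) k a = Some b" "bounded c b" for a b k
    using that
  proof (induction k arbitrary: a)
    case 0
    then show ?case using c'(2) by (auto simp: bounded_nth) (meson le_less_trans)
  next
    case (Suc k)
    then obtain a' where a': "e_num j a = Some a'" "opt_iter (e_num j) k a' = Some b"
      by (auto simp: opt_iter_Suc bind_eq_Some_conv)
    then have "bounded c' a'" using Suc e_num_closed(1) by blast
    then show ?case using bounded_exchange[OF Suc.prems(1) a'(1), of c'] c' by blast
  qed
  moreover have "\<exists>k b. b \<in> fans n H I \<and> bounded c b \<and> opt_iter (e_num j) k a = Some b" 
    if "a \<in> fans n H I" "bounded c' a" for a
    using that
  proof (induction "length (a ! j)" arbitrary: a rule: less_induct)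
    case less
    show ?case
    proof (cases "bounded c a")
      case True
      then show ?thesis using less.prems by (intro exI[of _ 0] exI[of _ a]) simp
    next
      case False
      then obtain i m where i: "i < length a" "m \<in> set (a ! i)" "\<not> c i < cl m" by (auto simp: bounded_nth)
      then have "c' i < cl m" using less.prems(2) by (auto simp: bounded_nth)
      then have "i = j" using c'(3) i(3) by metis
      then obtain L U V R where ab: "a = L @ U # V # R" "j = Suc (length L)" 
        using factors_split[of j a] i(1) j by metis
      have V: "m \<in> set V" using i(2) \<open>i = j\<close> by (simp add: ab nth_append)
      have m: "cl m \<le> c j" using i(3) \<open>i = j\<close> by simp
      have f: "fan H (cl ` set (concat L)) (U @ V)" "sorted_wrt (>) U" "sorted_wrt (>) V"
        using less.prems(1) unfolding ab fans_split by auto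
      \<comment> \<open>If raising failed, \<open>m\<close> would be alone in its factor and paired
        with \<open>hd U\<close>. Then \<open>hd U\<close> would lie strictly between
        \<open>c (j - 1)\<close> and \<open>m\<close>, but \<open>m\<close> is at most
        \<open>c (j - 1) + 1\<close>.\<close>
      have "\<not> (has_up U V \<and> tl V = [])"
      proof
        assume h: "has_up U V \<and> tl V = []"
        then have "V = [m]" using V by (cases V) auto
        with h have "cl (hd U) < cl m" "hd U \<in> set U" by (auto simp: has_up_def)
        moreover have "\<forall>u\<in>set U. c' (j - 1) < cl u"
          using less.prems(2) unfolding ab bounded_append by simp
        moreover have "c' (j - 1) = c (j - 1)" using c'(3) j by simp
        ultimately have "c (j - 1) < cl (hd U)" "cl (hd U) < cl m" by auto
        with m c show False by linarith
      qed
      then obtain U' V' where UV: "raise_fan U V = Some (U', V')" 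
        using V by (cases "has_up U V"; cases V; cases "tl V") (auto simp: raise_fan_def)
      let ?b = "L @ U' # V' # R"
      have e: "e_num j a = Some ?b" unfolding e_num_fans[OF less.prems(1)] unfolding ab on_factors_split UV by simp
      have b: "?b \<in> fans n H I" using e_num_closed(1)[OF less.prems(1) e] .
      have "length (?b ! j) < length (a ! j)"
        using raise_fan_closed(6)[OF f _ UV] by (simp add: ab nth_append)
      then obtain k d where "d \<in> fans n H I \<and> bounded c d \<and> opt_iter (e_num j) k ?b = Some d"
        using less.hyps[OF _ b] bounded_exchange[OF less.prems(1) e, of c'] c' less.prems(2) by blast
      then show ?thesis using e by (intro exI[of _ "Suc k"] exI[of _ d]) (simp add: opt_iter_Suc)
    qed
  qed
  ultimately show ?thesis unfolding demazure_def M c'_def[symmetric] by blast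
qed

text \<open>Moving \<open>j\<close> up to \<open>j + 1\<close> changes the number of elements up to
  a point only at the point \<open>j\<close>. This is the change of bounds in
  \<open>demazure_bounded\<close>, whose hypothesis of a jump by one says that \<open>j\<close> is
  in \<open>J\<close>.\<close>

lemma rank_simple_refl:
  assumes "finite J" "j \<in> J" "Suc j \<notin> J" "1 \<le> j"
  shows "rank J j = Suc (rank J (j - 1))" "rank (simple_refl j ` J) = (rank J)(j := rank J (j - 1))"
proof -
  have "J \<inter> {..j} = insert j (J \<inter> {..j - 1})" using assms by (auto simp: le_eq_less_or_eq[of _ j])
  then show 1: "rank J j = Suc (rank J (j - 1))" unfolding rank_def using assms by (simp)
  have s: "simple_refl j ` J = insert (Suc j) (J - {j})"
    using assms by (auto simp: simple_refl_def transpose_def image_iff)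
  show "rank (simple_refl j ` J) = (rank J)(j := rank J (j - 1))"
  proof
    fix i
    consider "i < j" | "i = j" | "i > j" by linarith
    then show "rank (simple_refl j ` J) i = ((rank J)(j := rank J (j - 1))) i"
    proof cases
      case 1
      then have "simple_refl j ` J \<inter> {..i} = J \<inter> {..i}" unfolding s by auto
      then show ?thesis using 1 by (simp add: rank_def)
    next
      case 2
      then have "simple_refl j ` J \<inter> {..i} = J \<inter> {..j - 1}" unfolding s using assms by (auto simp: le_eq_less_or_eq[of _ j])
      then show ?thesis using 2 by (simp add: rank_def)
    next
      case 3
      then have "simple_refl j ` J \<inter> {..i} = insert (Suc j) (J \<inter> {..i} - {j})" unfolding s by auto
      moreover have "card (J \<inter> {..i}) = Suc (card (J \<inter> {..i} - {j}))" 
        using assms 3 by (intro card.remove) auto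
      ultimately show ?thesis using 3 assms by (simp add: rank_def)
    qed
  qed
qed

text \<open>The sum of the elements plays the role of a length: a simple reflection raises it only
  by moving an element up to a free place, and then by one.\<close>

lemma sum_simple_refl:
  assumes "finite J"
  shows "\<Sum>(simple_refl j ` J) \<le> Suc (\<Sum>J)"
    "\<Sum>(simple_refl j ` J) = Suc (\<Sum>J) \<Longrightarrow> j \<in> J \<and> Suc j \<notin> J"
proof -
  have inj: "inj_on (simple_refl j) J" by (metis inj_onI simple_refl_def transpose_involutory)
  have "\<Sum>(simple_refl j ` J) = (\<Sum>x\<in>J. simple_refl j x)" by (simp add: sum.reindex[OF inj])
  also have "\<dots> = (\<Sum>x\<in>J - {j, Suc j}. x) + (\<Sum>x\<in>J \<inter> {j, Suc j}. simple_refl j x)"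
    using assms by (subst sum.Int_Diff[of _ _ "{j, Suc j}"])
      (auto simp: simple_refl_def intro!: sum.cong)
  finally have s: "\<Sum>(simple_refl j ` J) = \<Sum>(J - {j, Suc j}) + (\<Sum>x\<in>J \<inter> {j, Suc j}. simple_refl j x)" .
  have t: "\<Sum>J = \<Sum>(J - {j, Suc j}) + \<Sum>(J \<inter> {j, Suc j})"
    using assms sum.Int_Diff[of J "\<lambda>x. x" "{j, Suc j}"] by simp
  have "J \<inter> {j, Suc j} = (if j \<in> J then {j} else {}) \<union> (if Suc j \<in> J then {Suc j} else {})" by auto
  then have "(\<Sum>x\<in>J \<inter> {j, Suc j}. simple_refl j x) \<le> Suc (\<Sum>(J \<inter> {j, Suc j})) \<and>
    ((\<Sum>x\<in>J \<inter> {j, Suc j}. simple_refl j x) = Suc (\<Sum>(J \<inter> {j, Suc j})) \<longrightarrow> j \<in> J \<and> Suc j \<notin> J)"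
    by (cases "j \<in> J"; cases "Suc j \<in> J") (simp_all add: simple_refl_def)
  then show "\<Sum>(simple_refl j ` J) \<le> Suc (\<Sum>J)"
    "\<Sum>(simple_refl j ` J) = Suc (\<Sum>J) \<Longrightarrow> j \<in> J \<and> Suc j \<notin> J"
    using s t by linarith+
qed

text \<open>Each letter of \<open>js\<close> raises the sum by at most one, so by \<open>len\<close>
  every letter raises it by exactly one, and every Demazure operator meets the case of
  \<open>j\<close> inside and \<open>j + 1\<close> outside the set. The upper bound for the sum is
  carried through the induction to force this equality at the next letter.\<close>

lemma foldr_demazure:
  assumes M: "RF_O n z = fans n H I" and J: "finite J" and js: "set js \<subseteq> {1..}"
    and len: "\<Sum>J + length js \<le> \<Sum>(foldr (\<lambda>j w. simple_refl j \<circ> w) js id ` J)"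
  shows "\<Sum>(foldr (\<lambda>j w. simple_refl j \<circ> w) js id ` J) \<le> \<Sum>J + length js \<and>
    foldr (demazure n z) js {a \<in> fans n H I. bounded (rank J) a} =
    {a \<in> fans n H I. bounded (rank (foldr (\<lambda>j w. simple_refl j \<circ> w) js id ` J)) a}"
  using js len
proof (induction js)
  case (Cons j js)
  let ?u = "foldr (\<lambda>j w. simple_refl j \<circ> w) js id"
  let ?K = "?u ` J"
  have K: "finite ?K" using J by simp
  have eq: "foldr (\<lambda>j w. simple_refl j \<circ> w) (j # js) id ` J = simple_refl j ` ?K"
    by (simp add: image_comp)
  have le: "\<Sum>(simple_refl j ` ?K) \<le> Suc (\<Sum>?K)" using sum_simple_refl(1)[OF K] .
  then have "\<Sum>J + length js \<le> \<Sum>?K" using Cons.prems(2) unfolding eq by simp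
  moreover have "set js \<subseteq> {1..}" using Cons.prems(1) by simp
  ultimately have IH: "\<Sum>?K \<le> \<Sum>J + length js"
    "foldr (demazure n z) js {a \<in> fans n H I. bounded (rank J) a} =
    {a \<in> fans n H I. bounded (rank ?K) a}" using Cons.IH by blast+
  have "\<Sum>(simple_refl j ` ?K) = Suc (\<Sum>?K)" using Cons.prems(2) le IH(1) unfolding eq by simp
  then have j: "j \<in> ?K" "Suc j \<notin> ?K" using sum_simple_refl(2)[OF K] by blast+
  have j1: "1 \<le> j" using Cons.prems(1) by simp
  note r = rank_simple_refl[OF K j j1]
  have "foldr (demazure n z) (j # js) {a \<in> fans n H I. bounded (rank J) a} =
    demazure n z j {a \<in> fans n H I. bounded (rank ?K) a}" using IH(2) by simp
  also have "\<dots> = {a \<in> fans n H I. bounded (rank (simple_refl j ` ?K)) a}"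
    unfolding r(2) by (rule demazure_bounded[OF M j1 r(1)])
  finally show ?case unfolding eq using le IH(1) by simp
qed simp

text \<open>In contrast to \<open>rank_less_iff\<close>, the number \<open>i\<close>, later the
  index of a factor, may lie outside \<open>I\<close>.\<close>

lemma rank_less_rank_iff:
  assumes "finite I" "m \<in> I"
  shows "rank I i < rank I m \<longleftrightarrow> i < m"
proof
  assume "i < m"
  then have "I \<inter> {..i} \<subseteq> I \<inter> {..m}" "m \<in> I \<inter> {..m}" "m \<notin> I \<inter> {..i}" using assms by auto
  then show "rank I i < rank I m" unfolding rank_def using assms(1) by (intro psubset_card_mono) blast+
next
  assume l: "rank I i < rank I m"
  show "i < m"
  proof (rule ccontr)
    assume "\<not> i < m"
    then have "rank I m \<le> rank I i" unfolding rank_def using assms(1) by (intro card_mono) auto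
    with l show False by simp
  qed
qed

lemma flag_bounded_fans:
  assumes a: "a \<in> fans n H I"
  shows "flag_bounded a \<longleftrightarrow> (\<forall>i<length a. \<forall>m\<in>set (a ! i). i < cl m)"
proof -
  have L: "is_letter m" if "i < length a" "m \<in> set (a ! i)" for i m
    using a fan_letter[of H "{}" "concat a" m] nth_mem[OF that(1)] that(2) by (auto simp: fans_def)
  have "flag_bounded a \<longleftrightarrow> (\<forall>i<length a. \<forall>m\<in>set (a ! i). int (Suc i) \<le> \<lceil>m\<rceil>)"
    unfolding flag_bounded_def image_Suc_lessThan[symmetric] by (simp del: image_Suc_lessThan) (simp add: Ball_def)
  also have "\<dots> \<longleftrightarrow> (\<forall>i<length a. \<forall>m\<in>set (a ! i). i < cl m)"
  proof -
    have "int (Suc i) \<le> \<lceil>m\<rceil> \<longleftrightarrow> i < cl m" if "i < length a" "m \<in> set (a ! i)" for i m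
      unfolding ceiling_letter[OF L[OF that]] by linarith
    then show ?thesis by blast
  qed
  finally show ?thesis .
qed

lemma std_flag_bounded:
  assumes I: "finite I" "0 \<notin> I"
  shows "std I ` {a \<in> fans n H I. flag_bounded a} =
    {b \<in> fans n (\<lambda>_. False) {1..card I}. bounded (rank I) b}"
proof -
  have "bounded (rank I) (std I a) \<longleftrightarrow> flag_bounded a" if a: "a \<in> fans n H I" for a
  proof -
    let ?c = "cl (hd (concat a))"
    have "cl m \<in> I" if "i < length a" "m \<in> set (a ! i)" for i m
      using fans_factor_subset[OF a nth_mem[OF that(1)]] that(2) by auto
    then have "rank I i < cl (std_letter I ?c m) \<longleftrightarrow> i < cl m" if "i < length a" "m \<in> set (a ! i)" for i m
      using that by (simp add: std_letter[OF I(1)] rank_less_rank_iff[OF I(1)])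
    then show ?thesis unfolding flag_bounded_fans[OF a] bounded_nth by (simp add: std_def)
  qed
  moreover have "b \<in> std I ` fans n H I" if "b \<in> fans n (\<lambda>_. False) {1..card I}" for b
    using std_surj[OF I that] .
  ultimately show ?thesis using std_closed[of _ n H I] by blast
qed

text \<open>For an index \<open>i\<close> above \<open>k\<close> the rank is \<open>k\<close> and
  not \<open>i\<close>, but then neither inequality can hold for a letter from {1..k}.\<close>

lemma flag_bounded_interval:
  assumes a: "a \<in> fans n H {1..k}"
  shows "flag_bounded a \<longleftrightarrow> bounded (rank {1..k}) a"
proof -
  have "cl m \<in> {1..k}" if "i < length a" "m \<in> set (a ! i)" for i m
    using fans_factor_subset[OF a nth_mem[OF that(1)]] that(2) by auto
  moreover have "rank {1..k} m = m" if "m \<in> {1..k}" for m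
  proof -
    have "{1..k} \<inter> {..m} = {1..m}" using that unfolding set_eq_iff Int_iff atLeastAtMost_iff atMost_iff by auto
    then show ?thesis unfolding rank_def by (simp only: card_atLeastAtMost)
  qed
  ultimately have "rank {1..k} i < cl m \<longleftrightarrow> i < cl m" if "i < length a" "m \<in> set (a ! i)" for i m
    using that rank_less_rank_iff[of "{1..k}" "cl m" i] by simp
  then show ?thesis unfolding flag_bounded_fans[OF a] bounded_nth by simp
qed


section \<open>Fans as involution words\<close>

text \<open>The involution reached by reading \<open>S\<close> upwards. The lemmas on inserting a
  maximum and a minimum show that every fan on \<open>S\<close> reaches the same one.\<close>

definition fan_inv :: "nat set \<Rightarrow> nat \<Rightarrow> nat" where
  "fan_inv S = fold (\<lambda>i z. invol_step z i) (sorted_list_of_set S) id"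

lemma fan_inv_empty [simp]: "fan_inv {} = id"
  by (simp add: fan_inv_def)

lemma fan_inv_insert_max:
  assumes "finite S" "\<forall>y\<in>S. y < m"
  shows "fan_inv (insert m S) = invol_step (fan_inv S) m"
proof -
  have "sorted_list_of_set (insert m S) = sorted_list_of_set S @ [m]"
    using assms by (subst sorted_list_of_set_insert)
      (auto intro!: sorted_insort_is_snoc simp: less_imp_le)
  then show ?thesis by (simp add: fan_inv_def)
qed

lemma simple_refl_simps [simp]:
  "simple_refl i i = Suc i" "simple_refl i (Suc i) = i"
  "x \<noteq> i \<Longrightarrow> x \<noteq> Suc i \<Longrightarrow> simple_refl i x = x"
  "simple_refl i (simple_refl i x) = x"
  by (auto simp: simple_refl_def)

lemma simple_refl_image_eq:
  assumes "i + 2 \<le> j \<or> j + 2 \<le> i"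
  shows "simple_refl i ` A = {j, j + 1} \<longleftrightarrow> A = {j, j + 1}"
proof -
  have "simple_refl i j = j" "simple_refl i (Suc j) = Suc j" using assms by auto
  then have "simple_refl i ` {j, j + 1} = {j, j + 1}" by simp
  moreover have "simple_refl i ` simple_refl i ` A = A" by (simp add: image_comp)
  ultimately show ?thesis by metis
qed

text \<open>Commuting two steps also requires that neither changes the branch of
  \<open>invol_step\<close> taken by the other.\<close>

lemma invol_step_preserves:
  assumes "i + 2 \<le> j \<or> j + 2 \<le> i"
  shows "invol_step z i ` {j, j + 1} = {j, j + 1} \<longleftrightarrow> z ` {j, j + 1} = {j, j + 1}"
proof -
  have "simple_refl i ` {j, j + 1} = {j, j + 1}" by (simp only: simple_refl_image_eq[OF assms])
  then have "invol_step z i ` {j, j + 1} = simple_refl i ` z ` {j, j + 1}"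
    unfolding invol_step_def by (cases "z ` {i, i + 1} = {i, i + 1}") (simp_all only: if_True if_False image_comp[symmetric] simp_thms)
  then show ?thesis by (simp only: simple_refl_image_eq[OF assms])
qed

lemma invol_step_commute:
  assumes "i + 2 \<le> j"
  shows "invol_step (invol_step z i) j = invol_step (invol_step z j) i"
proof -
  have c: "simple_refl i (simple_refl j x) = simple_refl j (simple_refl i x)" for x
    using assms by (auto simp: simple_refl_def transpose_def)
  show ?thesis
    unfolding invol_step_def[of "invol_step z i"] invol_step_def[of "invol_step z j"]
      invol_step_preserves[of i j, OF disjI1[OF assms]] invol_step_preserves[of j i, OF disjI2[OF assms]]
    unfolding invol_step_def by (auto simp: fun_eq_iff c)
qed

text \<open>Reading upwards puts \<open>m\<close> first; it is moved to the end by commuting it past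
  the elements of \<open>S\<close> one at a time. Only \<open>m + 1\<close> is too close for the
  general commutation, and it meets \<open>m\<close> only at the beginning of the word.\<close>

lemma fan_inv_insert_min:
  assumes "finite S" "\<forall>y\<in>S. m < y"
  shows "fan_inv (insert m S) = invol_step (fan_inv S) m"
  using assms
proof (induction S rule: finite_linorder_max_induct)
  case (insert b A)
  have "insert m (insert b A) = insert b (insert m A)" by auto
  then have "fan_inv (insert m (insert b A)) = invol_step (fan_inv (insert m A)) b"
    using insert by (simp add: fan_inv_insert_max)
  also have "\<dots> = invol_step (invol_step (fan_inv A) m) b" using insert by simp
  also have "\<dots> = invol_step (invol_step (fan_inv A) b) m"
  proof (cases "m + 2 \<le> b")
    case True
    then show ?thesis by (rule invol_step_commute)
  next
    case False
    then have b: "b = Suc m" using insert.prems by auto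
    \<comment> \<open>Elements of \<open>A\<close> would lie strictly between \<open>m\<close> and
      \<open>m + 1\<close>. Starting from \<open>id\<close>, both orders of the two letters give the
      same involution.\<close>
    then have "A = {}" using insert by fastforce
    then show ?thesis unfolding b fan_inv_empty invol_step_def
      by (auto simp: fun_eq_iff simple_refl_def transpose_def doubleton_eq_iff)
  qed
  also have "\<dots> = invol_step (fan_inv (insert b A)) m" using insert by (simp add: fan_inv_insert_max)
  finally show ?case .
qed (simp add: fan_inv_insert_max)

lemma fan_inv_fixed:
  assumes "finite S" "x \<notin> S" "x \<notin> Suc ` S"
  shows "fan_inv S x = x"
  using assms
proof (induction S rule: finite_linorder_max_induct)
  case (insert b A)
  then show ?case by (auto simp: fan_inv_insert_max invol_step_def)
qed simp

lemma fan_inv_le: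
  assumes "finite S" "\<forall>y\<in>S. y < m" "x \<le> m"
  shows "fan_inv S x \<le> m"
  using assms
proof (induction S arbitrary: x rule: finite_linorder_max_induct)
  case (insert b A)
  have s: "simple_refl b u \<le> m" if "u \<le> m" for u
    using that insert.prems by (auto simp: simple_refl_def transpose_def)
  show ?case using insert s by (auto simp: fan_inv_insert_max invol_step_def)
qed simp

lemma fan_inv_ge:
  assumes "finite S" "\<forall>y\<in>S. m \<le> y" "m \<le> x"
  shows "m \<le> fan_inv S x"
  using assms
proof (induction S arbitrary: x rule: finite_linorder_max_induct)
  case (insert b A)
  have s: "m \<le> simple_refl b u" if "m \<le> u" for u
    using that insert.prems by (auto simp: simple_refl_def transpose_def)
  show ?case using insert s by (auto simp: fan_inv_insert_max invol_step_def)
qed simp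

text \<open>If \<open>p\<close> is in \<open>S\<close>, it is the last letter read upwards, and its
  step sends \<open>Suc p\<close> to a value of at most \<open>p\<close>, whichever branch is
  taken.\<close>

lemma fan_inv_max_iff:
  assumes "finite S" "\<forall>y\<in>S. y < Suc p"
  shows "fan_inv S (Suc p) = Suc p \<longleftrightarrow> p \<notin> S"
proof
  assume "p \<notin> S"
  then show "fan_inv S (Suc p) = Suc p" using assms by (intro fan_inv_fixed) auto
next
  assume fx: "fan_inv S (Suc p) = Suc p"
  show "p \<notin> S"
  proof
    assume p: "p \<in> S"
    define A where "A = S - {p}"
    have A: "S = insert p A" "finite A" "\<forall>y\<in>A. y < p" using assms p by (auto simp: A_def less_Suc_eq)
    let ?y = "fan_inv A"
    have y: "?y (Suc p) = Suc p" "?y p \<le> p"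
      using A by (auto intro!: fan_inv_fixed fan_inv_le)
    have "fan_inv S = invol_step ?y p" using A by (simp add: fan_inv_insert_max)
    then show False using fx y
      by (cases "?y p = p") (auto simp: invol_step_def split: if_splits)
  qed
qed

text \<open>The mirror image: if \<open>Suc m\<close> is in \<open>S\<close>, it is the minimum and
  may be read last, and its step sends \<open>Suc m\<close> to a larger value.\<close>

lemma fan_inv_min_iff:
  assumes "finite S" "\<forall>y\<in>S. m < y"
  shows "fan_inv S (Suc m) = Suc m \<longleftrightarrow> Suc m \<notin> S"
proof
  assume "Suc m \<notin> S"
  then show "fan_inv S (Suc m) = Suc m" using assms by (intro fan_inv_fixed) auto
next
  assume fx: "fan_inv S (Suc m) = Suc m"
  let ?p = "Suc m"
  show "Suc m \<notin> S"
  proof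
    assume p: "?p \<in> S"
    define A where "A = S - {?p}"
    have A: "S = insert ?p A" "finite A" "\<forall>y\<in>A. ?p < y" using assms p by (auto simp: A_def Suc_lessI)
    let ?y = "fan_inv A"
    have y: "?y ?p = ?p" using A by (intro fan_inv_fixed) auto
    have y': "Suc ?p \<le> ?y (Suc ?p)" using A by (intro fan_inv_ge) (auto simp: Suc_le_eq)
    have "fan_inv S = invol_step ?y ?p" using A by (simp add: fan_inv_insert_min)
    then show False using fx y y'
      by (cases "?y (Suc ?p) = Suc ?p") (auto simp: invol_step_def split: if_splits)
  qed
qed

text \<open>The prime of a letter of a fan is admissible iff the two neighbouring values do not occur
  earlier in the word.\<close>

fun gap_ok :: "nat set \<Rightarrow> real list \<Rightarrow> bool" where
  "gap_ok S [] \<longleftrightarrow> True"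
| "gap_ok S (x # w) \<longleftrightarrow>
     (is_primed x \<longrightarrow> cl x - 1 \<notin> S \<and> Suc (cl x) \<notin> S) \<and> gap_ok (insert (cl x) S) w"

lemma gap_ok_append: "gap_ok S (u @ v) \<longleftrightarrow> gap_ok S u \<and> gap_ok (S \<union> cl ` set u) v"
proof (induction u arbitrary: S)
  case (Cons x u)
  show ?case by (simp add: Cons.IH)
qed simp

text \<open>A new maximum \<open>m\<close> finds \<open>m + 1\<close> fixed and \<open>m\<close>
  sent to at most \<open>m\<close>; a new minimum \<open>m\<close> finds \<open>m\<close> fixed and
  \<open>m + 1\<close> sent to at least \<open>m + 1\<close>. Hence the ascent required of an
  involution word is automatic, and only the condition on primes remains.\<close>

lemma invol_path_fan:
  assumes "finite S" "fan H S w"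
  shows "invol_path (fan_inv S) w z \<longleftrightarrow> gap_ok S w \<and> z = fan_inv (S \<union> cl ` set w)"
  using assms
proof (induction w arbitrary: S)
  case (Cons x w)
  let ?z = "fan_inv S" and ?m = "cl x"
  have x: "is_letter x" and f: "fan H (insert ?m S) w" using Cons.prems(2) by auto
  obtain p where p: "?m = Suc p" using cl_letter_pos[OF x] by (cases ?m) auto
  have "?z ?m < ?z (Suc ?m) \<and> (?z ?m = ?m \<and> ?z (Suc ?m) = Suc ?m \<longleftrightarrow> ?m - 1 \<notin> S \<and> Suc ?m \<notin> S) \<and>
    fan_inv (insert ?m S) = invol_step ?z ?m"
  proof (cases "\<forall>y\<in>S. y < ?m")
    case True
    have "?z (Suc ?m) = Suc ?m" using True Cons.prems(1) by (intro fan_inv_fixed) auto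
    moreover have "?z ?m \<le> ?m" using True Cons.prems(1) by (intro fan_inv_le) auto
    moreover have "?z ?m = ?m \<longleftrightarrow> ?m - 1 \<notin> S"
      using fan_inv_max_iff[of S p] True Cons.prems(1) by (simp add: p)
    moreover have "Suc ?m \<notin> S" using True by auto
    ultimately show ?thesis using fan_inv_insert_max[OF Cons.prems(1) True] by auto
  next
    case False
    then have lt: "\<forall>y\<in>S. ?m < y" using Cons.prems(2) by auto
    have "?z ?m = ?m" using lt Cons.prems(1) by (intro fan_inv_fixed) auto
    moreover have "Suc ?m \<le> ?z (Suc ?m)" using lt Cons.prems(1) by (intro fan_inv_ge) (auto simp: Suc_le_eq)
    moreover have "?z (Suc ?m) = Suc ?m \<longleftrightarrow> Suc ?m \<notin> S"
      using fan_inv_min_iff[OF Cons.prems(1) lt] .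
    moreover have "?m - 1 \<notin> S" using lt by (auto simp: p)
    ultimately show ?thesis using fan_inv_insert_min[OF Cons.prems(1) lt] by auto
  qed
  then show ?case using Cons.IH[OF _ f] Cons.prems(1) x
    by (auto simp: Let_def cl_def[symmetric])
qed auto

lemma R_O_fan:
  assumes "fan H {} w"
  shows "w \<in> R_O z \<longleftrightarrow> gap_ok {} w \<and> z = fan_inv (cl ` set w)"
  using invol_path_fan[of "{}" H w z] assms by (simp add: R_O_def)

text \<open>The last letter of an involution word is thus a descent of the involution reached. This
  excludes adjacent letters with equal ceilings and allows words to be analysed from their
  ends.\<close>

lemma invol_step_descent:
  assumes "inj y" "y i < y (Suc i)"
  shows "invol_step y i (Suc i) < invol_step y i i" "inj (invol_step y i)"
proof -
  show "invol_step y i (Suc i) < invol_step y i i"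
  proof (cases "y ` {i, i + 1} = {i, i + 1}")
    case True
    then have "y i = i" "y (Suc i) = Suc i" using assms(2) by (auto simp: doubleton_eq_iff)
    then show ?thesis using True by (simp add: invol_step_def)
  next
    case False
    then have "\<not> (y i = i \<and> y (Suc i) = Suc i)" by auto
    then show ?thesis using False assms(2)
      by (auto simp: invol_step_def simple_refl_def transpose_def)
  qed
  have "inj (simple_refl i)" by (metis injI simple_refl_simps(4))
  then show "inj (invol_step y i)" using assms(1) by (auto simp: invol_step_def intro!: inj_compose)
qed

lemma invol_path_append: "invol_path y (u @ v) z \<longleftrightarrow> (\<exists>x. invol_path y u x \<and> invol_path x v z)"
  by (induction u arbitrary: y) (auto simp: Let_def)

lemma invol_path_inj: "invol_path y w z \<Longrightarrow> inj y \<Longrightarrow> inj z"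
  by (induction w arbitrary: y) (auto simp: Let_def invol_step_descent(2))

lemma invol_path_letter: "invol_path y w z \<Longrightarrow> x \<in> set w \<Longrightarrow> is_letter x"
  by (induction w arbitrary: y) (auto simp: Let_def)

lemma invol_path_successively:
  "invol_path y w z \<Longrightarrow> inj y \<Longrightarrow> successively (\<lambda>a b. cl a \<noteq> cl b) w"
proof (induction w arbitrary: y)
  case (Cons a w)
  have ih: "successively (\<lambda>a b. cl a \<noteq> cl b) w"
    using Cons by (auto simp: Let_def intro: invol_step_descent(2))
  show ?case
  proof (cases w)
    case w: (Cons b v)
    have "cl a \<noteq> cl b"
    proof
      assume "cl a = cl b"
      then show False using Cons.prems(1) invol_step_descent(1)[OF Cons.prems(2), of "cl a"]
        by (auto simp: w Let_def cl_def[symmetric])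
    qed
    then show ?thesis using ih w by simp
  qed simp
qed simp

lemma fan_inv_interval:
  assumes "a \<le> b"
  shows "fan_inv {a..b} = transpose a (Suc b)"
  using assms
proof (induction b rule: dec_induct)
  case base
  show ?case using fan_inv_insert_max[of "{}" a] by (simp add: invol_step_def simple_refl_def)
next
  case (step b)
  have "{a..Suc b} = insert (Suc b) {a..b}" using step.hyps by auto
  then have "fan_inv {a..Suc b} = invol_step (transpose a (Suc b)) (Suc b)"
    using step by (simp add: fan_inv_insert_max)
  also have "transpose a (Suc b) ` {Suc b, Suc b + 1} \<noteq> {Suc b, Suc b + 1}"
    using step.hyps by (auto simp: doubleton_eq_iff)
  then have "invol_step (transpose a (Suc b)) (Suc b) = transpose a (Suc (Suc b))"
    using step.hyps by (auto simp: invol_step_def simple_refl_def transpose_def fun_eq_iff)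
  finally show ?case .
qed

text \<open>The last letter is a descent of the transposition of \<open>a\<close> and
  \<open>b + 1\<close>, so it is \<open>a\<close> or \<open>b\<close>. Undoing it drops that end of
  the interval, and while the interval has more than one element a prime is excluded, since the
  previous involution moves one of the two points involved.\<close>

lemma fan_interval_if_path:
  assumes "invol_path id w (transpose a (Suc b))" "a \<le> b"
  shows "fan (\<lambda>_. False) {} w \<and> cl ` set w = {a..b}"
  using assms
proof (induction w arbitrary: a b rule: rev_induct)
  case Nil
  then have "transpose a (Suc b) a = a" by (metis invol_path.simps(1) id_apply)
  then show ?case using Nil.prems(2) by simp
next
  case (snoc x w)
  let ?z = "transpose a (Suc b)" and ?i = "cl x"
  obtain y where y: "invol_path id w y" and "invol_path y [x] ?z"
    using snoc.prems(1) unfolding invol_path_append by blast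
  then have x: "is_letter x" and asc: "y ?i < y (Suc ?i)"
    and pr: "is_primed x \<Longrightarrow> y ?i = ?i \<and> y (Suc ?i) = Suc ?i" and z: "invol_step y ?i = ?z"
    by (auto simp: Let_def cl_def[symmetric])
  have inj: "inj y" using invol_path_inj[OF y] by (simp add: inj_on_id)
  have "?z (Suc ?i) < ?z ?i" using invol_step_descent(1)[OF inj asc] z by simp
  then have i: "?i = a \<or> ?i = b" using snoc.prems(2) by (auto simp: transpose_def split: if_splits)
  show ?case
  proof (cases "y ` {?i, ?i + 1} = {?i, ?i + 1}")
    case True
    then have "y ?i = ?i" "y (Suc ?i) = Suc ?i" using asc by (auto simp: doubleton_eq_iff)
    moreover have zi: "simple_refl ?i \<circ> y = ?z" using z True by (simp add: invol_step_def)
    ultimately have "?z ?i = Suc ?i" by (metis comp_apply simple_refl_simps(1))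
    then have ab: "a = ?i" "b = ?i" using i snoc.prems(2) by (auto simp: transpose_def split: if_splits)
    have "y = simple_refl ?i \<circ> (simple_refl ?i \<circ> y)" by (simp add: fun_eq_iff)
    also have "\<dots> = id" unfolding zi using ab by (simp add: simple_refl_def)
    finally have "invol_path id w id" using y by simp
    \<comment> \<open>No nonempty word reaches \<open>id\<close>, which has no descent.\<close>
    have "w = []"
    proof (cases w rule: rev_cases)
      case (snoc v c)
      then obtain u where u: "invol_path id v u" "invol_path u [c] id"
        using \<open>invol_path id w id\<close> unfolding \<open>w = v @ [c]\<close> invol_path_append by blast
      then have c: "u (cl c) < u (Suc (cl c))" "invol_step u (cl c) = id"
        by (auto simp: Let_def cl_def[symmetric])
      have "inj u" using invol_path_inj[OF u(1)] by (simp add: inj_on_id)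
      then show ?thesis using invol_step_descent(1)[of u "cl c"] c by simp
    qed
    then show ?thesis using x ab by simp
  next
    case False
    then have zs: "simple_refl ?i \<circ> y \<circ> simple_refl ?i = ?z" using z by (auto simp: invol_step_def)
    have "y = simple_refl ?i \<circ> (simple_refl ?i \<circ> y \<circ> simple_refl ?i) \<circ> simple_refl ?i" 
      by (simp add: fun_eq_iff)
    then have ys: "y = simple_refl ?i \<circ> ?z \<circ> simple_refl ?i" unfolding zs .
    have "a \<noteq> b"
    proof
      assume "a = b"
      then have "y = simple_refl ?i" using i ys by (auto simp: simple_refl_def fun_eq_iff)
      then show False using False by auto
    qed
    then have ab: "a < b" using snoc.prems(2) by simp
    from i show ?thesis
    proof
      assume ia: "?i = a"
      have yy: "y = transpose (Suc a) (Suc b)"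
        unfolding ys ia using ab by (auto simp: fun_eq_iff simple_refl_def transpose_def)
      have "fan (\<lambda>_. False) {} w \<and> cl ` set w = {Suc a..b}"
        by (rule snoc.IH[OF y[unfolded yy]]) (use ab in simp)
      moreover have "\<not> is_primed x" using pr ia ab yy by auto
      ultimately have "fan (\<lambda>_. False) {} w" "cl ` set w = {Suc a..b}" "\<not> is_primed x"
        by blast+
      then show ?thesis using x ia ab by (auto simp: fan_append)
    next
      assume ib: "?i = b"
      then obtain b' where b': "b = Suc b'" using ab by (cases b) auto
      have yy: "y = transpose a (Suc b')"
        unfolding ys ib using ab b' by (auto simp: fun_eq_iff simple_refl_def transpose_def)
      have "fan (\<lambda>_. False) {} w \<and> cl ` set w = {a..b'}"
        by (rule snoc.IH[OF y[unfolded yy]]) (use ab b' in simp)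
      moreover have "\<not> is_primed x" using pr ib ab yy b' by auto
      ultimately have "fan (\<lambda>_. False) {} w" "cl ` set w = {a..b'}" "\<not> is_primed x"
        by blast+
      then show ?thesis using x ib b' ab by (auto simp: fan_append)
    qed
  qed
qed

text \<open>Only a letter with nothing before it can be primed, so no neighbouring value occurs
  earlier.\<close>

lemma gap_ok_unprimed: "fan (\<lambda>_. False) S w \<Longrightarrow> gap_ok S w"
  by (induction w arbitrary: S) auto

lemma RF_O_hook:
  assumes "1 \<le> k"
  shows "RF_O n (transpose 1 (Suc k)) = fans n (\<lambda>_. False) {1..k}"
proof -
  have "w \<in> R_O (transpose 1 (Suc k)) \<longleftrightarrow> fan (\<lambda>_. False) {} w \<and> cl ` set w = {1..k}" for w
    using fan_interval_if_path[of w 1 k] R_O_fan[of "\<lambda>_. False" w "transpose 1 (Suc k)"] gap_ok_unprimed[of "{}" w] 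
      fan_inv_interval[OF assms] assms by (auto simp: R_O_def)
  then show ?thesis unfolding RF_O_def fans_def by blast
qed


section \<open>Orthogonal Coxeter--Knuth classes of fans\<close>

text \<open>The invariant of an equivalence class. By \<open>R_O_fan\<close>, the part
  \<open>gap_ok\<close> records that the primes are admissible, so that an equivalent fan is again
  an involution word.\<close>

definition gapped_fan :: "(nat \<Rightarrow> bool) \<Rightarrow> nat set \<Rightarrow> real list \<Rightarrow> bool" where
  "gapped_fan H I w \<longleftrightarrow> fan H {} w \<and> cl ` set w = I \<and> gap_ok {} w"

lemma of_int_letter: "is_letter (of_int a) \<longleftrightarrow> 1 \<le> a" "cl (of_int a) = nat a" "\<not> is_primed (of_int a)"
  by (auto simp: is_letter_def cl_def is_primed_def)

lemma prm_letter: "is_letter (prm a) \<longleftrightarrow> 1 \<le> a" "cl (prm a) = nat a" "is_primed (prm a)"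
proof -
  have c: "\<lceil>prm a\<rceil> = a" unfolding prm_def by (intro ceiling_unique) auto
  then show "cl (prm a) = nat a" by (simp add: cl_def)
  have "prm a \<notin> \<int>"
  proof
    assume "prm a \<in> \<int>"
    then obtain b where "prm a = of_int b" by (auto elim: Ints_cases)
    then have "a = b" using c by simp
    with \<open>prm a = of_int b\<close> show False by (simp add: prm_def)
  qed
  then show "is_primed (prm a)" by (simp add: is_primed_def)
  show "is_letter (prm a) \<longleftrightarrow> 1 \<le> a"
    unfolding is_letter_def prm_def by (auto simp: field_simps)
qed

lemma letter_cases:
  assumes "is_letter x"
  obtains "x = of_int \<lceil>x\<rceil>" "\<not> is_primed x" | "x = prm \<lceil>x\<rceil>" "is_primed x"
  using letter_gap[OF assms] by (cases "is_primed x") (auto simp: prm_def)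

lemma gapped_fan_init_swap:
  assumes "gapped_fan H I (y # x # v)" "is_letter x1" "is_letter y1" "cl x1 = cl x" "cl y1 = cl y"
    "is_primed x1 = is_primed y" "is_primed y1 = is_primed x"
  shows "gapped_fan H I (x1 # y1 # v)"
proof -
  have "fan H {} (x1 # y1 # v)"
    using assms by (intro fan_init_swap[of x1 y1 x y]) (auto simp: gapped_fan_def)
  moreover have "gap_ok {} (x1 # y1 # v)"
  proof -
    have "1 \<le> cl x" "1 \<le> cl y" using assms cl_letter_pos by metis+
    then show ?thesis using assms by (auto simp: gapped_fan_def insert_commute)
  qed
  ultimately show ?thesis using assms by (auto simp: gapped_fan_def)
qed

text \<open>The value \<open>b\<close> between them keeps \<open>A\<close> and \<open>C\<close> from
  being neighbours.\<close>

lemma gap_ok_swap: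
  assumes "cl A < b" "b < cl C"
  shows "gap_ok S (A # C # v) \<longleftrightarrow> gap_ok S (C # A # v)"
  using assms by (auto simp: insert_commute)

lemma gapped_fan_not_repeated:
  assumes "cl x = cl z"
  shows "\<not> gapped_fan H I (u @ [x, y, z] @ v)"
proof
  assume "gapped_fan H I (u @ [x, y, z] @ v)"
  then have "distinct (map cl (u @ [x, y, z] @ v))" unfolding gapped_fan_def using fan_distinct by blast
  then show False using assms by simp
qed

lemma gapped_fan_letter: "gapped_fan H I w \<Longrightarrow> x \<in> set w \<Longrightarrow> is_letter x"
  unfolding gapped_fan_def using fan_letter by blast

text \<open>A letter between the two before it is neither a new maximum nor a new minimum; this
  excludes both sides of the first Knuth relation.\<close>

lemma gapped_fan_no_middle:
  assumes "u' = u @ [x, y, z] @ v" "cl x < cl z \<and> cl z < cl y \<or> cl y < cl z \<and> cl z < cl x"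
  shows "\<not> gapped_fan H I u'"
proof
  assume "gapped_fan H I u'"
  then have "fan H (cl ` set (u @ [x, y])) (z # v)"
    unfolding gapped_fan_def assms(1) using fan_append[of H "{}" "u @ [x, y]" "z # v"] by simp
  then show False using assms(2) by auto
qed

text \<open>Braid relations repeat a letter and the first Knuth relation ends in its middle letter,
  so neither side of these is a fan. The second Knuth relation is \<open>fan_swap\<close> with
  \<open>B\<close> as the element in between, and the relations exchanging the first two letters are
  \<open>gapped_fan_init_swap\<close>.\<close>

lemma gapped_fan_ock_step:
  assumes "ock_step w w'"
  shows "gapped_fan H I w \<longleftrightarrow> gapped_fan H I w'"
  using assms
proof cases
  case (knuth1 A B C u v)
  have "\<not> gapped_fan H I w \<and> \<not> gapped_fan H I w'"
  \<comment> \<open>The relation is stated for arbitrary reals; a word containing anything but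
    letters is no fan.\<close>
  proof (cases "is_letter A \<and> is_letter B \<and> is_letter C")
    case True
    then have "cl A < cl B \<and> cl B < cl C" using knuth1 ceiling_letter by (metis of_nat_less_iff)
    then show ?thesis using knuth1 gapped_fan_no_middle by blast
  next
    case False
    then show ?thesis using knuth1 gapped_fan_letter[of H I w] gapped_fan_letter[of H I w'] by auto
  qed
  then show ?thesis by simp
next
  case (knuth2 A B C u v)
  show ?thesis
  proof (cases "is_letter A \<and> is_letter B \<and> is_letter C")
    case True
    then have l: "cl A < cl B" "cl B < cl C" using knuth2 ceiling_letter by (metis of_nat_less_iff)+
    let ?S = "cl ` set (u @ [B])"
    have w: "w = (u @ [B]) @ C # A # v" "w' = (u @ [B]) @ A # C # v" using knuth2 by simp_all
    have "fan H {} w \<longleftrightarrow> fan H {} w'"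
      unfolding w fan_append[of H "{}" "u @ [B]"] using l by (subst fan_swap[of _ "cl B"]) auto
    moreover have "gap_ok {} w \<longleftrightarrow> gap_ok {} w'"
      unfolding w gap_ok_append[of "{}" "u @ [B]"] using gap_ok_swap[OF l] by blast
    moreover have "set w = set w'" using w by auto
    ultimately show ?thesis by (simp add: gapped_fan_def)
  next
    case False
    then have "\<not> gapped_fan H I w \<and> \<not> gapped_fan H I w'" 
      using knuth2 gapped_fan_letter[of H I w] gapped_fan_letter[of H I w'] by auto
    then show ?thesis by simp
  qed
next
  case (init1 a v)
  have "is_letter (of_int a :: real) \<longleftrightarrow> is_letter (prm a)" by (simp add: of_int_letter prm_letter)
  then show ?thesis by (simp add: init1 gapped_fan_def of_int_letter(2) prm_letter(2))
next
  case (init2 a b v)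
  have "gapped_fan H I (of_int b # of_int a # v)" if g: "gapped_fan H I (of_int a # of_int b # v)" for a b
  proof -
    have "1 \<le> a" "1 \<le> b"
      using gapped_fan_letter[OF g, of "of_int a"] gapped_fan_letter[OF g, of "of_int b"]
      by (simp_all add: of_int_letter prm_letter)
    then show ?thesis
      by (intro gapped_fan_init_swap[OF g]) (simp_all add: of_int_letter prm_letter)
  qed
  then show ?thesis using init2 by auto
next
  case (init3 a b v)
  have "gapped_fan H I (of_int b # prm a # v)" if g: "gapped_fan H I (of_int a # prm b # v)" for a b
  proof -
    have "1 \<le> a" "1 \<le> b"
      using gapped_fan_letter[OF g, of "of_int a"] gapped_fan_letter[OF g, of "prm b"]
      by (simp_all add: of_int_letter prm_letter)
    then show ?thesis
      by (intro gapped_fan_init_swap[OF g]) (simp_all add: of_int_letter prm_letter)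
  qed
  then show ?thesis using init3 by auto
next
  case (init4 a b v)
  have "gapped_fan H I (prm b # of_int a # v)" if g: "gapped_fan H I (prm a # of_int b # v)" for a b
  proof -
    have "1 \<le> a" "1 \<le> b"
      using gapped_fan_letter[OF g, of "prm a"] gapped_fan_letter[OF g, of "of_int b"]
      by (simp_all add: of_int_letter prm_letter)
    then show ?thesis
      by (intro gapped_fan_init_swap[OF g]) (simp_all add: of_int_letter prm_letter)
  qed
  then show ?thesis using init4 by auto
next
  case (init5 a b v)
  have "gapped_fan H I (prm b # prm a # v)" if g: "gapped_fan H I (prm a # prm b # v)" for a b
  proof -
    have "1 \<le> a" "1 \<le> b"
      using gapped_fan_letter[OF g, of "prm a"] gapped_fan_letter[OF g, of "prm b"]
      by (simp_all add: of_int_letter prm_letter)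
    then show ?thesis
      by (intro gapped_fan_init_swap[OF g]) (simp_all add: of_int_letter prm_letter)
  qed
  then show ?thesis using init5 by auto
qed (simp_all add: gapped_fan_not_repeated[simplified] of_int_letter prm_letter)

lemma gapped_fan_ock_equiv:
  assumes "ock_equiv w w'" "gapped_fan H I w"
  shows "gapped_fan H I w'"
  using assms(1)
  by (induction rule: equivclp_induct) (use assms(2) gapped_fan_ock_step in blast)+

section \<open>Connectivity of the fans on a given set\<close>

lemma ock_step_append: "ock_step w w' \<Longrightarrow> ock_step (w @ v) (w' @ v)"
proof (induction rule: ock_step.induct)
  case (knuth1 A B C u t)
  then show ?case using ock_step.knuth1[of A B C u "t @ v"] by simp
next
  case (knuth2 A B C u t)
  then show ?case using ock_step.knuth2[of A B C u "t @ v"] by simp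
next
  case (braid1 a b u t)
  then show ?case using ock_step.braid1[of a b u "t @ v"] by simp
next
  case (braid2 a b u t)
  then show ?case using ock_step.braid2[of a b u "t @ v"] by simp
next
  case (braid3 a b u t)
  then show ?case using ock_step.braid3[of a b u "t @ v"] by simp
next
  case (braid4 a b u t)
  then show ?case using ock_step.braid4[of a b u "t @ v"] by simp
next
  case (braid5 a b u t)
  then show ?case using ock_step.braid5[of a b u "t @ v"] by simp
next
  case (braid6 a b u t)
  then show ?case using ock_step.braid6[of a b u "t @ v"] by simp
next
  case (init1 a t)
  then show ?case using ock_step.init1[of a "t @ v"] by simp
next
  case (init2 a b t)
  then show ?case using ock_step.init2[of a b "t @ v"] by simp
next
  case (init3 a b t)
  then show ?case using ock_step.init3[of a b "t @ v"] by simp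
next
  case (init4 a b t)
  then show ?case using ock_step.init4[of a b "t @ v"] by simp
next
  case (init5 a b t)
  then show ?case using ock_step.init5[of a b "t @ v"] by simp
qed

text \<open>Letters can be added on the right only, because some relations concern the beginning of
  the word. Hence connectivity is proved by removing last letters.\<close>

lemma ock_equiv_append: "ock_equiv w w' \<Longrightarrow> ock_equiv (w @ v) (w' @ v)"
proof (induction rule: equivclp_induct)
  case (step y z)
  then show ?case using ock_step_append by (meson equivclp_into_equivclp)
qed simp

lemma ock_equiv_first:
  assumes "is_letter x" "is_letter y" "cl x = cl y"
  shows "ock_equiv (x # v) (y # v)"
proof -
  have "\<lceil>x\<rceil> = \<lceil>y\<rceil>" using assms ceiling_letter by metis
  moreover have "ock_equiv (of_int a # v) (prm a # v)" for a
    using ock_step.init1 by (rule r_into_equivclp)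
  ultimately show ?thesis using letter_cases[OF assms(1)] letter_cases[OF assms(2)]
    by (metis equivclp_refl equivclp_sym)
qed

lemma ock_equiv_init_swap:
  assumes "is_letter x" "is_letter y" "is_letter x1" "is_letter y1" "cl x1 = cl x" "cl y1 = cl y"
    "is_primed x1 = is_primed y"
  shows "ock_equiv (x # y # v) (y1 # x1 # v)"
proof -
  define a b where "a = \<lceil>x\<rceil>" "b = \<lceil>y\<rceil>"
  \<comment> \<open>The relation yields \<open>y\<close> with the prime of \<open>x\<close>; since
    it comes first, its prime can be changed afterwards.\<close>
  obtain y2 where y2: "is_letter y2" "cl y2 = cl y" "is_primed y2 = is_primed x"
    using obtain_letter[OF cl_letter_pos[OF assms(2)]] by metis
  have c: "\<lceil>x1\<rceil> = a" "\<lceil>y2\<rceil> = b" using assms y2 ceiling_letter a_b_def by metis+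
  have "ock_step (x # y # v) (y2 # x1 # v)"
    using letter_cases[OF assms(1)] letter_cases[OF assms(2)] letter_cases[OF assms(3)] letter_cases[OF y2(1)]
      ock_step.init2[of a b v] ock_step.init3[of a b v] ock_step.init4[of a b v] ock_step.init5[of a b v]
    unfolding a_b_def[symmetric] c by (metis append_Cons append_Nil assms(7) y2(3))
  then have "ock_equiv (x # y # v) (y2 # x1 # v)" by (rule r_into_equivclp)
  also have "ock_equiv (y2 # x1 # v) (y1 # x1 # v)" using assms y2 by (intro ock_equiv_first) auto
  finally show ?thesis .
qed

text \<open>The increasing word serves, since each of its letters names the gap that it
  closes.\<close>

lemma fan_exists:
  assumes "finite K" "0 \<notin> K"
  obtains q where "fan H {} q" "cl ` set q = K"
proof -
  have "\<exists>q. fan H {} q \<and> cl ` set q = K"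
    using assms
  proof (induction K rule: finite_linorder_max_induct)
    case empty
    show ?case by (intro exI[of _ "[]"]) simp
  next
    case (insert b A)
    then obtain q where q: "fan H {} q" "cl ` set q = A" by auto
    have "1 \<le> b" using insert.prems by (cases b) auto
    then obtain x where "is_letter x" "cl x = b" "is_primed x = H b" by (rule obtain_letter)
    then show ?case using q insert.hyps by (intro exI[of _ "q @ [x]"]) (auto simp: fan_append)
  qed
  then show thesis using that by blast
qed

text \<open>Fans on the same set are connected by induction on the last letter, which is the maximum or
  the minimum of the set. If it differs, both words are related to words ending in these two
  extreme letters, which can be exchanged.\<close>

lemma fans_connected:
  assumes "fan H {} w" "fan H {} w'" "cl ` set w = cl ` set w'"
  shows "ock_equiv w w'"
  using assms
proof (induction "length w" arbitrary: w w' rule: less_induct)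
  case less
  have len: "length w' = length w"
    using less.prems fan_distinct by (metis distinct_card length_map set_map)
  show ?case
  proof (cases w rule: rev_cases)
    case Nil
    then show ?thesis using len by simp
  next
    case w: (snoc p x)
    then obtain p' x' where w': "w' = p' @ [x']" using len by (cases w' rule: rev_cases) auto
    let ?S = "cl ` set p" and ?S' = "cl ` set p'"
    have f: "fan H {} p" "fan H ?S [x]" "fan H {} p'" "fan H ?S' [x']"
      using less.prems by (simp_all add: w w' fan_append)
    have d: "cl x \<notin> ?S" "cl x' \<notin> ?S'" using f(2,4) fan_disjoint by (metis list.set_intros(1))+
    have S: "insert (cl x) ?S = insert (cl x') ?S'" using less.prems(3) by (simp add: w w')
    have letters: "is_letter x" "is_letter x'" using f by auto
    have lp: "length p < length w" "length p' < length w" using w w' len by auto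
    show ?thesis
    proof (cases "p = []")
      case True
      then have "p' = []" using w w' len by simp
      then show ?thesis using S letters True by (simp add: w w' ock_equiv_first)
    next
      case p: False
      then have p': "p' \<noteq> []" using w w' len by auto
      show ?thesis
      proof (cases "cl x = cl x'")
        case True
        then have SS: "?S = ?S'" using S d by (metis insert_ident)
        \<comment> \<open>The last letter closes the same gap in both words, so it carries the same
          prime.\<close>
        then have "[x] = [x']" using f p True by (intro fan_unique[of H ?S]) auto
        then show ?thesis using less.hyps[OF lp(1) f(1,3) SS] by (simp add: w w' ock_equiv_append)
      next
        case False
        \<comment> \<open>The word ending in the maximum is put on the left; the opposite case
          follows by symmetry of the equivalence.\<close>
        have main: "ock_equiv (r @ [y]) (r' @ [y'])" 
          if r: "fan H {} (r @ [y])" "fan H {} (r' @ [y'])" "cl ` set (r @ [y]) = cl ` set (r' @ [y'])"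
            "length r < length w" "length r' < length w" "r \<noteq> []" "r' \<noteq> []" "length r' = length r"
            "cl y' < cl y" for r r' y y'
        proof -
          \<comment> \<open>The set without its two extreme elements \<open>cl y\<close> and
            \<open>cl y'\<close>.\<close>
          define M where "M = cl ` set r - {cl y'}"
          have fr: "fan H {} r" "fan H (cl ` set r) [y]" "fan H {} r'" "fan H (cl ` set r') [y']"
            using r by (simp_all add: fan_append)
          have L: "is_letter y" "is_letter y'" using fr by auto
          have dr: "cl y \<notin> cl ` set r" "cl y' \<notin> cl ` set r'" using fr(2,4) fan_disjoint by (metis list.set_intros(1))+
          have Sr: "insert (cl y) (cl ` set r) = insert (cl y') (cl ` set r')" using r(3) by simp
          have ne: "cl y \<noteq> cl y'" using r(9) by simp
          have y'r: "cl y' \<in> cl ` set r" using Sr ne by (metis insert_iff)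
          have yr': "cl y \<in> cl ` set r'" using Sr ne by (metis insert_iff)
          have rK: "cl ` set r = insert (cl y') M" using y'r by (simp only: M_def insert_Diff)
          have r'K: "cl ` set r' = insert (cl y) M"
            unfolding M_def using Sr dr ne by (metis Diff_insert_absorb insert_Diff_if singletonD)
          have up: "\<forall>s\<in>cl ` set r. s < cl y" "is_primed y = H (cl y)"
            using fr(2) y'r r(9) r(6) by (auto dest!: bspec[of _ _ "cl y'"])
          have down: "\<forall>s\<in>cl ` set r'. cl y' < s" "is_primed y' = H (Min (cl ` set r'))"
            using fr(4) yr' r(9) r(7) by (auto dest!: bspec[of _ _ "cl y"])
          show ?thesis
          \<comment> \<open>With two letters there is no element in between, and the relations on
            the first two letters replace the Knuth relation.\<close>
          proof (cases "M = {}")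
            case True
            then have sing: "cl ` set r = {cl y'}" "cl ` set r' = {cl y}" using rK r'K by simp_all
            then have "length r = card (cl ` set r)" "length r' = card (cl ` set r')"
              using fan_distinct[OF fr(1)] fan_distinct[OF fr(3)] by (metis distinct_card length_map set_map)+
            then obtain u u' where u: "r = [u]" "r' = [u']"
              using sing by (auto simp: length_Suc_conv)
            then have "ock_equiv (u # y # []) (u' # y' # [])"
              using sing fr L up down
              by (intro ock_equiv_init_swap) auto
            then show ?thesis by (simp add: u)
          next
            case K: False
            have Mr: "M \<subseteq> cl ` set r" "M \<subseteq> cl ` set r'" by (simp_all only: rK r'K subset_insertI)
            have "1 \<le> c" if "c \<in> cl ` set r" for c
              using that fan_letter[OF fr(1)] cl_letter_pos by auto
            then have "0 \<notin> M" using Mr(1) by fastforce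
            moreover have "finite M" using Mr(1) by (rule finite_subset) simp
            ultimately have "finite M" "0 \<notin> M" by simp_all
            then obtain q where q: "fan H {} q" "cl ` set q = M" by (rule fan_exists)
            have K': "\<forall>k\<in>M. cl y' < k \<and> k < cl y"
            proof
              fix k assume k: "k \<in> M"
              show "cl y' < k \<and> k < cl y"
                using bspec[OF up(1) subsetD[OF Mr(1) k]] bspec[OF down(1) subsetD[OF Mr(2) k]] by simp
            qed
            have dn: "is_primed y' = H (Min (insert (cl y) M))" using down(2) by (simp only: r'K)
            have qy: "fan H M (y # y' # [])"
              using K' up(2) dn r(9) L by simp
            obtain k where k: "k \<in> M" using K by blast
            have finM: "finite M" using q(2) by (metis List.finite_set finite_imageI)
            have "cl y' < k" "k < cl y" using K' k by simp_all
            then have yq: "fan H M (y' # y # [])"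
              using qy fan_swap[OF finM k, of y' y H "[]"] by (simp only:)
            have q1: "fan H {} (q @ [y])" "fan H {} (q @ [y'])"
              using q qy yq by (auto simp: fan_append)
            have "ock_equiv r (q @ [y'])"
              by (rule less.hyps[OF r(4) fr(1) q1(2)]) (simp add: rK q(2))
            then have e1: "ock_equiv (r @ [y]) (q @ [y', y])" using ock_equiv_append[of r "q @ [y']" "[y]"] by simp
            have "ock_equiv r' (q @ [y])"
              by (rule less.hyps[OF r(5) fr(3) q1(1)]) (simp add: r'K q(2))
            then have e2: "ock_equiv (r' @ [y']) (q @ [y, y'])" using ock_equiv_append[of r' "q @ [y]" "[y']"] by simp
            have "q \<noteq> []" using q(2) K by auto
            \<comment> \<open>The last letter of \<open>q\<close> acts as the middle letter of the
              second Knuth relation.\<close>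
            then obtain q0 B where B: "q = q0 @ [B]" by (cases q rule: rev_cases) auto
            have "cl B \<in> M" "is_letter B" using q B fan_letter[OF q(1)] by auto
            then have "\<lceil>y'\<rceil> < \<lceil>B\<rceil>" "\<lceil>B\<rceil> < \<lceil>y\<rceil>" using K' L ceiling_letter by auto
            then have "ock_step (q0 @ [B, y, y'] @ []) (q0 @ [B, y', y] @ [])" by (rule ock_step.knuth2)
            then have "ock_equiv (q @ [y, y']) (q @ [y', y])" using B by (simp add: r_into_equivclp)
            then show ?thesis using e1 e2 by (meson equivclp_sym equivclp_trans)
          qed
        qed
        have "cl x < cl x' \<or> cl x' < cl x" using False by linarith
        then show ?thesis
        proof
          assume "cl x' < cl x"
          then show ?thesis unfolding w w' 
            using less.prems lp p p' len by (intro main) (simp_all add: w w')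
        next
          assume "cl x < cl x'"
          then have "ock_equiv (p' @ [x']) (p @ [x])"
            using less.prems lp p p' len by (intro main) (simp_all add: w w')
          then show ?thesis unfolding w w' by (rule equivclp_sym)
        qed
      qed
    qed
  qed
qed

section \<open>One-row tableaux\<close>

lemma increasing_fan:
  assumes "sorted_wrt (\<lambda>x y. cl x < cl y) w" "\<forall>x\<in>set w. is_letter x"
  obtains H where "fan H {} w"
proof -
  define H where "H c \<longleftrightarrow> (\<exists>x\<in>set w. cl x = c \<and> is_primed x)" for c
  have inj: "x = y" if "x \<in> set w" "y \<in> set w" "cl x = cl y" for x y
    using assms(1) that by (metis in_set_conv_nth less_irrefl linorder_neqE_nat sorted_wrt_iff_nth_less)
  have "fan H S v" if "sorted_wrt (\<lambda>x y. cl x < cl y) v" "set v \<subseteq> set w" "\<forall>s\<in>S. \<forall>x\<in>set v. s < cl x" for S v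
    using that
  proof (induction v arbitrary: S)
    case (Cons x v)
    have "is_primed x = H (cl x)" using Cons.prems(2) inj by (auto simp: H_def)
    moreover have "fan H (insert (cl x) S) v" using Cons.prems by (intro Cons.IH) auto
    ultimately show ?case using Cons.prems assms(2) by auto
  qed simp
  then show thesis using that assms(1) by blast
qed

text \<open>A descending letter closes a gap named by the previous minimum, so \<open>H\<close> is
  built along the recursion: \<open>K\<close> prescribes it away from the gaps still to come, and
  updating \<open>K\<close> at \<open>Min S\<close> records the prime of the current letter.\<close>

lemma decreasing_fan:
  assumes "sorted_wrt (\<lambda>x y. cl x > cl y) w" "\<forall>x\<in>set w. is_letter x"
  obtains H where "fan H {} w"
proof -
  have "\<exists>H. fan H S w \<and> (\<forall>c. c \<notin> insert (Min S) (cl ` set w) \<longrightarrow> H c = K c)" 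
    if "sorted_wrt (\<lambda>x y. cl x > cl y) w" "\<forall>x\<in>set w. is_letter x"
      "finite S" "\<forall>s\<in>S. \<forall>x\<in>set w. cl x < s" for S K w
    using that
  proof (induction w arbitrary: S K)
    case (Cons x w)
    let ?S = "insert (cl x) S"
    have m: "Min ?S = cl x" using Cons.prems by (intro Min_eqI) (auto simp: less_imp_le)
    obtain H where H: "fan H ?S w" "\<forall>c. c \<notin> insert (cl x) (cl ` set w) \<longrightarrow> H c = (K(Min S := is_primed x)) c"
      using Cons.IH[of ?S "K(Min S := is_primed x)"] Cons.prems m by auto
    have "H (Min S) = is_primed x" if "S \<noteq> {}"
    proof -
      have "Min S \<in> S" using that Cons.prems(3) by simp
      then have "Min S \<notin> insert (cl x) (cl ` set w)" using Cons.prems(4) by fastforce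
      then show ?thesis using H(2) by simp
    qed
    then have "fan H S (x # w)" using H(1) Cons.prems by auto
    then show ?case using H(2) by (intro exI[of _ H]) auto
  qed auto
  from this[of w "{}"] show thesis using assms that by auto
qed

text \<open>A strictly monotone row could contain \<open>x'\<close> next to \<open>x\<close>, but an
  involution word cannot. So the ceilings are strictly monotone as well, and the row is a fan going
  in one direction.\<close>

lemma one_row_fan:
  assumes "O_reduced_tableau z T" "T = [r]"
  obtains H where "gapped_fan H (cl ` set r) r" "z = fan_inv (cl ` set r)"
proof -
  have r: "r \<in> R_O z" "sorted_wrt (<) r \<or> sorted_wrt (>) r"
    using assms by (auto simp: O_reduced_tableau_def row_word_def rows_columns_sorted_def)
  then have L: "\<forall>x\<in>set r. is_letter x" using invol_path_letter by (auto simp: R_O_def)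
  have "inj (id :: nat \<Rightarrow> nat)" by (simp add: inj_on_id)
  then have s: "successively (\<lambda>a b. cl a \<noteq> cl b) r" 
    using r(1) invol_path_successively[of id r z] by (simp add: R_O_def)
  have "\<exists>H. fan H {} r"
    using r(2)
  proof
    assume "sorted_wrt (<) r"
    then have "successively (<) r" by (simp add: successively_if_sorted_wrt)
    then have "successively (\<lambda>a b. cl a < cl b) r"
      using s by (induction r rule: induct_list012) (auto simp: le_neq_implies_less cl_mono)
    then have "sorted_wrt (\<lambda>a b. cl a < cl b) r"
      by (subst (asm) successively_conv_sorted_wrt) (auto simp: transp_def)
    then show ?thesis using L increasing_fan by blast
  next
    assume "sorted_wrt (>) r"
    then have "successively (>) r" by (simp add: successively_if_sorted_wrt)
    then have "successively (\<lambda>a b. cl a > cl b) r"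
      using s by (induction r rule: induct_list012) (auto simp: le_neq_implies_less cl_mono)
    then have "sorted_wrt (\<lambda>a b. cl a > cl b) r"
      by (subst (asm) successively_conv_sorted_wrt) (auto simp: transp_def)
    then show ?thesis using L decreasing_fan by blast
  qed
  then obtain H where H: "fan H {} r" by blast
  then have "gap_ok {} r" "z = fan_inv (cl ` set r)" using R_O_fan r(1) by blast+
  then show thesis using that H by (auto simp: gapped_fan_def)
qed

text \<open>Invariance of \<open>gapped_fan\<close> gives one inclusion and
  \<open>fans_connected\<close> the other. A fan found to be equivalent to \<open>r\<close> inherits
  \<open>gap_ok\<close>, which places it in \<open>R_O z\<close>.\<close>

lemma RF_O_tab_fans:
  assumes "gapped_fan H I r" "z = fan_inv I"
  shows "RF_O_tab n z [r] = fans n H I"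
proof -
  have "w \<in> R_O z \<and> ock_equiv w r \<longleftrightarrow> fan H {} w \<and> cl ` set w = I" for w
  proof
    assume "w \<in> R_O z \<and> ock_equiv w r"
    then have "ock_equiv r w" by (meson equivclp_sym)
    then have "gapped_fan H I w" using assms gapped_fan_ock_equiv by blast
    then show "fan H {} w \<and> cl ` set w = I" by (simp add: gapped_fan_def)
  next
    assume w: "fan H {} w \<and> cl ` set w = I"
    then have e: "ock_equiv w r" using assms(1) by (intro fans_connected[of H]) (auto simp: gapped_fan_def)
    then have "ock_equiv r w" by (meson equivclp_sym)
    then have "gapped_fan H I w" using assms gapped_fan_ock_equiv by blast
    then show "w \<in> R_O z \<and> ock_equiv w r" using e R_O_fan[of H w z] assms(2) by (auto simp: gapped_fan_def)
  qed
  then show ?thesis unfolding RF_O_tab_def RF_O_def fans_def row_word_def by auto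
qed


section \<open>The hook-shaped weak composition\<close>

text \<open>Row \<open>i\<close> of the diagram lists the smaller values to the right. If the
  permutations agree before \<open>i\<close> and \<open>w' i < w i\<close>, then \<open>w' i\<close>
  is such a value for \<open>w\<close>, hence by equality of the rows a value of \<open>w'\<close>
  smaller than itself.\<close>

lemma rothe_diagram_inj:
  assumes w: "w permutes {1..}" and w': "w' permutes {1..}" and eq: "rothe_diagram w = rothe_diagram w'"
  shows "w = w'"
proof
  fix i
  show "w i = w' i"
  proof (induction i rule: less_induct)
    case (less i)
    have row: "v i \<in> {u j | j. i < j \<and> u j < u i}"
      if uv: "u permutes {1..}" "v permutes {1..}" "\<And>p. p < i \<Longrightarrow> u p = v p" "v i < u i" for u v :: "nat \<Rightarrow> nat"
    proof -
      obtain j where j: "u j = v i" using permutes_surj[OF uv(1)] by (metis surjD)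
      have "\<not> j < i"
      proof
        assume "j < i"
        then have "v j = v i" using uv(3) j by metis
        then show False using \<open>j < i\<close> permutes_inj[OF uv(2)] by (simp add: inj_eq)
      qed
      then show ?thesis using j uv(4) by (metis (mono_tags, lifting) linorder_neqE_nat mem_Collect_eq less_irrefl)
    qed
    have R: "{u j | j. i < j \<and> u j < u i} = {c. (i, c) \<in> rothe_diagram u}" if "1 \<le> i" for u
      using that by (auto simp: rothe_diagram_def)
    show ?case
    proof (cases "i = 0")
      case True
      then show ?thesis using permutes_not_in[OF w, of 0] permutes_not_in[OF w', of 0] by simp
    next
      case False
      then have i: "1 \<le> i" by simp
      have E: "{w j | j. i < j \<and> w j < w i} = {w' j | j. i < j \<and> w' j < w' i}" using R[OF i] eq by simp
      have "w' i \<in> {w' j | j. i < j \<and> w' j < w' i}" if "w' i < w i"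
        using row[OF w w' less that] unfolding E .
      moreover have "w i \<in> {w j | j. i < j \<and> w j < w i}" if "w i < w' i"
        using row[OF w' w less[symmetric] that] unfolding E .
      ultimately have "\<not> w' i < w i" "\<not> w i < w' i" by force+
      then show ?thesis by simp
    qed
  qed
qed

definition hook :: "nat \<Rightarrow> nat \<Rightarrow> nat" where
  "hook k p = (if p = 1 then k else if 2 \<le> p \<and> p \<le> k then 1 else 0)"

lemma w_dom_hook:
  assumes "1 \<le> k"
  shows "w_dom (hook k) = transpose 1 (Suc k)"
  unfolding w_dom_def
proof (rule the_equality)
  let ?t = "transpose 1 (Suc k)"
  have p: "?t permutes {1..}" by (intro permutes_swap_id) auto
  have "{i. ?t i \<noteq> i} \<subseteq> {1, Suc k}" by (auto simp: transpose_def)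
  then have "?t \<in> S_inf" using p finite_subset by (auto simp: S_inf_def)
  moreover have "dominant ?t"
    unfolding dominant_def using assms by (auto simp: transpose_def split: if_splits)
  moreover have r: "rothe_diagram ?t = young_diagram (hook k)"
  proof (rule set_eqI, clarify)
    fix i c
    have "(i, c) \<in> rothe_diagram ?t \<longleftrightarrow> 1 \<le> i \<and> (\<exists>j. i < j \<and> ?t j < ?t i \<and> c = ?t j)"
      by (auto simp: rothe_diagram_def)
    \<comment> \<open>The position \<open>j\<close> of the value \<open>c\<close> is
      \<open>?t c\<close>, as a transposition is its own inverse.\<close>
    also have "\<dots> \<longleftrightarrow> 1 \<le> i \<and> i < ?t c \<and> c < ?t i"
      by (metis transpose_involutory)
    also have "\<dots> \<longleftrightarrow> (i, c) \<in> young_diagram (hook k)"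
      using assms by (auto simp: young_diagram_def hook_def transpose_def split: if_splits)
    finally show "(i, c) \<in> rothe_diagram ?t \<longleftrightarrow> (i, c) \<in> young_diagram (hook k)" .
  qed
  ultimately show "?t \<in> S_inf \<and> dominant ?t \<and> rothe_diagram ?t = young_diagram (hook k)" by blast
  fix w assume "w \<in> S_inf \<and> dominant w \<and> rothe_diagram w = young_diagram (hook k)"
  then show "w = ?t" using rothe_diagram_inj[of w ?t] p r by (auto simp: S_inf_def)
qed

text \<open>\<open>perm_length\<close> is a \<open>card\<close>, so comparing inversion sets by
  inclusion requires their finiteness.\<close>

lemma finite_inversions:
  assumes "u \<in> S_inf"
  shows "finite {(i, j). 1 \<le> i \<and> i < j \<and> u i > u j}"
proof -
  have fin: "finite {i. u i \<noteq> i}" and u: "inj u" using assms permutes_inj by (auto simp: S_inf_def)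
  \<comment> \<open>A bound above all moved points and their images; both positions of an inversion
    lie below it.\<close>
  define N where "N = Suc (Max (insert 0 ({i. u i \<noteq> i} \<union> u ` {i. u i \<noteq> i})))"
  have N: "x < N" if "x \<in> {i. u i \<noteq> i} \<union> u ` {i. u i \<noteq> i}" for x
    unfolding N_def less_Suc_eq_le using fin that by (intro Max_ge) auto
  have "j < N" if "i < j" "u i > u j" for i j
  proof (cases "u j = j")
    case True
    then have "u i \<noteq> i" using that by auto
    then have "u i < N" using N by blast
    then show ?thesis using that True by simp
  qed (use N in blast)
  then have "{(i, j). 1 \<le> i \<and> i < j \<and> u i > u j} \<subseteq> {..<N} \<times> {..<N}" by fastforce
  then show ?thesis by (rule finite_subset) simp
qed

lemma simple_refl_S_inf:
  assumes "u \<in> S_inf" "1 \<le> j"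
  shows "simple_refl j \<circ> u \<in> S_inf"
proof -
  have "simple_refl j permutes {1..}" unfolding simple_refl_def using assms by (intro permutes_swap_id) auto
  then have "simple_refl j \<circ> u permutes {1..}" using assms by (auto simp: S_inf_def intro: permutes_compose)
  moreover have "{i. (simple_refl j \<circ> u) i \<noteq> i} \<subseteq> {i. u i \<noteq> i} \<union> {j, Suc j}"
    by (auto simp: simple_refl_def transpose_def)
  ultimately show ?thesis using assms finite_subset by (auto simp: S_inf_def)
qed

text \<open>Only the positions \<open>a\<close> and \<open>b\<close> of the values \<open>j\<close>
  and \<open>j + 1\<close> can form a new inversion.\<close>

lemma perm_length_simple_refl:
  assumes "u \<in> S_inf"
  shows "perm_length (simple_refl j \<circ> u) \<le> Suc (perm_length u)"
proof -
  let ?inv = "{(i, j). 1 \<le> i \<and> i < j \<and> u i > u j}"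
  have inj: "inj u" using assms permutes_inj by (auto simp: S_inf_def)
  have surj: "surj u" using assms permutes_surj by (auto simp: S_inf_def)
  then obtain a b where ab: "u a = j" "u b = Suc j" by (metis surjD)
  have ua: "u x = j \<longleftrightarrow> x = a" "u x = Suc j \<longleftrightarrow> x = b" for x using inj ab by (metis injD)+
  have "{(p, q). 1 \<le> p \<and> p < q \<and> (simple_refl j \<circ> u) p > (simple_refl j \<circ> u) q} \<subseteq> insert (a, b) ?inv"
  proof clarsimp
    fix p q assume pq: "p < q" "simple_refl j (u q) < simple_refl j (u p)" "(p = a) \<longrightarrow> q \<noteq> b"
    show "u q < u p"
    proof (rule ccontr)
      assume "\<not> u q < u p"
      moreover have "u p \<noteq> u q" using pq(1) inj by (metis injD less_irrefl)
      ultimately have "u p = j \<and> u q = Suc j"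
        using pq(2) by (auto simp: simple_refl_def transpose_def split: if_splits)
      then show False using pq(3) ua by simp
    qed
  qed
  then have "perm_length (simple_refl j \<circ> u) \<le> card (insert (a, b) ?inv)"
    unfolding perm_length_def using finite_inversions[OF assms] by (intro card_mono) auto
  also have "\<dots> \<le> Suc (perm_length u)" unfolding perm_length_def by (rule card_insert_le_m1) simp_all
  finally show ?thesis .
qed

lemma interval_or_gap:
  assumes "finite I" "0 \<notin> I"
  shows "I = {1..card I} \<or> (\<exists>j. 1 \<le> j \<and> j \<notin> I \<and> Suc j \<in> I)"
proof (rule disjCI)
  assume n: "\<not> (\<exists>j. 1 \<le> j \<and> j \<notin> I \<and> Suc j \<in> I)"
  have down: "j \<in> I" if "1 \<le> j" "j \<le> m" "m \<in> I" for j m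
    using that(2,3,1)
  proof (induction m rule: dec_induct)
    case (step m)
    have "1 \<le> m" using step by simp
    then show ?case using n step by blast
  qed simp
  show "I = {1..card I}"
  proof (cases "I = {}")
    case False
    then have M: "Max I \<in> I" using assms by simp
    have "I = {1..Max I}"
    proof
      show "I \<subseteq> {1..Max I}" using assms by (auto simp: Suc_le_eq intro: gr0I)
      show "{1..Max I} \<subseteq> I" using down M by auto
    qed
    then show ?thesis by (metis card_atLeastAtMost diff_Suc_1)
  qed simp
qed

text \<open>Unless \<open>I\<close> is an initial interval, some \<open>j + 1\<close> in
  \<open>I\<close> can be moved down to a free \<open>j\<close>, which lowers the sum by one;
  undoing the move lengthens the permutation by at most one. Strict monotonicity will send 1 to
  \<open>Min I\<close>, the place of the largest part.\<close>

lemma short_permutation_exists: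
  assumes "finite I" "0 \<notin> I"
  shows "\<exists>u\<in>S_inf. u ` {1..card I} = I \<and> strict_mono_on {1..card I} u \<and>
    perm_length u + \<Sum>{1..card I} \<le> \<Sum>I"
  using assms
proof (induction "\<Sum>I" arbitrary: I rule: less_induct)
  case less
  from interval_or_gap[OF less.prems] show ?case
  proof
    assume I: "I = {1..card I}"
    have "{(i, j). (1::nat) \<le> i \<and> i < j \<and> id i > id j} = {}" by auto
    then have "perm_length id = 0" unfolding perm_length_def by (metis card.empty)
    moreover have "id \<in> S_inf" by (simp add: S_inf_def permutes_id)
    ultimately show ?thesis using I by (intro bexI[of _ id]) (auto simp: strict_mono_on_def)
  next
    assume "\<exists>j. 1 \<le> j \<and> j \<notin> I \<and> Suc j \<in> I"
    then obtain j where j: "1 \<le> j" "j \<notin> I" "Suc j \<in> I" by blast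
    define J where "J = simple_refl j ` I"
    have inj: "inj (simple_refl j)" by (metis injI simple_refl_simps(4))
    have JI: "simple_refl j ` J = I" by (simp add: J_def image_comp)
    have fJ: "finite J" using less.prems(1) by (simp add: J_def)
    have cJ: "card J = card I" unfolding J_def using inj by (intro card_image) (metis inj_on_subset subset_UNIV)
    have J: "j \<in> J" "Suc j \<notin> J"
    proof -
      show "j \<in> J" unfolding J_def using j(3) by (metis image_eqI simple_refl_simps(2))
      show "Suc j \<notin> J" unfolding J_def using j(2) by (metis imageE simple_refl_simps(1,4))
    qed
    have "0 \<notin> J" unfolding J_def using j(1) less.prems(2) by (auto simp: simple_refl_def transpose_def split: if_splits)
    have "J = insert j (I - {Suc j})"
      unfolding J_def using j by (auto simp: simple_refl_def transpose_def image_iff)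
    then have "\<Sum>J = j + \<Sum>(I - {Suc j})" using j(2) less.prems(1) by simp
    moreover have "\<Sum>I = Suc j + \<Sum>(I - {Suc j})" using j(3) less.prems(1) by (simp add: sum.remove)
    ultimately have s: "\<Sum>I = Suc (\<Sum>J)" by simp
    obtain u where u: "u \<in> S_inf" "u ` {1..card I} = J" "strict_mono_on {1..card I} u"
      "perm_length u + \<Sum>{1..card I} \<le> \<Sum>J"
      using less.hyps[of J] s fJ \<open>0 \<notin> J\<close> unfolding cJ by auto
    \<comment> \<open>The order is preserved because \<open>j + 1\<close> is not in
      \<open>J\<close>, so the two exchanged values never occur together.\<close>
    have "strict_mono_on {1..card I} (simple_refl j \<circ> u)"
    proof (rule strict_mono_onI)
      fix p q assume pq: "p \<in> {1..card I}" "q \<in> {1..card I}" "p < q"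
      then have "u p < u q" using u(3) by (auto simp: strict_mono_on_def)
      moreover have "u p \<in> J" "u q \<in> J" using pq u(2) by blast+
      then have "u p \<noteq> Suc j" "u q \<noteq> Suc j" using J(2) by metis+
      ultimately show "(simple_refl j \<circ> u) p < (simple_refl j \<circ> u) q"
        by (auto simp: simple_refl_def transpose_def)
    qed
    moreover have "(simple_refl j \<circ> u) ` {1..card I} = I" by (simp only: image_comp[symmetric] u(2) JI)
    moreover have "perm_length (simple_refl j \<circ> u) + \<Sum>{1..card I} \<le> \<Sum>I"
      using perm_length_simple_refl[OF u(1), of j] u(4) s by linarith
    ultimately show ?thesis using simple_refl_S_inf[OF u(1) j(1)] by blast
  qed
qed

lemma alpha_O_one_row:
  assumes "I = cl ` set r" "r \<noteq> []"
  shows "alpha_O [r] p = (if p = Min I then card I else if p \<in> I then 1 else 0)"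
proof -
  have fin: "finite I" "I \<noteq> {}" using assms by auto
  define xs where "xs = sorted_list_of_set I"
  have xs: "sorted_list_of_set ((\<lambda>x. nat \<lceil>x\<rceil>) ` (\<Union>r\<in>set [r]. set r)) = xs"
    using assms by (simp add: xs_def cl_def)
  have len: "length xs = card I" and d: "distinct xs" and sx: "set xs = I" using fin by (auto simp: xs_def)
  obtain ys where ys: "xs = Min I # ys" using fin sorted_list_of_set_nonempty[of I] by (auto simp: xs_def)
  have "alpha_O [r] p = card I * unit_comp (Min I) p + (\<Sum>j = 1..<length xs. unit_comp (xs ! j) p)"
    unfolding alpha_O_def Let_def xs len by (simp add: ys)
  also have "(\<Sum>j = 1..<length xs. unit_comp (xs ! j) p) = (\<Sum>j<length ys. unit_comp (ys ! j) p)"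
    unfolding ys by (simp add: sum.shift_bounds_Suc_ivl atLeast0LessThan del: sum.op_ivl_Suc)
  also have "\<dots> = (\<Sum>y\<leftarrow>ys. unit_comp y p)" by (simp add: sum_list_sum_nth atLeast0LessThan)
  also have "\<dots> = (\<Sum>y\<in>set ys. unit_comp y p)" using d ys by (intro sum_list_distinct_conv_sum_set) simp
  also have "\<dots> = (if p \<in> set ys then 1 else 0)" by (simp add: unit_comp_def)
  finally show ?thesis using ys sx d by (auto simp: unit_comp_def)
qed

lemma sort_comp_hook:
  assumes I: "finite I" "I \<noteq> {}" and \<alpha>: "\<And>p. \<alpha> p = (if p = Min I then card I else if p \<in> I then 1 else 0)"
  shows "sort_comp \<alpha> = hook (card I)"
proof -
  have pos: "0 < card I" using I by (simp add: card_gt_0_iff)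
  have M: "Min I \<in> I" using I by simp
  have supp: "{i. \<alpha> i \<noteq> 0} = I" using pos M by (auto simp: \<alpha>)
  define ys where "ys = sorted_list_of_set (I - {Min I})"
  have xs: "sorted_list_of_set I = Min I # ys" using sorted_list_of_set_nonempty[OF I] by (simp add: ys_def)
  have ys: "set ys = I - {Min I}" "length ys = card I - 1" using I by (auto simp: ys_def)
  have "map \<alpha> ys = replicate (card I - 1) 1"
    using ys by (intro replicate_eqI) (auto simp: \<alpha>)
  then have m: "map \<alpha> (sorted_list_of_set I) = card I # replicate (card I - 1) 1"
    by (simp add: xs \<alpha>)
  have "sort (card I # replicate (card I - 1) 1) = replicate (card I - 1) 1 @ [card I]"
    using pos by (intro properties_for_sort) (auto simp: sorted_append sorted_replicate)
  then have "rev (sort (map \<alpha> (sorted_list_of_set {i. \<alpha> i \<noteq> 0}))) = card I # replicate (card I - 1) 1"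
    unfolding supp m by simp
  then show ?thesis
    using pos by (auto simp: fun_eq_iff sort_comp_def Let_def hook_def nth_Cons')
qed

text \<open>The permutation \<open>v\<close> shows that the minimum is taken over a nonempty set and
  bounds it. Every candidate carries the support of the partition onto that of the composition, so
  the image and the length bound follow without identifying \<open>u_perm\<close> with
  \<open>v\<close>.\<close>

lemma u_perm_hook:
  assumes I: "finite I" "I \<noteq> {}" "0 \<notin> I"
    and \<alpha>: "\<And>p. \<alpha> p = (if p = Min I then card I else if p \<in> I then 1 else 0)"
  shows "u_perm \<alpha> ` {1..card I} = I" "perm_length (u_perm \<alpha>) + \<Sum>{1..card I} \<le> \<Sum>I"
proof -
  let ?k = "card I"
  let ?P = "\<lambda>u. u \<in> S_inf \<and> \<alpha> = sort_comp \<alpha> \<circ> inv u"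
  have pos: "0 < ?k" using I by (simp add: card_gt_0_iff)
  have M: "Min I \<in> I" using I by simp
  have l: "sort_comp \<alpha> = hook ?k" using I(1,2) \<alpha> by (rule sort_comp_hook)
  obtain v where v: "v \<in> S_inf" "v ` {1..?k} = I" "strict_mono_on {1..?k} v" 
    "perm_length v + \<Sum>{1..?k} \<le> \<Sum>I"
    using short_permutation_exists[OF I(1,3)] by blast
  have bv: "bij v" using v(1) permutes_bij by (auto simp: S_inf_def)
  have "v 1 = Min I"
  proof (rule Min_eqI[symmetric])
    show "v 1 \<in> I" using v(2) pos by auto
    fix y assume "y \<in> I"
    then obtain q where q: "q \<in> {1..?k}" "y = v q" using v(2) by blast
    show "v 1 \<le> y"
    proof (cases "q = 1")
      case False
      then show ?thesis using v(3) q pos by (auto simp: strict_mono_on_def intro!: less_imp_le)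
    qed (simp add: q)
  qed (rule I(1))
  have "\<alpha> (v q) = hook ?k q" for q
  proof -
    have "v q = Min I \<longleftrightarrow> q = 1" using \<open>v 1 = Min I\<close> bv by (metis bij_pointE)
    moreover have "v q \<in> I \<longleftrightarrow> q \<in> {1..?k}" using v(2) bv by (metis bij_is_inj inj_image_mem_iff)
    ultimately show ?thesis using pos by (auto simp: \<alpha> hook_def)
  qed
  then have "\<alpha> = hook ?k \<circ> inv v" using bv by (auto simp: fun_eq_iff) (metis bij_inv_eq_iff)
  then have Pv: "?P v" using v(1) l by simp
  have Pu: "?P (u_perm \<alpha>)" unfolding u_perm_def by (rule arg_min_natI[of ?P, OF Pv])
  have "perm_length (u_perm \<alpha>) \<le> perm_length v" unfolding u_perm_def by (rule arg_min_nat_le[of ?P, OF Pv])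
  then show "perm_length (u_perm \<alpha>) + \<Sum>{1..?k} \<le> \<Sum>I" using v(4) by simp
  have bu: "bij (u_perm \<alpha>)" using Pu permutes_bij by (auto simp: S_inf_def)
  have "\<alpha> (u_perm \<alpha> q) = hook ?k q" for q
    using Pu bu unfolding l by (metis bij_inv_eq_iff comp_apply)
  moreover have "hook ?k q \<noteq> 0 \<longleftrightarrow> q \<in> {1..?k}" for q using pos by (auto simp: hook_def)
  moreover have "\<alpha> p \<noteq> 0 \<longleftrightarrow> p \<in> I" for p using pos M by (auto simp: \<alpha>)
  ultimately have "u_perm \<alpha> q \<in> I \<longleftrightarrow> q \<in> {1..?k}" for q by metis
  then have "{1..?k} = u_perm \<alpha> -` I" by blast
  then show "u_perm \<alpha> ` {1..?k} = I" using surj_image_vimage_eq[OF bij_is_surj[OF bu]] by simp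
qed

theorem theorem5p11:
  fixes n :: nat and z :: "nat \<Rightarrow> nat" and T :: "real list list" and js :: "nat list"
  assumes "z \<in> I_inf"
    and "\<And>i. descent z i \<Longrightarrow> i \<le> n"
    and "O_reduced_tableau z T"
    and "length T = 1"
    and "js \<in> reduced_words (u_perm (alpha_O T))"
  shows "q_crystal_iso n (BRF_O_tab n z T) (BRF_O_comp n (alpha_O T) js)"
proof -
  obtain r where T: "T = [r]" using assms(4) by (auto simp: length_Suc_conv)
  have r: "r \<noteq> []" using assms(3) by (auto simp: T O_reduced_tableau_def shifted_tableau_def)
  define I where "I = cl ` set r"
  define k where "k = card I"
  obtain H where H: "gapped_fan H I r" "z = fan_inv I"
    using one_row_fan[OF assms(3) T] unfolding I_def by blast
  have I: "finite I" "I \<noteq> {}" using r by (auto simp: I_def)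
  have I0: "0 \<notin> I" using gapped_fan_letter[OF H(1)] cl_letter_pos by (fastforce simp: I_def)
  have k: "1 \<le> k" using I by (simp add: k_def Suc_le_eq card_gt_0_iff)
  let ?\<alpha> = "alpha_O T" and ?w = "transpose 1 (Suc k)" and ?F = "fans n (\<lambda>_. False) {1..k}"
  have \<alpha>: "?\<alpha> p = (if p = Min I then card I else if p \<in> I then 1 else 0)" for p
    unfolding T using alpha_O_one_row[OF I_def r] .
  have w: "w_dom (sort_comp ?\<alpha>) = ?w"
    using sort_comp_hook[OF I \<alpha>] w_dom_hook[OF k] by (simp add: k_def)
  have RF: "RF_O n ?w = ?F" using k by (rule RF_O_hook)
  have js: "set js \<subseteq> {1..}" "foldr (\<lambda>j w. simple_refl j \<circ> w) js id = u_perm ?\<alpha>" "length js = perm_length (u_perm ?\<alpha>)"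
    using assms(5) by (auto simp: reduced_words_def)
  note u = u_perm_hook[OF I I0 \<alpha>, folded k_def]
  have "BRF_O n ?w = {a \<in> ?F. bounded (rank {1..k}) a}"
    unfolding BRF_O_def RF using flag_bounded_interval by blast
  \<comment> \<open>The upper bound for the length of \<open>u_perm\<close> is the hypothesis
    \<open>len\<close> of \<open>foldr_demazure\<close>, and every reduced word meets it.\<close>
  moreover have "foldr (demazure n ?w) js {a \<in> ?F. bounded (rank {1..k}) a} = {a \<in> ?F. bounded (rank I) a}"
    using foldr_demazure[OF RF _ js(1), of "{1..k}"] u unfolding js(2,3) by (simp add: add.commute)
  ultimately have "BRF_O_comp n ?\<alpha> js = {a \<in> ?F. bounded (rank I) a}"
    unfolding BRF_O_comp_def Let_def w by simp
  also have "\<dots> = std I ` {a \<in> fans n H I. flag_bounded a}"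
    using std_flag_bounded[OF I(1) I0] by (simp add: k_def)
  also have "{a \<in> fans n H I. flag_bounded a} = BRF_O_tab n z T"
    unfolding BRF_O_tab_def T RF_O_tab_fans[OF H] ..
  finally have "BRF_O_comp n ?\<alpha> js = std I ` BRF_O_tab n z T" .
  moreover have "BRF_O_tab n z T \<subseteq> fans n H I"
    unfolding BRF_O_tab_def T RF_O_tab_fans[OF H] by blast
  ultimately show ?thesis using std_crystal_iso I(1) by simp
qed

end
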